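(* Consider the following setting: - A dual pair of Banach spaces $(\mathcal{X}=\mathcal{U}\oplus\mathcal{N}_{\boldsymbol{p}^*},\ \mathcal{X}'=\mathcal{U}'\oplus\mathcal{N}_{\boldsymbol{p}})$, where $\mathcal{N}_{\boldsymbol{p}}=\mathcal{N}'_{\boldsymbol{p}^*}$ is the vector space spanned by the finite-dimensional basis $\boldsymbol{p}=(p_1,\dots,p_{N_0})$. - The analysis subspace $\mathcal{N}_{\boldsymbol{\nu}}=\mathrm{span}\{\nu_m\}_{m=1}^M\subset\mathcal{X}$, with the $\nu_m$ linearly independent and $M>N_0$. - The linear measurement operator $\boldsymbol{\nu}:\mathcal{X}'\to\mathbb{R}^M$, $f\mapsto(\langle\nu_1,f\rangle,\dots,\langle\nu_M,f\rangle)$. - The vectors $\mathbf{v}_1,\dots,\mathbf{v}_{N_0}\in\mathbb{R}^M$ with $[\mathbf{v}_n]_m=\langle\nu_m,p_n\rangle$ are linearly independent; they admit a complementary set $\{\mathbf{u}_1,\dots,\mathbf{u}_{M-N_0}\}$ in $\mathbb{R}^M$ such that $\mathbb{R}^M=\mathrm{span}\{\mathbf{v}_n\}_{n=1}^{N_0}\oplus\mathrm{span}\{\mathbf{u}_m\}_{m=1}^{M-N_0}$. - A proper, lower-semicontinuous, coercive, and convex loss functional $E:\mathbb{R}^M\times\mathbb{R}^M\to\mathbb{R}^+\cup\{+\infty\}$. - A strictly increasing and convex function $\psi:\mathbb{R}^+\to\mathbb{R}^+$. Then, for any fixed $\boldsymbol{y}\in\mathbb{R}^M$, the solution set $$S=\arg\min_{f\in\mathcal{X}'}\Big(E\big(\boldsymbol{y},\boldsymbol{\nu}(f)\big)+\psi\big(\|f\|_{\mathcal{U}'}\big)\Big)$$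 is nonempty, convex, and weak*-compact. If $E$ is strictly convex, or if it imposes the equality constraint $\boldsymbol{y}=\boldsymbol{\nu}(f)$, then any solution $f_0\in S\subset\mathcal{X}'$ has a unique decomposition as $f_0=p_0+s_0$ with $p_0\in\mathcal{N}_{\boldsymbol{p}}$ and $s_0\in\mathcal{U}'$ a $(\mathcal{U}',\mathcal{U})$-conjugate of a common $\widetilde{\nu}_0\in\mathcal{U}$ whose generic form is $$\widetilde{\nu}_0=\sum_{m=1}^{M-N_0}a_m\widetilde{\nu}_m\in\mathcal{N}_{\boldsymbol{\nu}}\cap\mathcal{U}$$ with suitable coefficients $\boldsymbol{a}=(a_m)\in\mathbb{R}^{M-N_0}$ and reduced basis functions $\widetilde{\nu}_m=\widetilde{\mathbf{u}}_m^T\boldsymbol{\nu}\in\mathcal{U}$, where $\widetilde{\mathbf{u}}_m\in\mathbb{R}^M$ is the unique (biorthogonal) vector such that $\widetilde{\mathbf{u}}_m^T\mathbf{v}_n=0$ and $\widetilde{\mathbf{u}}_m^T\mathbf{u}_{m'}=\delta_{m,m'}$ for any $m,m'\in\{1,\dots,M-N_0\}$ and $n\in\{1,\dots,N_0\}$. Depending on the Banach characteristics of $\mathcal{U}'$, this then results in the following description of the solution(s): 1. If $\mathcal{U}'$ is a Hilbert space and $\psi$ is strictly convex, then the solution $f_0$ is unique and admits the linear representation $$f_0=\sum_{m=1}^{M-N_0}a_m\varphi_m+\sum_{n=1}^{N_0}b_np_n$$ with coefficients $(\boldsymbol{a},\boldsymbol{b})\in\mathbb{R}^M$ and basis functions $p_n\in\mathcal{N}_{\boldsymbol{p}}$,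 $\varphi_m=\mathrm{J}_{\mathcal{U}}\{\widetilde{\nu}_m\}\in\mathcal{U}'$, where $\mathrm{J}_{\mathcal{U}}$ is the Riesz map $\mathcal{U}\to\mathcal{U}'$. 2. If $\mathcal{U}'$ is a strictly convex Banach space and $\psi$ is strictly increasing, then the solution is unique and admits the parametric representation $$f_0=\mathrm{J}_{\mathcal{U}}\Big\{\sum_{m=1}^{M-N_0}a_m\widetilde{\nu}_m\Big\}+\sum_{n=1}^{N_0}b_np_n,$$ where $\mathrm{J}_{\mathcal{U}}:\mathcal{U}\to\mathcal{U}'$ is the (nonlinear) duality operator. 3. Otherwise, when $\mathcal{U}'$ is not strictly convex, the solution set is the weak*-closure of the convex hull of its extremal points, which can all be expressed as $$f_0=\sum_{k=1}^{K_0}c_ke_k+\sum_{n=1}^{N_0}b_np_n$$ for some $K_0\le M-N_0$ and $c_1,\dots,c_{K_0}\in\mathbb{R}$, where $e_1,\dots,e_{K_0}\in\mathcal{U}'$ are some extremal points of the unit ball $B_{\mathcal{U}'}=\{s\in\mathcal{U}':\|s\|_{\mathcal{U}'}\le1\}$. The vector $\boldsymbol{b}=(b_n)\in\mathbb{R}^{N_0}$ that characterizes the null-space component of $f_0$ is unique and common to all solutions whenever $E$ is strictly convex and $\mathcal{N}_{\boldsymbol{p}^*}\subset\mathcal{N}_{\boldsymbol{\nu}}$.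
   Context: All spaces are real; $\mathbb{R}^+=[0,\infty)$; $\mathcal{X}'$ is the continuous dual of the Banach space $\mathcal{X}$, and $\mathcal{U}'$ that of the Banach space $(\mathcal{U},\|\cdot\|_{\mathcal{U}})$; $\langle\nu,f\rangle=\langle f,\nu\rangle$ is the duality product. Direct-sum structure: $\mathcal{X}'=\mathcal{U}'\oplus\mathcal{N}_{\boldsymbol{p}}$ with $\mathcal{N}_{\boldsymbol{p}}=\mathrm{span}\{p_n\}_{n=1}^{N_0}$ of dimension $N_0$. There is a unique set $p_1^*,\dots,p_{N_0}^*\in\mathcal{X}$ with $\langle p_m^*,p_n\rangle=\delta_{m,n}$ and $\langle p_n^*,s\rangle=0$ for all $s\in\mathcal{U}'$; $\mathcal{N}_{\boldsymbol{p}^*}=\mathrm{span}\{p_n^*\}_{n=1}^{N_0}=\mathcal{N}_{\boldsymbol{p}}'$. Equivalently, $\mathcal{U}'=\{s\in\mathcal{X}':\langle p_n^*,s\rangle=0,\ n=1,\dots,N_0\}$ and $\mathcal{U}=\{u\in\mathcal{X}:\langle p_n,u\rangle=0,\ n=1,\dots,N_0\}$. The projectors are $\mathrm{Proj}_{\mathcal{N}_{\boldsymbol{p}}}\{f\}=\sum_n\langle p_n^*,f\rangle p_n$ and $\mathrm{Proj}_{\mathcal{U}'}=\mathrm{Id}-\mathrm{Proj}_{\mathcal{N}_{\boldsymbol{p}}}$. The norm of $\mathcal{X}'$ is the composite norm $\|f\|_{\mathcal{X}'}=\|(\|\mathrm{Proj}_{\mathcal{U}'}f\|_{\mathcal{U}'},\|\mathrm{Proj}_{\mathcal{N}_{\boldsymbol{p}}}f\|_{\mathcal{N}_{\boldsymbol{p}}})\|_{\mathcal{Z}'}\le\|\mathrm{Proj}_{\mathcal{U}'}f\|_{\mathcal{U}'}+\|\mathrm{Proj}_{\mathcal{N}_{\boldsymbol{p}}}f\|_{\mathcal{N}_{\boldsymbol{p}}}$,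 where $\|\cdot\|_{\mathcal{Z}'}$ is dual to an absolute norm on $\mathbb{R}^2$ (absolute: $\|(z_n)\|=\|(|z_n|)\|$). For $f\in\mathcal{X}'$, $\|f\|_{\mathcal{U}'}$ denotes the semi-norm $\|\mathrm{Proj}_{\mathcal{U}'}f\|_{\mathcal{U}'}$. For $\mathbf{w}\in\mathbb{R}^M$, $\mathbf{w}^T\boldsymbol{\nu}=\sum_m w_m\nu_m$. $E$ "imposes the equality constraint" means $E(\boldsymbol{y},\boldsymbol{z})=0$ if $\boldsymbol{z}=\boldsymbol{y}$ and $+\infty$ otherwise. Properness, lower semicontinuity, coercivity ($E(\boldsymbol{y},\boldsymbol{z})\to\infty$ as $\|\boldsymbol{z}\|\to\infty$) and (strict) convexity of $E$ are understood in the second argument for fixed data $\boldsymbol{y}$. Elements $\nu^*\in\mathcal{U}'$, $\nu\in\mathcal{U}$ are $(\mathcal{U}',\mathcal{U})$-conjugates if $\|\nu^*\|_{\mathcal{U}'}=\|\nu\|_{\mathcal{U}}$ and $\langle\nu,\nu^*\rangle=\|\nu\|_{\mathcal{U}}\|\nu^*\|_{\mathcal{U}'}$. When every $\nu$ has exactly one conjugate (e.g. when $\mathcal{U}'$ is strictly convex), the duality operator $\mathrm{J}_{\mathcal{U}}:\mathcal{U}\to\mathcal{U}'$ maps $\nu$ to it; in the Hilbert case it is the Riesz map. A Banach space is strictly convex if $\|\lambda f_1+(1-\lambda)f_2\|<1$ for all $\lambda\in(0,1)$ and unit-norm $f_1\neq f_2$. An extremal point of a convex set $C$ is $f\in C$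 such that $f=tf_1+(1-t)f_2$ with $f_1,f_2\in C$, $t\in(0,1)$ implies $f=f_1=f_2$. The representations in items 1-3 are under the assumption that $E$ is strictly convex or imposes the equality constraint. In item 3, "extremal points" of the solution set is to be read as solutions whose penalized component $s_0$ is an extremal point of the corresponding set of penalized components. *)

theory Defs
  imports "HOL-Analysis.Analysis"
begin

text \<open>
  The continuous dual of \<open>'x\<close> is the type \<open>'x \<Rightarrow>\<^sub>L real\<close>, with the operator norm; the duality
  product is application.  The weak* topology on it is the topology of pointwise convergence,
  which the library calls the strong operator topology.
\<close>

abbreviation weak_star :: "('x::real_normed_vector \<Rightarrow>\<^sub>L real) topology"
  where "weak_star \<equiv> strong_operator_topology"

definition lin_indep_family :: "('i \<Rightarrow> 'a::real_vector) \<Rightarrow> 'i set \<Rightarrow> bool"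
  where "lin_indep_family g I \<longleftrightarrow> inj_on g I \<and> independent (g ` I)"

definition direct_sum_UNIV :: "'a::real_vector set \<Rightarrow> 'a set \<Rightarrow> bool"
  where "direct_sum_UNIV V W \<longleftrightarrow> V \<inter> W = {0} \<and> {a + b | a b. a \<in> V \<and> b \<in> W} = UNIV"

definition norm_on :: "'a::real_vector set \<Rightarrow> ('a \<Rightarrow> real) \<Rightarrow> bool"
  where "norm_on V n \<longleftrightarrow>
    (\<forall>x\<in>V. 0 \<le> n x \<and> (n x = 0 \<longleftrightarrow> x = 0)) \<and>
    (\<forall>x\<in>V. \<forall>y\<in>V. n (x + y) \<le> n x + n y) \<and>
    (\<forall>x\<in>V. \<forall>c. n (c *\<^sub>R x) = \<bar>c\<bar> * n x)"

definition dual_norm :: "'a::real_vector set \<Rightarrow> ('a \<Rightarrow> real) \<Rightarrow> ('a \<Rightarrow> real) \<Rightarrow> real"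
  where "dual_norm V n \<phi> = (SUP v\<in>{v \<in> V. n v \<le> 1}. \<bar>\<phi> v\<bar>)"

definition strictly_convex_norm_on :: "'a::real_vector set \<Rightarrow> ('a \<Rightarrow> real) \<Rightarrow> bool"
  where "strictly_convex_norm_on V n \<longleftrightarrow>
    (\<forall>t\<in>{0<..<1}. \<forall>f\<in>V. \<forall>g\<in>V. n f = 1 \<and> n g = 1 \<and> f \<noteq> g \<longrightarrow>
       n (t *\<^sub>R f + (1 - t) *\<^sub>R g) < 1)"

definition inner_product_on ::
    "'a::real_vector set \<Rightarrow> ('a \<Rightarrow> real) \<Rightarrow> ('a \<Rightarrow> 'a \<Rightarrow> real) \<Rightarrow> bool"
  where "inner_product_on V n ip \<longleftrightarrow>
    (\<forall>x\<in>V. \<forall>y\<in>V. ip x y = ip y x) \<and>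
    (\<forall>x\<in>V. \<forall>y\<in>V. \<forall>z\<in>V. ip (x + y) z = ip x z + ip y z) \<and>
    (\<forall>x\<in>V. \<forall>y\<in>V. \<forall>c. ip (c *\<^sub>R x) y = c * ip x y) \<and>
    (\<forall>x\<in>V. ip x x = (n x)\<^sup>2)"

text \<open>
  Completeness is not part of the next definition: it is only applied to the dual space
  \<open>\<U>'\<close> below, which is complete.
\<close>

definition hilbert_norm_on :: "'a::real_vector set \<Rightarrow> ('a \<Rightarrow> real) \<Rightarrow> bool"
  where "hilbert_norm_on V n \<longleftrightarrow> (\<exists>ip. inner_product_on V n ip)"

text \<open>
  \<open>p 1, \<dots>, p N\<close> lie in the dual of \<open>'x\<close> and \<open>ps 1, \<dots>, ps N\<close> are the biorthonormal
  elements of \<open>'x\<close>.  The sets \<open>Uspace\<close> and \<open>Udual\<close> are \<open>\<U>\<close> and \<open>\<U>'\<close>, both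
  seen inside \<open>'x\<close> and its dual.
\<close>

definition Uspace :: "nat \<Rightarrow> (nat \<Rightarrow> 'x::real_normed_vector \<Rightarrow>\<^sub>L real) \<Rightarrow> 'x set"
  where "Uspace N p = {u. \<forall>n\<in>{1..N}. blinfun_apply (p n) u = 0}"

definition Udual :: "nat \<Rightarrow> (nat \<Rightarrow> 'x::real_normed_vector) \<Rightarrow> ('x \<Rightarrow>\<^sub>L real) set"
  where "Udual N ps = {s. \<forall>n\<in>{1..N}. blinfun_apply s (ps n) = 0}"

definition proj_Np ::
    "nat \<Rightarrow> (nat \<Rightarrow> 'x::real_normed_vector \<Rightarrow>\<^sub>L real) \<Rightarrow> (nat \<Rightarrow> 'x) \<Rightarrow> ('x \<Rightarrow>\<^sub>L real) \<Rightarrow> ('x \<Rightarrow>\<^sub>L real)"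
  where "proj_Np N p ps f = (\<Sum>n=1..N. blinfun_apply f (ps n) *\<^sub>R p n)"

definition proj_Udual ::
    "nat \<Rightarrow> (nat \<Rightarrow> 'x::real_normed_vector \<Rightarrow>\<^sub>L real) \<Rightarrow> (nat \<Rightarrow> 'x) \<Rightarrow> ('x \<Rightarrow>\<^sub>L real) \<Rightarrow> ('x \<Rightarrow>\<^sub>L real)"
  where "proj_Udual N p ps f = f - proj_Np N p ps f"

definition proj_Nps ::
    "nat \<Rightarrow> (nat \<Rightarrow> 'x::real_normed_vector \<Rightarrow>\<^sub>L real) \<Rightarrow> (nat \<Rightarrow> 'x) \<Rightarrow> 'x \<Rightarrow> 'x"
  where "proj_Nps N p ps x = (\<Sum>n=1..N. blinfun_apply (p n) x *\<^sub>R ps n)"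

definition proj_Uspace ::
    "nat \<Rightarrow> (nat \<Rightarrow> 'x::real_normed_vector \<Rightarrow>\<^sub>L real) \<Rightarrow> (nat \<Rightarrow> 'x) \<Rightarrow> 'x \<Rightarrow> 'x"
  where "proj_Uspace N p ps x = x - proj_Nps N p ps x"

definition Udual_norm ::
    "nat \<Rightarrow> (nat \<Rightarrow> 'x::real_normed_vector \<Rightarrow>\<^sub>L real) \<Rightarrow> ('x \<Rightarrow> real) \<Rightarrow> ('x \<Rightarrow>\<^sub>L real) \<Rightarrow> real"
  where "Udual_norm N p nU s = dual_norm (Uspace N p) nU (blinfun_apply s)"

text \<open>
  The norm of \<open>'x\<close> is composed from the norm \<open>nU\<close> of \<open>\<U>\<close>, the norm \<open>nN\<close> of the span of the
  \<open>ps n\<close>, and the absolute norm \<open>Z\<close>.  That the norm of the dual space is the corresponding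
  composite norm, with the dual of \<open>Z\<close>, is then a consequence: see \<open>norm_dual_composite\<close>.
  Since \<open>\<U>\<close> is closed in \<open>'x\<close>, on which its norm is a multiple of the ambient one, \<open>\<U>\<close> is a
  Banach space whenever \<open>'x\<close> is one.
\<close>

locale direct_sum_dual_pair =
  fixes N :: nat
    and p :: "nat \<Rightarrow> 'x::banach \<Rightarrow>\<^sub>L real"
    and ps :: "nat \<Rightarrow> 'x"
    and nU nN :: "'x \<Rightarrow> real"
    and Z :: "real \<times> real \<Rightarrow> real"
  assumes biorthonormal:
      "\<lbrakk>m \<in> {1..N}; n \<in> {1..N}\<rbrakk> \<Longrightarrow> blinfun_apply (p n) (ps m) = (if m = n then 1 else 0)"
    and norm_U: "norm_on (Uspace N p) nU"
    and norm_N: "norm_on (span (ps ` {1..N})) nN"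
    and norm_Z: "norm_on UNIV Z"
    and absolute_Z: "Z (a, b) = Z (\<bar>a\<bar>, \<bar>b\<bar>)"
    and dual_Z_le: "dual_norm UNIV Z (\<lambda>z. a * fst z + b * snd z) \<le> \<bar>a\<bar> + \<bar>b\<bar>"
    and norm_composite: "norm x = Z (nU (proj_Uspace N p ps x), nN (proj_Nps N p ps x))"

definition conjugates ::
    "nat \<Rightarrow> (nat \<Rightarrow> 'x::real_normed_vector \<Rightarrow>\<^sub>L real) \<Rightarrow> (nat \<Rightarrow> 'x) \<Rightarrow> ('x \<Rightarrow> real) \<Rightarrow>
      ('x \<Rightarrow>\<^sub>L real) \<Rightarrow> 'x \<Rightarrow> bool"
  where "conjugates N p ps nU s u \<longleftrightarrow> s \<in> Udual N ps \<and> u \<in> Uspace N p \<and>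
    Udual_norm N p nU s = nU u \<and> blinfun_apply s u = nU u * Udual_norm N p nU s"

definition duality_map ::
    "nat \<Rightarrow> (nat \<Rightarrow> 'x::real_normed_vector \<Rightarrow>\<^sub>L real) \<Rightarrow> (nat \<Rightarrow> 'x) \<Rightarrow> ('x \<Rightarrow> real) \<Rightarrow>
      'x \<Rightarrow> ('x \<Rightarrow>\<^sub>L real)"
  where "duality_map N p ps nU u = (THE s. conjugates N p ps nU s u)"

definition measure_op :: "('m::finite \<Rightarrow> 'x::real_normed_vector) \<Rightarrow> ('x \<Rightarrow>\<^sub>L real) \<Rightarrow> real ^ 'm"
  where "measure_op \<nu> f = (\<chi> m. blinfun_apply f (\<nu> m))"

definition biorthogonal ::
    "nat \<Rightarrow> nat \<Rightarrow> (nat \<Rightarrow> real ^ 'm) \<Rightarrow> (nat \<Rightarrow> real ^ 'm) \<Rightarrow> nat \<Rightarrow> real ^ 'm::finite \<Rightarrow> bool"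
  where "biorthogonal N K v u m w \<longleftrightarrow>
    (\<forall>n\<in>{1..N}. w \<bullet> v n = 0) \<and> (\<forall>m'\<in>{1..K}. w \<bullet> u m' = (if m = m' then 1 else 0))"

definition reduced_vec ::
    "nat \<Rightarrow> nat \<Rightarrow> (nat \<Rightarrow> real ^ 'm) \<Rightarrow> (nat \<Rightarrow> real ^ 'm) \<Rightarrow> nat \<Rightarrow> real ^ 'm::finite"
  where "reduced_vec N K v u m = (THE w. biorthogonal N K v u m w)"

text \<open>
  All notions concern the second argument, for each fixed data vector \<open>y\<close>.  Strict convexity
  is strict convexity on the effective domain.
\<close>

definition proper_loss :: "('d \<Rightarrow> 'd \<Rightarrow> ereal) \<Rightarrow> bool"
  where "proper_loss E \<longleftrightarrow> (\<forall>y. \<exists>z. E y z < \<infinity>)"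

definition lsc_loss :: "('d \<Rightarrow> 'd::topological_space \<Rightarrow> ereal) \<Rightarrow> bool"
  where "lsc_loss E \<longleftrightarrow> (\<forall>y z. E y z \<le> Liminf (at z) (E y))"

definition coercive_loss :: "('d \<Rightarrow> 'd::real_normed_vector \<Rightarrow> ereal) \<Rightarrow> bool"
  where "coercive_loss E \<longleftrightarrow> (\<forall>y. (E y \<longlongrightarrow> \<infinity>) at_infinity)"

definition convex_loss :: "('d \<Rightarrow> 'd::real_vector \<Rightarrow> ereal) \<Rightarrow> bool"
  where "convex_loss E \<longleftrightarrow> (\<forall>y z1 z2. \<forall>t\<in>{0<..<1}.
    E y (t *\<^sub>R z1 + (1 - t) *\<^sub>R z2) \<le> ereal t * E y z1 + ereal (1 - t) * E y z2)"

definition strictly_convex_loss :: "('d \<Rightarrow> 'd::real_vector \<Rightarrow> ereal) \<Rightarrow> bool"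
  where "strictly_convex_loss E \<longleftrightarrow> (\<forall>y z1 z2. \<forall>t\<in>{0<..<1}.
    z1 \<noteq> z2 \<and> E y z1 < \<infinity> \<and> E y z2 < \<infinity> \<longrightarrow>
    E y (t *\<^sub>R z1 + (1 - t) *\<^sub>R z2) < ereal t * E y z1 + ereal (1 - t) * E y z2)"

definition equality_loss :: "('d \<Rightarrow> 'd \<Rightarrow> ereal) \<Rightarrow> bool"
  where "equality_loss E \<longleftrightarrow> (\<forall>y z. E y z = (if z = y then 0 else \<infinity>))"

definition strictly_convex_on :: "real set \<Rightarrow> (real \<Rightarrow> real) \<Rightarrow> bool"
  where "strictly_convex_on A g \<longleftrightarrow> (\<forall>r\<in>A. \<forall>s\<in>A. \<forall>t\<in>{0<..<1}. r \<noteq> s \<longrightarrow>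
    g (t * r + (1 - t) * s) < t * g r + (1 - t) * g s)"

definition solution_set ::
    "nat \<Rightarrow> (nat \<Rightarrow> 'x::real_normed_vector \<Rightarrow>\<^sub>L real) \<Rightarrow> (nat \<Rightarrow> 'x) \<Rightarrow> ('x \<Rightarrow> real) \<Rightarrow>
      ('m::finite \<Rightarrow> 'x) \<Rightarrow> (real ^ 'm \<Rightarrow> real ^ 'm \<Rightarrow> ereal) \<Rightarrow> (real \<Rightarrow> real) \<Rightarrow> real ^ 'm \<Rightarrow>
      ('x \<Rightarrow>\<^sub>L real) set"
  where "solution_set N p ps nU \<nu> E \<psi> y =
    {f. is_arg_min (\<lambda>f. E y (measure_op \<nu> f) +
                        ereal (\<psi> (Udual_norm N p nU (proj_Udual N p ps f)))) (\<lambda>_. True) f}"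

context direct_sum_dual_pair
begin

lemma Z_scale: "Z (c *\<^sub>R z) = \<bar>c\<bar> * Z z"
  and Z_triangle: "Z (z + w) \<le> Z z + Z w"
  and Z_nonneg: "0 \<le> Z z"
  and Z_eq_0: "Z z = 0 \<longleftrightarrow> z = 0"
  using norm_Z unfolding norm_on_def by blast+

lemma Z_mono1:
  assumes "0 \<le> a" "a \<le> a'"
  shows "Z (a, b) \<le> Z (a', b)"
proof (cases "a' = 0")
  case False
  define t where "t = (1 + a / a') / 2"
  have t: "0 \<le> t" "t \<le> 1" using assms False by (auto simp: t_def field_simps)
  have "(a, b) = t *\<^sub>R (a', b) + (1 - t) *\<^sub>R (- a', b)"
    using False by (simp add: t_def field_simps)
  then have "Z (a, b) \<le> Z (t *\<^sub>R (a', b)) + Z ((1 - t) *\<^sub>R (- a', b))"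
    using Z_triangle by metis
  also have "\<dots> = t * Z (a', b) + (1 - t) * Z (- a', b)"
    using t by (simp only: Z_scale abs_of_nonneg diff_ge_0_iff_ge)
  also have "Z (- a', b) = Z (a', b)"
    using absolute_Z[of "- a'" b] absolute_Z[of a' b] by simp
  finally show ?thesis by (simp add: algebra_simps)
qed (use assms in simp)

lemma Z_mono2:
  assumes "0 \<le> b" "b \<le> b'"
  shows "Z (a, b) \<le> Z (a, b')"
proof (cases "b' = 0")
  case False
  define t where "t = (1 + b / b') / 2"
  have t: "0 \<le> t" "t \<le> 1" using assms False by (auto simp: t_def field_simps)
  have "(a, b) = t *\<^sub>R (a, b') + (1 - t) *\<^sub>R (a, - b')"
    using False by (simp add: t_def field_simps)
  then have "Z (a, b) \<le> Z (t *\<^sub>R (a, b')) + Z ((1 - t) *\<^sub>R (a, - b'))"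
    using Z_triangle by metis
  also have "\<dots> = t * Z (a, b') + (1 - t) * Z (a, - b')"
    using t by (simp only: Z_scale abs_of_nonneg diff_ge_0_iff_ge)
  also have "Z (a, - b') = Z (a, b')"
    using absolute_Z[of a "- b'"] absolute_Z[of a b'] by simp
  finally show ?thesis by (simp add: algebra_simps)
qed (use assms in simp)

lemma Z_fst: "\<bar>a\<bar> * Z (1, 0) \<le> Z (a, b)"
  using Z_scale[of a "(1, 0)"] Z_mono2[of 0 "\<bar>b\<bar>" "a"] absolute_Z[of a b] absolute_Z[of a "\<bar>b\<bar>"]
  by simp

lemma Z_snd: "\<bar>b\<bar> * Z (0, 1) \<le> Z (a, b)"
  using Z_scale[of b "(0, 1)"] Z_mono1[of 0 "\<bar>a\<bar>" "b"] absolute_Z[of a b] absolute_Z[of "\<bar>a\<bar>" b]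
  by simp

lemma Z_pos: "0 < Z (1, 0)" "0 < Z (0, 1)"
  using Z_nonneg Z_eq_0 by (metis less_eq_real_def prod.inject zero_neq_one zero_prod_def)+

lemma dual_Z:
  shows dual_Z_bdd: "bdd_above ((\<lambda>z. \<bar>a * fst z + b * snd z\<bar>) ` {z \<in> UNIV. Z z \<le> 1})"
    and dual_Z_apply: "\<bar>a * r + b * s\<bar> \<le> dual_norm UNIV Z (\<lambda>z. a * fst z + b * snd z) * Z (r, s)"
proof -
  show bdd: "bdd_above ((\<lambda>z. \<bar>a * fst z + b * snd z\<bar>) ` {z \<in> UNIV. Z z \<le> 1})"
  proof (rule bdd_aboveI2)
    fix z assume "z \<in> {z \<in> UNIV. Z z \<le> 1}"
    then have z: "Z (fst z, snd z) \<le> 1" by simp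
    have "\<bar>fst z\<bar> \<le> 1 / Z (1, 0)" "\<bar>snd z\<bar> \<le> 1 / Z (0, 1)"
      using Z_fst[of "fst z" "snd z"] Z_snd[of "snd z" "fst z"] z Z_pos by (auto simp: field_simps)
    then have "\<bar>a\<bar> * \<bar>fst z\<bar> + \<bar>b\<bar> * \<bar>snd z\<bar> \<le> \<bar>a\<bar> * (1 / Z (1, 0)) + \<bar>b\<bar> * (1 / Z (0, 1))"
      by (intro add_mono mult_left_mono) auto
    moreover have "\<bar>a * fst z + b * snd z\<bar> \<le> \<bar>a\<bar> * \<bar>fst z\<bar> + \<bar>b\<bar> * \<bar>snd z\<bar>"
      using abs_triangle_ineq[of "a * fst z" "b * snd z"] by (simp add: abs_mult)
    ultimately show "\<bar>a * fst z + b * snd z\<bar> \<le> \<bar>a\<bar> * (1 / Z (1, 0)) + \<bar>b\<bar> * (1 / Z (0, 1))"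
      by linarith
  qed
  show "\<bar>a * r + b * s\<bar> \<le> dual_norm UNIV Z (\<lambda>z. a * fst z + b * snd z) * Z (r, s)"
  proof (cases "(r, s) = 0")
    case False
    then have pos: "0 < Z (r, s)" using Z_nonneg Z_eq_0 less_eq_real_def by metis
    define w where "w = (1 / Z (r, s)) *\<^sub>R (r, s)"
    have "Z w \<le> 1" using pos by (simp only: w_def Z_scale) simp
    then have "\<bar>a * fst w + b * snd w\<bar> \<le> dual_norm UNIV Z (\<lambda>z. a * fst z + b * snd z)"
      unfolding dual_norm_def by (intro cSUP_upper[OF _ bdd]) auto
    moreover have "a * fst w + b * snd w = (a * r + b * s) / Z (r, s)"
      by (simp add: w_def add_divide_distrib)
    ultimately show ?thesis using pos by (simp add: abs_divide field_simps)
  qed (use Z_eq_0[of 0] in \<open>simp add: zero_prod_def\<close>)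
qed

lemma subspace_Uspace: "subspace (Uspace N p)"
  by (auto simp: subspace_def Uspace_def blinfun.bilinear_simps)

lemma p_proj_Nps:
  assumes "n \<in> {1..N}"
  shows "blinfun_apply (p n) (proj_Nps N p ps x) = blinfun_apply (p n) x"
proof -
  have "blinfun_apply (p n) (proj_Nps N p ps x)
      = (\<Sum>k=1..N. blinfun_apply (p k) x * (if k = n then 1 else 0))"
    unfolding proj_Nps_def blinfun.sum_right using assms
    by (intro sum.cong refl) (simp add: blinfun.scaleR_right biorthonormal)
  also have "\<dots> = (\<Sum>k=1..N. if k = n then blinfun_apply (p k) x else 0)"
    by (intro sum.cong refl) simp
  finally show ?thesis using assms by simp
qed

lemma proj_Uspace_in: "proj_Uspace N p ps x \<in> Uspace N p"
  by (auto simp: Uspace_def proj_Uspace_def blinfun.diff_right p_proj_Nps simp del: atLeastAtMost_iff)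

lemma proj_Nps_in: "proj_Nps N p ps x \<in> span (ps ` {1..N})"
  unfolding proj_Nps_def by (intro span_sum span_scale span_base) auto

lemma proj_Nps_span:
  assumes "w \<in> span (ps ` {1..N})"
  shows "proj_Nps N p ps w = w"
  using assms
proof (induction rule: span_induct_alt)
  case base
  show ?case by (simp add: proj_Nps_def)
next
  case (step c x y)
  then obtain k where k: "k \<in> {1..N}" "x = ps k" by auto
  have "proj_Nps N p ps (c *\<^sub>R x + y) = c *\<^sub>R proj_Nps N p ps x + proj_Nps N p ps y"
    by (simp add: proj_Nps_def blinfun.bilinear_simps scaleR_sum_right sum.distrib algebra_simps)
  also have "proj_Nps N p ps x = (\<Sum>n=1..N. if k = n then ps n else 0)"
    unfolding proj_Nps_def k(2) using k(1) by (intro sum.cong refl) (simp add: biorthonormal)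
  also have "\<dots> = x" using k by simp
  finally show ?case using step by simp
qed

lemma proj_Nps_add:
  assumes "u \<in> Uspace N p" "w \<in> span (ps ` {1..N})"
  shows "proj_Nps N p ps (u + w) = w" "proj_Uspace N p ps (u + w) = u"
proof -
  have "proj_Nps N p ps (u + w) = proj_Nps N p ps u + proj_Nps N p ps w"
    by (simp add: proj_Nps_def blinfun.bilinear_simps sum.distrib algebra_simps)
  moreover have "proj_Nps N p ps u = 0" using assms by (auto simp: proj_Nps_def Uspace_def)
  ultimately show "proj_Nps N p ps (u + w) = w" using proj_Nps_span assms by simp
  then show "proj_Uspace N p ps (u + w) = u" by (simp add: proj_Uspace_def)
qed

lemma norm_add:
  assumes "u \<in> Uspace N p" "w \<in> span (ps ` {1..N})"
  shows "norm (u + w) = Z (nU u, nN w)"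
  using norm_composite[of "u + w"] proj_Nps_add[OF assms] by simp

lemma dual_norm_facts:
  assumes V: "subspace V" "norm_on V n" and C: "\<And>v. v \<in> V \<Longrightarrow> norm v \<le> C * n v"
  shows "bdd_above ((\<lambda>v. \<bar>blinfun_apply f v\<bar>) ` {v \<in> V. n v \<le> 1})" (is ?A)
    and "v \<in> V \<Longrightarrow> \<bar>blinfun_apply f v\<bar> \<le> dual_norm V n (blinfun_apply f) * n v"
    and "0 \<le> dual_norm V n (blinfun_apply f)"
proof -
  show bdd: ?A
  proof (rule bdd_aboveI2)
    fix v assume v: "v \<in> {v \<in> V. n v \<le> 1}"
    have "0 \<le> n v" using V(2) v by (auto simp: norm_on_def)
    then have "norm v \<le> max 0 C * n v"
      using C[of v] v mult_right_mono[of C "max 0 C" "n v"] by (auto intro: order_trans)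
    also have "\<dots> \<le> max 0 C * 1" using v by (intro mult_left_mono) auto
    finally have "norm f * norm v \<le> norm f * max 0 C" by (intro mult_left_mono) auto
    then show "\<bar>blinfun_apply f v\<bar> \<le> norm f * max 0 C"
      using norm_blinfun[of f v] by (simp only: real_norm_def)
  qed
  have up: "\<bar>blinfun_apply f v\<bar> \<le> dual_norm V n (blinfun_apply f)" if "v \<in> V" "n v \<le> 1" for v
    unfolding dual_norm_def using that by (intro cSUP_upper[OF _ bdd]) auto
  have V0: "0 \<in> V" "n 0 = 0" using V by (auto simp: subspace_def norm_on_def)
  then show "0 \<le> dual_norm V n (blinfun_apply f)" using up[of 0] by simp
  show "\<bar>blinfun_apply f v\<bar> \<le> dual_norm V n (blinfun_apply f) * n v" if v: "v \<in> V"
  proof (cases "v = 0")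
    case False
    then have pos: "0 < n v" using V(2) v unfolding norm_on_def by force
    have "n ((1 / n v) *\<^sub>R v) = \<bar>1 / n v\<bar> * n v" using V(2) v unfolding norm_on_def by blast
    then have "n ((1 / n v) *\<^sub>R v) = 1" using pos by simp
    then have "\<bar>blinfun_apply f ((1 / n v) *\<^sub>R v)\<bar> \<le> dual_norm V n (blinfun_apply f)"
      using up V(1) v by (simp add: subspace_def)
    then show ?thesis using pos by (simp add: blinfun.scaleR_right abs_mult field_simps)
  qed (simp add: V0)
qed

lemma norm_le_nU: "u \<in> Uspace N p \<Longrightarrow> norm u \<le> Z (1, 0) * nU u"
  and norm_le_nN: "w \<in> span (ps ` {1..N}) \<Longrightarrow> norm w \<le> Z (0, 1) * nN w"
proof -
  have z: "nU 0 = 0" "nN 0 = 0" "0 \<in> Uspace N p" "0 \<in> span (ps ` {1..N})"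
    using norm_U norm_N subspace_Uspace by (auto simp: norm_on_def subspace_def span_zero)
  show "norm u \<le> Z (1, 0) * nU u" if "u \<in> Uspace N p"
  proof -
    have "norm u = Z (nU u *\<^sub>R (1, 0))" using norm_add[OF that z(4)] z by simp
    moreover have "0 \<le> nU u" using that norm_U by (auto simp: norm_on_def)
    ultimately show ?thesis by (simp only: Z_scale) simp
  qed
  show "norm w \<le> Z (0, 1) * nN w" if "w \<in> span (ps ` {1..N})"
  proof -
    have "norm w = Z (nN w *\<^sub>R (0, 1))" using norm_add[OF z(3) that] z by simp
    moreover have "0 \<le> nN w" using that norm_N by (auto simp: norm_on_def)
    ultimately show ?thesis by (simp only: Z_scale) simp
  qed
qed

lemmas dual_U = dual_norm_facts[OF subspace_Uspace norm_U norm_le_nU]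
lemmas dual_N = dual_norm_facts[OF subspace_span norm_N norm_le_nN]

lemma apply_decomp:
  assumes "u \<in> Uspace N p" "w \<in> span (ps ` {1..N})"
  shows "blinfun_apply f (u + w)
    = blinfun_apply (proj_Udual N p ps f) u + blinfun_apply (proj_Np N p ps f) w"
proof -
  have "blinfun_apply (proj_Np N p ps f) u = 0"
    using assms(1) by (simp add: proj_Np_def Uspace_def blinfun.sum_left blinfun.scaleR_left)
  moreover have "blinfun_apply (proj_Np N p ps f) w = blinfun_apply f (proj_Nps N p ps w)"
    by (simp add: proj_Np_def proj_Nps_def blinfun.bilinear_simps blinfun.sum_left
        blinfun.sum_right mult.commute)
  ultimately show ?thesis
    using proj_Nps_span[OF assms(2)] by (simp add: proj_Udual_def blinfun.bilinear_simps)
qed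

theorem norm_dual_composite:
  "norm f = dual_norm UNIV Z (\<lambda>z.
      Udual_norm N p nU (proj_Udual N p ps f) * fst z +
      dual_norm (span (ps ` {1..N})) nN (blinfun_apply (proj_Np N p ps f)) * snd z)"
proof -
  define s q where "s = proj_Udual N p ps f" and "q = proj_Np N p ps f"
  define a b where "a = dual_norm (Uspace N p) nU (blinfun_apply s)"
    and "b = dual_norm (span (ps ` {1..N})) nN (blinfun_apply q)"
  define D where "D = dual_norm UNIV Z (\<lambda>z. a * fst z + b * snd z)"
  have a0: "0 \<le> a" and b0: "0 \<le> b" unfolding a_def b_def using dual_U(3) dual_N(3) by auto
  have D0: "0 \<le> D" using dual_Z_apply[of a 1 b 0] Z_pos(1) a0
    unfolding D_def[symmetric] by (simp add: zero_le_mult_iff) (smt (verit) zero_le_mult_iff)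
  have "norm f \<le> D"
  proof (rule norm_blinfun_bound[OF D0])
    fix x
    define u w where "u = proj_Uspace N p ps x" and "w = proj_Nps N p ps x"
    have x: "x = u + w" by (simp add: u_def w_def proj_Uspace_def)
    have uw: "u \<in> Uspace N p" "w \<in> span (ps ` {1..N})"
      unfolding u_def w_def using proj_Uspace_in proj_Nps_in by auto
    have "\<bar>blinfun_apply f x\<bar> \<le> \<bar>blinfun_apply s u\<bar> + \<bar>blinfun_apply q w\<bar>"
      unfolding x apply_decomp[OF uw] s_def q_def by (rule abs_triangle_ineq)
    also have "\<dots> \<le> a * nU u + b * nN w"
      unfolding a_def b_def using dual_U(2)[OF _ uw(1)] dual_N(2)[OF _ uw(2)] by (intro add_mono) auto
    also have "\<dots> \<le> D * Z (nU u, nN w)"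
      using dual_Z_apply[of a "nU u" b "nN w"] by (simp add: D_def)
    finally show "norm (blinfun_apply f x) \<le> D * norm x"
      using norm_add[OF uw] x by simp
  qed
  moreover have "D \<le> norm f"
    unfolding D_def dual_norm_def[of UNIV]
  proof (rule cSUP_least)
    have "Z 0 = 0" by (simp add: Z_eq_0)
    then show "{z \<in> UNIV. Z z \<le> 1} \<noteq> {}" by (metis (mono_tags) UNIV_I empty_iff mem_Collect_eq zero_le_one)
  next
    fix z assume "z \<in> {z \<in> UNIV. Z z \<le> 1}"
    define r t where "r = \<bar>fst z\<bar>" and "t = \<bar>snd z\<bar>"
    have rt: "0 \<le> r" "0 \<le> t" "Z (r, t) \<le> 1"
      using \<open>z \<in> _\<close> absolute_Z[of "fst z" "snd z"] by (auto simp: r_def t_def)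
    have key: "r * \<bar>blinfun_apply s u\<bar> + t * \<bar>blinfun_apply q w\<bar> \<le> norm f"
      if u: "u \<in> Uspace N p" "nU u \<le> 1" and w: "w \<in> span (ps ` {1..N})" "nN w \<le> 1" for u w
    proof -
      define c d where "c = r * sgn (blinfun_apply s u)" and "d = t * sgn (blinfun_apply q w)"
      have cd: "\<bar>c\<bar> \<le> r" "\<bar>d\<bar> \<le> t" using rt by (auto simp: c_def d_def abs_mult sgn_if)
      have mem: "c *\<^sub>R u \<in> Uspace N p" "d *\<^sub>R w \<in> span (ps ` {1..N})"
        using u(1) w(1) subspace_Uspace by (auto simp: subspace_def span_scale)
      have n: "nU (c *\<^sub>R u) = \<bar>c\<bar> * nU u" "nN (d *\<^sub>R w) = \<bar>d\<bar> * nN w" "0 \<le> nU u" "0 \<le> nN w"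
        using norm_U norm_N u(1) w(1) by (auto simp: norm_on_def)
      have "r * \<bar>blinfun_apply s u\<bar> + t * \<bar>blinfun_apply q w\<bar> = blinfun_apply f (c *\<^sub>R u + d *\<^sub>R w)"
        unfolding apply_decomp[OF mem] s_def[symmetric] q_def[symmetric]
        by (simp add: blinfun.scaleR_right c_def d_def abs_sgn mult.commute mult.left_commute)
      also have "\<dots> \<le> norm f * norm (c *\<^sub>R u + d *\<^sub>R w)"
        using norm_blinfun[of f] abs_ge_self order_trans by (metis real_norm_def)
      also have "\<dots> \<le> norm f * Z (r, t)"
      proof (rule mult_left_mono)
        have 1: "\<bar>c\<bar> * nU u \<le> r" "\<bar>d\<bar> * nN w \<le> t"
          using mult_mono[of "\<bar>c\<bar>" r "nU u" 1] mult_mono[of "\<bar>d\<bar>" t "nN w" 1] cd n u w rt by auto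
        show "norm (c *\<^sub>R u + d *\<^sub>R w) \<le> Z (r, t)" unfolding norm_add[OF mem] n(1,2)
          using Z_mono1[of "\<bar>c\<bar> * nU u" r "\<bar>d\<bar> * nN w"] Z_mono2[of "\<bar>d\<bar> * nN w" t r] 1 n
          by (auto intro: order_trans)
      qed simp
      finally show ?thesis
        using rt(3) mult_left_mono[of "Z (r, t)" 1 "norm f"] by simp
    qed
    have z0: "nU 0 = 0" "nN 0 = 0" "0 \<in> Uspace N p" "0 \<in> span (ps ` {1..N})"
      using norm_U norm_N subspace_Uspace by (auto simp: norm_on_def subspace_def span_zero)
    have k1: "r * a + t * \<bar>blinfun_apply q w\<bar> \<le> norm f"
      if w: "w \<in> span (ps ` {1..N})" "nN w \<le> 1" for w
    proof (cases "r = 0")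
      case True
      then show ?thesis using key[OF z0(3) _ w] z0 by simp
    next
      case False
      then have "0 < r" using rt by simp
      have "a \<le> (norm f - t * \<bar>blinfun_apply q w\<bar>) / r"
        unfolding a_def dual_norm_def
        by (rule cSUP_least) (use z0 key[OF _ _ w] \<open>0 < r\<close> in \<open>auto simp: field_simps\<close>)
      then show ?thesis using \<open>0 < r\<close> by (simp add: field_simps)
    qed
    have "r * a + t * b \<le> norm f"
    proof (cases "t = 0")
      case True
      then show ?thesis using k1[OF z0(4)] z0 by simp
    next
      case False
      then have "0 < t" using rt by simp
      have "b \<le> (norm f - r * a) / t"
        unfolding b_def dual_norm_def
        by (rule cSUP_least) (use z0 k1 \<open>0 < t\<close> in \<open>auto simp: field_simps\<close>)
      then show ?thesis using \<open>0 < t\<close> by (simp add: field_simps)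
    qed
    moreover have "\<bar>a * fst z + b * snd z\<bar> \<le> r * a + t * b"
      using abs_triangle_ineq[of "a * fst z" "b * snd z"] a0 b0
      by (simp add: abs_mult r_def t_def mult.commute)
    ultimately show "\<bar>a * fst z + b * snd z\<bar> \<le> norm f" by linarith
  qed
  ultimately show ?thesis by (simp add: D_def a_def b_def s_def q_def Udual_norm_def)
qed

corollary norm_dual_le_sum:
  "norm f \<le> Udual_norm N p nU (proj_Udual N p ps f) +
     dual_norm (span (ps ` {1..N})) nN (blinfun_apply (proj_Np N p ps f))"
  using dual_Z_le[of "Udual_norm N p nU (proj_Udual N p ps f)"
      "dual_norm (span (ps ` {1..N})) nN (blinfun_apply (proj_Np N p ps f))"]
    norm_dual_composite[of f] dual_U(3) dual_N(3)
  by (simp add: Udual_norm_def)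

end

end

theory Submission
  imports Defs
begin

text \<open>
  Existence is the direct method.  Coercivity of the loss bounds the measurements, the growth of
  a strictly increasing convex \<open>\<psi>\<close> bounds the semi-norm, and the linear independence of
  the vectors \<open>v n\<close> turns a bound on the measurements into a bound on the null-space component.
  So the sublevel sets of the objective are bounded; they are weak* closed because the loss is
  lower semicontinuous in finitely many evaluations and the semi-norm is a supremum of
  evaluations.  By \<open>Banach_Alaoglu\<close> they are weak* compact.

  A strictly convex loss, or the equality constraint, forces all solutions to have the same
  measurements \<open>z\<close>, hence the same semi-norm \<open>r\<close>.  The problem becomes one of minimal norm: among
  all \<open>s\<close> in \<open>\<U>'\<close> with prescribed values on the finite-dimensional space \<open>V\<close> spanned by
  the reduced functions \<open>\<nu>t m\<close>, the penalized components of the solutions are those of least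
  norm.  By \<open>Hahn_Banach_Udual\<close> this least norm \<open>r\<close> is the norm of the prescribed functional
  on \<open>V\<close>, and since \<open>V\<close> is finite-dimensional that norm is attained at some \<open>x\<close> in \<open>V\<close>.
  Scaled to norm \<open>r\<close>, this \<open>x\<close> is conjugate to the penalized component of every solution:
  \<open>x\<close> was obtained from the common data alone.  This is \<open>common_conjugate\<close>.

  The three descriptions follow.  If \<open>\<U>'\<close> is strictly convex, conjugates are unique, so the
  penalized component is \<open>J x\<close>, and the null-space component is determined by the measurements
  that remain.  If \<open>\<U>'\<close> is a Hilbert space, then \<open>J\<close> is the Riesz map of an inner product on
  \<open>\<U>\<close>, in particular linear.  In general \<open>Krein_Milman_weak_star\<close> describes the solution set by
  its extreme points.  Unless it is \<open>0\<close>, the penalized component \<open>s\<close> of such a point, divided by \<open>r\<close>,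
  lies on the unit sphere, and the directions in which it can be moved to both sides within the unit ball are
  annihilated by \<open>x\<close>; extremality says that among these directions only \<open>0\<close> is annihilated by all
  \<open>\<nu>t m\<close>.  Hence \<open>s\<close> and these directions together span a space that the \<open>K\<close>
  evaluations at \<open>\<nu>t m\<close> separate, of dimension at most \<open>K\<close>, and by \<open>in_span_extreme_points\<close> the
  extreme points of the ball in that space span \<open>s\<close>.
\<close>

section \<open>Sublinear functionals and the Hahn-Banach theorem\<close>

definition sublinear :: "('a::real_vector \<Rightarrow> real) \<Rightarrow> bool"
  where "sublinear q \<longleftrightarrow> (\<forall>x y. q (x + y) \<le> q x + q y) \<and> (\<forall>c x. 0 \<le> c \<longrightarrow> q (c *\<^sub>R x) = c * q x)"

lemma sublinear_add: "sublinear q \<Longrightarrow> q (x + y) \<le> q x + q y"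
  and sublinear_scaleR: "sublinear q \<Longrightarrow> 0 \<le> c \<Longrightarrow> q (c *\<^sub>R x) = c * q x"
  by (auto simp: sublinear_def)

lemma sublinear_0: "sublinear q \<Longrightarrow> q 0 = 0"
  using sublinear_scaleR[of q 0 0] by simp

lemma sublinear_minus_le: "sublinear q \<Longrightarrow> - q (- x) \<le> q x"
  using sublinear_add[of q x "- x"] sublinear_0[of q] by simp

text \<open>
  An infimal convolution: \<open>g x\<close> is the infimum of \<open>q (x + v) - k\<close> over the cone \<open>C\<close>.  Both steps of
  the Hahn-Banach theorem are instances.  If \<open>C\<close> is the graph of a functional on a subspace, a linear
  minorant of \<open>g\<close> extends that functional; if \<open>C\<close> is the graph over a single ray, \<open>g\<close> shows that
  a minimal sublinear functional is additive.
\<close>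

lemma sublinear_inf_convolution:
  assumes q: "sublinear q"
    and zero: "(0, 0) \<in> C"
    and add: "\<And>a b. a \<in> C \<Longrightarrow> b \<in> C \<Longrightarrow> a + b \<in> C"
    and scale: "\<And>c a. 0 < c \<Longrightarrow> a \<in> C \<Longrightarrow> c *\<^sub>R a \<in> C"
    and le: "\<And>v k. (v, k) \<in> C \<Longrightarrow> k \<le> q v"
  obtains g where "sublinear g" "\<And>x. g x \<le> q x" "\<And>x v k. (v, k) \<in> C \<Longrightarrow> g x \<le> q (x + v) - k"
proof -
  define g where "g x = (INF a\<in>C. q (x + fst a) - snd a)" for x
  have bdd: "bdd_below ((\<lambda>a. q (x + fst a) - snd a) ` C)" for x
  proof (rule bdd_belowI2)
    fix a assume "a \<in> C"
    then have "snd a \<le> q (fst a)" using le[of "fst a" "snd a"] by simp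
    also have "q (fst a) \<le> q (x + fst a) + q (- x)"
      using sublinear_add[OF q, of "x + fst a" "- x"] by simp
    finally show "- q (- x) \<le> q (x + fst a) - snd a" by simp
  qed
  have ub: "g x \<le> q (x + v) - k" if "(v, k) \<in> C" for x v k
    using cINF_lower[OF bdd that, of x] by (simp add: g_def)
  have lb: "c \<le> g x" if "\<And>v k. (v, k) \<in> C \<Longrightarrow> c \<le> q (x + v) - k" for c x
    unfolding g_def using zero that by (intro cINF_greatest) auto
  have "g (x + y) \<le> g x + g y" for x y
  proof -
    have "g (x + y) \<le> (q (x + v) - k) + (q (y + w) - l)" if vw: "(v, k) \<in> C" "(w, l) \<in> C" for v k w l
    proof -
      have "g (x + y) \<le> q ((x + v) + (y + w)) - (k + l)"
        using ub[of "v + w" "k + l" "x + y"] add[OF vw] by (simp add: algebra_simps)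
      then show ?thesis using sublinear_add[OF q, of "x + v" "y + w"] by linarith
    qed
    then have "g (x + y) - (q (y + w) - l) \<le> g x" if "(w, l) \<in> C" for w l
      using that by (intro lb) (simp add: algebra_simps)
    then have "g (x + y) - g x \<le> g y" by (intro lb) (simp add: algebra_simps)
    then show ?thesis by simp
  qed
  moreover have g_scale: "g (c *\<^sub>R x) \<le> c * g x" if "0 < c" for c x
  proof -
    have "g (c *\<^sub>R x) / c \<le> q (x + v) - k" if vk: "(v, k) \<in> C" for v k
    proof -
      have "g (c *\<^sub>R x) \<le> q (c *\<^sub>R (x + v)) - c * k"
        using ub[of "c *\<^sub>R v" "c * k" "c *\<^sub>R x"] scale[OF \<open>0 < c\<close> vk] by (simp add: algebra_simps)
      then show ?thesis using \<open>0 < c\<close> sublinear_scaleR[OF q, of c "x + v"]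
        by (simp add: field_simps)
    qed
    then have "g (c *\<^sub>R x) / c \<le> g x" by (rule lb)
    then show ?thesis using \<open>0 < c\<close> by (simp add: field_simps)
  qed
  have "g (c *\<^sub>R x) = c * g x" if "0 \<le> c" for c x
  proof (cases "c = 0")
    case True
    have "g 0 \<le> 0" using ub[OF zero, of 0] sublinear_0[OF q] by simp
    moreover have "0 \<le> g 0" by (rule lb) (simp add: le)
    ultimately show ?thesis using True by simp
  next
    case False
    then have "0 < c" using that by simp
    moreover have "g x \<le> (1 / c) * g (c *\<^sub>R x)"
      using g_scale[of "1 / c" "c *\<^sub>R x"] \<open>0 < c\<close> by simp
    ultimately show ?thesis using g_scale[of c x] by (simp add: field_simps)
  qed
  ultimately have "sublinear g" by (simp add: sublinear_def)
  moreover have "g x \<le> q x" for x using ub[OF zero, of x] by simp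
  ultimately show ?thesis using that ub by blast
qed

text \<open>
  A pointwise minimal sublinear functional \<open>F\<close> below \<open>q\<close> exists by Zorn's lemma.  It is linear:
  lowering \<open>F\<close> along the ray through \<open>y\<close> gives a sublinear functional that minimality
  identifies with \<open>F\<close>, and this says that \<open>F\<close> is superadditive.
\<close>

lemma exists_linear_below_sublinear:
  assumes q: "sublinear q"
  obtains F where "linear F" "\<And>x. F x \<le> q x"
proof -
  define A where "A = {g. sublinear g \<and> (\<forall>x. g x \<le> q x)}"
  define P :: "('a \<Rightarrow> real) \<Rightarrow> ('a \<Rightarrow> real) \<Rightarrow> bool" where "P g h \<longleftrightarrow> h \<le> g" for g h
  have "\<exists>m\<in>A. \<forall>a\<in>A. P m a \<longrightarrow> a = m"
  proof (rule predicate_Zorn)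
    show "partial_order_on A (relation_of P A)"
      by (rule partial_order_on_relation_ofI) (auto simp: P_def)
  next
    fix C assume C: "C \<in> Chains (relation_of P A)"
    then have CA: "C \<subseteq> A" and tot: "\<And>g h. g \<in> C \<Longrightarrow> h \<in> C \<Longrightarrow> g \<le> h \<or> h \<le> g"
      by (auto simp: Chains_def relation_of_def P_def)
    show "\<exists>u\<in>A. \<forall>a\<in>C. P a u"
    proof (cases "C = {}")
      case True
      then show ?thesis using q by (auto simp: A_def)
    next
      case False
      define u where "u x = (INF g\<in>C. g x)" for x
      \<comment> \<open>The infimum of the chain is finite because every member of it lies above the map
        that sends \<open>x\<close> to \<open>- q (- x)\<close>.\<close>
      have bdd: "bdd_below ((\<lambda>g. g x) ` C)" for x
      proof (rule bdd_belowI2)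
        fix g assume "g \<in> C"
        then have "sublinear g" "g (- x) \<le> q (- x)" using CA by (auto simp: A_def)
        then show "- q (- x) \<le> g x" using sublinear_minus_le[of g x] by linarith
      qed
      have ub: "u x \<le> g x" if "g \<in> C" for g x
        unfolding u_def using cINF_lower[OF bdd that] .
      have lb: "c \<le> u x" if "\<And>g. g \<in> C \<Longrightarrow> c \<le> g x" for c x
        unfolding u_def using False that by (intro cINF_greatest) auto
      have "u (x + y) \<le> u x + u y" for x y
      proof -
        have "u (x + y) \<le> g x + h y" if gh: "g \<in> C" "h \<in> C" for g h
        proof -
          \<comment> \<open>Different members of the chain may be good at \<open>x\<close> and at \<open>y\<close>; the smaller one is good at both.\<close>
          obtain k where k: "k \<in> C" "k \<le> g" "k \<le> h" using tot[OF gh] gh by blast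
          then have "k x \<le> g x" "k y \<le> h y" by (auto simp: le_fun_def)
          moreover have "k (x + y) \<le> k x + k y" using k(1) CA by (auto simp: A_def sublinear_def)
          ultimately show ?thesis using ub[OF k(1), of "x + y"] by linarith
        qed
        then have "u (x + y) - h y \<le> u x" if "h \<in> C" for h
          using that by (intro lb) (simp add: algebra_simps)
        then have "u (x + y) - u x \<le> u y" by (intro lb) (simp add: algebra_simps)
        then show ?thesis by simp
      qed
      moreover have "u (c *\<^sub>R x) = c * u x" if "0 \<le> c" for c x
      proof (rule antisym)
        have hom: "g (c *\<^sub>R x) = c * g x" if "g \<in> C" for g
          using that CA \<open>0 \<le> c\<close> by (auto simp: A_def sublinear_def)
        show "c * u x \<le> u (c *\<^sub>R x)"
          by (rule lb) (simp add: hom ub mult_left_mono \<open>0 \<le> c\<close>)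
        show "u (c *\<^sub>R x) \<le> c * u x"
        proof (cases "c = 0")
          case True
          obtain g where "g \<in> C" using False by blast
          then show ?thesis using ub[of g "c *\<^sub>R x"] hom[of g] True by simp
        next
          case False
          then have "u (c *\<^sub>R x) / c \<le> u x" using \<open>0 \<le> c\<close> hom ub[of _ "c *\<^sub>R x"]
            by (intro lb) (simp add: field_simps)
          then show ?thesis using False \<open>0 \<le> c\<close> by (simp add: field_simps)
        qed
      qed
      ultimately have "sublinear u" by (simp add: sublinear_def)
      moreover have "u x \<le> q x" for x
      proof -
        obtain g where "g \<in> C" using False by blast
        moreover have "g x \<le> q x" using \<open>g \<in> C\<close> CA by (auto simp: A_def)
        ultimately show ?thesis using ub[of g x] by linarith
      qed
      ultimately have "u \<in> A" by (simp add: A_def)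
      then show ?thesis using ub by (auto simp: P_def le_fun_def)
    qed
  qed
  then obtain F where F: "F \<in> A" and min: "\<And>g. g \<in> A \<Longrightarrow> g \<le> F \<Longrightarrow> g = F"
    by (auto simp: P_def)
  have subF: "sublinear F" and Fq: "F x \<le> q x" for x using F by (auto simp: A_def)
  have sup: "F x + F y \<le> F (x + y)" for x y
  proof -
    define C where "C = {(t *\<^sub>R y, t * F y) | t. 0 \<le> t}"
    obtain g where g: "sublinear g" "\<And>x. g x \<le> F x" "\<And>x v k. (v, k) \<in> C \<Longrightarrow> g x \<le> F (x + v) - k"
    proof (rule sublinear_inf_convolution[OF subF, of C])
      show "(0, 0) \<in> C" by (force simp: C_def)
      show "a + b \<in> C" if "a \<in> C" "b \<in> C" for a b
      proof -
        obtain s t where "a = (s *\<^sub>R y, s * F y)" "b = (t *\<^sub>R y, t * F y)" "0 \<le> s" "0 \<le> t"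
          using \<open>a \<in> C\<close> \<open>b \<in> C\<close> by (auto simp: C_def)
        then show ?thesis unfolding C_def
          by (intro CollectI exI[of _ "s + t"]) (simp add: algebra_simps)
      qed
      show "c *\<^sub>R a \<in> C" if "0 < c" "a \<in> C" for c a
      proof -
        obtain t where "a = (t *\<^sub>R y, t * F y)" "0 \<le> t" using \<open>a \<in> C\<close> by (auto simp: C_def)
        then show ?thesis unfolding C_def using \<open>0 < c\<close>
          by (intro CollectI exI[of _ "c * t"]) (simp add: algebra_simps)
      qed
      show "k \<le> F v" if "(v, k) \<in> C" for v k
        using that sublinear_scaleR[OF subF] by (auto simp: C_def)
    qed blast
    have "g \<in> A" using g(1,2) Fq by (auto simp: A_def intro: order_trans)
    then have "g = F" using min g(2) by (auto simp: le_fun_def)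
    moreover have "(1 *\<^sub>R y, 1 * F y) \<in> C" unfolding C_def by force
    ultimately show ?thesis using g(3)[of "1 *\<^sub>R y" "1 * F y" x] by simp
  qed
  have add: "F (x + y) = F x + F y" for x y
    using sup[of x y] sublinear_add[OF subF, of x y] by linarith
  have "linear F"
  proof (rule linearI)
    fix c :: real and x
    have neg: "F (- x) = - F x" for x using add[of x "- x"] sublinear_0[OF subF] by simp
    show "F (c *\<^sub>R x) = c *\<^sub>R F x"
    proof (cases "0 \<le> c")
      case False
      then have "F ((- c) *\<^sub>R x) = - c * F x" using sublinear_scaleR[OF subF, of "- c" x] by simp
      then show ?thesis using neg[of "c *\<^sub>R x"] by simp
    qed (simp add: sublinear_scaleR[OF subF])
  qed (rule add)
  then show ?thesis using Fq that by blast
qed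

theorem Hahn_Banach_sublinear:
  assumes q: "sublinear q" and V: "subspace V" and \<phi>: "linear \<phi>"
    and le: "\<And>v. v \<in> V \<Longrightarrow> \<phi> v \<le> q v"
  obtains F where "linear F" "\<And>x. F x \<le> q x" "\<And>v. v \<in> V \<Longrightarrow> F v = \<phi> v"
proof -
  define C where "C = (\<lambda>v. (v, \<phi> v)) ` V"
  obtain g where g: "sublinear g" "\<And>x. g x \<le> q x" "\<And>x v k. (v, k) \<in> C \<Longrightarrow> g x \<le> q (x + v) - k"
  proof (rule sublinear_inf_convolution[OF q, of C])
    show "(0, 0) \<in> C" using V \<phi> by (force simp: C_def subspace_0 linear_0)
  next
    fix a b assume "a \<in> C" "b \<in> C"
    then show "a + b \<in> C" using V \<phi>
      by (fastforce simp: C_def subspace_add linear_add)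
  next
    fix c :: real and a assume "0 < c" "a \<in> C"
    then show "c *\<^sub>R a \<in> C" using V \<phi>
      by (fastforce simp: C_def subspace_scale linear_scale)
  next
    fix v k assume "(v, k) \<in> C"
    then show "k \<le> q v" using le by (auto simp: C_def)
  qed blast
  obtain F where F: "linear F" "\<And>x. F x \<le> g x"
    using exists_linear_below_sublinear[OF g(1)] by blast
  have le': "F v \<le> \<phi> v" if "v \<in> V" for v
  proof -
    have "(- v, \<phi> (- v)) \<in> C" using that V by (auto simp: C_def subspace_neg)
    then show ?thesis using g(3)[of "- v" "\<phi> (- v)" v] F(2)[of v] sublinear_0[OF q] linear_neg[OF \<phi>, of v]
      by simp
  qed
  have "F v = \<phi> v" if "v \<in> V" for v
    using le'[of v] le'[of "- v"] that V linear_neg[OF \<phi>, of v] linear_neg[OF F(1), of v]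
    by (simp add: subspace_neg)
  then show ?thesis using that F g(2) order_trans by metis
qed

section \<open>The weak* topology\<close>

lemma continuous_map_weak_star_apply: "continuous_map weak_star euclidean (\<lambda>f. blinfun_apply f x)"
  by (rule strong_operator_topology_continuous_evaluation)

lemma topspace_weak_star [simp]: "topspace weak_star = UNIV"
  by (rule strong_operator_topology_topspace)

lemma closedin_weak_star_vimage:
  assumes "continuous_map weak_star euclidean h" "closed C"
  shows "closedin weak_star {f. h f \<in> C}"
  using closedin_continuous_map_preimage[OF assms(1), of C] assms(2) by simp

lemma openin_weak_star_vimage:
  assumes "continuous_map weak_star euclidean h" "open C"
  shows "openin weak_star {f. h f \<in> C}"
  using openin_continuous_map_preimage[OF assms(1), of C] assms(2) by simp

lemma Hausdorff_weak_star: "Hausdorff_space weak_star"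
  unfolding Hausdorff_space_def
proof (intro allI impI)
  fix f g :: "'a \<Rightarrow>\<^sub>L real"
  assume "f \<in> topspace weak_star \<and> g \<in> topspace weak_star \<and> f \<noteq> g"
  then obtain x where "blinfun_apply f x \<noteq> blinfun_apply g x" by (meson blinfun_eqI)
  then obtain V W where VW: "open V" "open W" "blinfun_apply f x \<in> V" "blinfun_apply g x \<in> W" "V \<inter> W = {}"
    using hausdorff[of "blinfun_apply f x" "blinfun_apply g x"] by metis
  show "\<exists>V W. openin weak_star V \<and> openin weak_star W \<and> f \<in> V \<and> g \<in> W \<and> disjnt V W"
    by (rule exI[of _ "{h. blinfun_apply h x \<in> V}"], rule exI[of _ "{h. blinfun_apply h x \<in> W}"])
      (use VW in \<open>auto simp: disjnt_iff intro!: openin_weak_star_vimage continuous_map_weak_star_apply\<close>)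
qed

text \<open>
  The ball is the image, under a continuous map, of the linear functions in a product of compact
  intervals; that product is compact by Tychonoff's theorem and linearity is a closed condition.
\<close>

theorem Banach_Alaoglu:
  assumes "0 \<le> r"
  shows "compactin weak_star {f :: 'a::real_normed_vector \<Rightarrow>\<^sub>L real. norm f \<le> r}"
proof -
  define P where "P = (\<Pi>\<^sub>E x\<in>UNIV. {- (r * norm (x::'a)) .. r * norm x})"
  define L where "L = {\<phi> :: 'a \<Rightarrow> real. linear \<phi>}"
  have P: "\<phi> \<in> P \<longleftrightarrow> (\<forall>x. \<bar>\<phi> x\<bar> \<le> r * norm x)" for \<phi>
    by (auto simp: P_def PiE_iff abs_le_iff minus_le_iff)
  have "compactin (product_topology (\<lambda>x. euclidean) UNIV) P"
    unfolding P_def by (simp add: compactin_PiE)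
  then have "compact P" by (simp add: euclidean_product_topology)
  moreover have "closed L"
  proof -
    have "L = (\<Inter>x. \<Inter>y. {\<phi>. \<phi> (x + y) = \<phi> x + \<phi> y}) \<inter> (\<Inter>c. \<Inter>x. {\<phi>. \<phi> (c *\<^sub>R x) = c * \<phi> x})"
      by (auto simp: L_def linear_iff)
    then show ?thesis
      by (auto intro!: closed_Int closed_INT closed_Collect_eq continuous_intros
          continuous_on_product_coordinates)
  qed
  ultimately have cpt: "compact (P \<inter> L)" by (rule compact_Int_closed)
  have ap: "blinfun_apply (Blinfun \<phi>) = \<phi>" if "\<phi> \<in> P \<inter> L" for \<phi>
  proof (rule bounded_linear_Blinfun_apply)
    show "bounded_linear \<phi>" using that
      by (intro bounded_linear_intro[of _ r]) (auto simp: L_def linear_iff P mult.commute)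
  qed
  have "continuous_map (top_of_set (P \<inter> L)) weak_star Blinfun"
    unfolding continuous_on_strong_operator_topo_iff_coordinatewise
  proof
    fix x
    have "continuous_on (P \<inter> L) (\<lambda>\<phi>. \<phi> x)"
      by (rule continuous_on_subset[OF continuous_on_product_coordinates]) simp
    moreover have "blinfun_apply (Blinfun \<phi>) x = \<phi> x" if "\<phi> \<in> P \<inter> L" for \<phi>
      by (simp only: ap[OF that])
    ultimately have "continuous_on (P \<inter> L) (\<lambda>\<phi>. blinfun_apply (Blinfun \<phi>) x)"
      using continuous_on_cong[OF refl, of "P \<inter> L" "\<lambda>\<phi>. blinfun_apply (Blinfun \<phi>) x" "\<lambda>\<phi>. \<phi> x"] by blast
    then show "continuous_map (top_of_set (P \<inter> L)) euclidean (\<lambda>\<phi>. blinfun_apply (Blinfun \<phi>) x)"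
      by simp
  qed
  then have "compactin weak_star (Blinfun ` (P \<inter> L))"
    by (rule image_compactin[rotated]) (simp add: compactin_subtopology cpt)
  moreover have "Blinfun ` (P \<inter> L) = {f. norm f \<le> r}"
  proof (intro equalityI subsetI)
    fix f assume "f \<in> Blinfun ` (P \<inter> L)"
    then obtain \<phi> where \<phi>: "\<phi> \<in> P \<inter> L" "f = Blinfun \<phi>" by blast
    then have "norm (blinfun_apply f x) \<le> r * norm x" for x using ap[OF \<phi>(1)] P[of \<phi>] by simp
    then show "f \<in> {f. norm f \<le> r}" using assms by (simp add: norm_blinfun_bound)
  next
    fix f :: "'a \<Rightarrow>\<^sub>L real" assume "f \<in> {f. norm f \<le> r}"
    then have "\<bar>blinfun_apply f x\<bar> \<le> r * norm x" for x
      using norm_blinfun[of f x] mult_right_mono[of "norm f" r "norm x"] by simp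
    then have "blinfun_apply f \<in> P \<inter> L" by (simp add: P L_def linear_iff blinfun.bilinear_simps)
    then show "f \<in> Blinfun ` (P \<inter> L)" by (metis blinfun_apply_inverse imageI)
  qed
  ultimately show ?thesis by simp
qed

section \<open>Extreme points of weak* compact convex sets\<close>

lemma maximizers_face:
  fixes C :: "('a::real_normed_vector \<Rightarrow>\<^sub>L real) set"
  assumes "convex C"
  shows "{g \<in> C. \<forall>h\<in>C. blinfun_apply h x \<le> blinfun_apply g x} face_of C" (is "?F face_of C")
  unfolding face_of_def
proof (intro conjI ballI impI)
  show "?F \<subseteq> C" by blast
  show "convex ?F"
  proof (rule convexI)
    fix g h and s t :: real
    assume gh: "g \<in> ?F" "h \<in> ?F" "0 \<le> s" "0 \<le> t" "s + t = 1"
    then have eq: "blinfun_apply g x = blinfun_apply h x" by (auto intro: antisym)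
    have "blinfun_apply (s *\<^sub>R g + t *\<^sub>R h) x = (s + t) * blinfun_apply h x"
      unfolding eq[symmetric] by (simp add: blinfun.bilinear_simps eq algebra_simps)
    then show "s *\<^sub>R g + t *\<^sub>R h \<in> ?F" using gh convexD[OF assms, of g h s t] by simp
  qed
next
  fix a b g assume ab: "a \<in> C" "b \<in> C" "g \<in> ?F" "g \<in> open_segment a b"
  then obtain t where t: "0 < t" "t < 1" "g = (1 - t) *\<^sub>R a + t *\<^sub>R b" by (auto simp: in_segment)
  have le: "blinfun_apply a x \<le> blinfun_apply g x" "blinfun_apply b x \<le> blinfun_apply g x"
    using ab by auto
  have "blinfun_apply g x = (1 - t) * blinfun_apply a x + t * blinfun_apply b x"
    by (simp add: t(3) blinfun.bilinear_simps)
  then have "(1 - t) * (blinfun_apply g x - blinfun_apply a x)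
      + t * (blinfun_apply g x - blinfun_apply b x) = 0" by algebra
  moreover have "0 \<le> (1 - t) * (blinfun_apply g x - blinfun_apply a x)"
    "0 \<le> t * (blinfun_apply g x - blinfun_apply b x)" using le t by auto
  ultimately have "(1 - t) * (blinfun_apply g x - blinfun_apply a x) = 0"
    "t * (blinfun_apply g x - blinfun_apply b x) = 0" by linarith+
  then have "blinfun_apply a x = blinfun_apply g x" "blinfun_apply b x = blinfun_apply g x"
    using t by auto
  then show "a \<in> ?F" "b \<in> ?F" using ab by auto
qed

lemma compactin_attains_max:
  assumes "compactin X C" "C \<noteq> {}" "continuous_map X euclideanreal h"
  obtains e where "e \<in> C" "\<And>g. g \<in> C \<Longrightarrow> h g \<le> h e"
proof -
  have "compact (h ` C)" using image_compactin[OF assms(1,3)] by simp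
  then show ?thesis using compact_attains_sup[of "h ` C"] assms(2) that by fastforce
qed

lemma compactin_maximizers:
  fixes C :: "('a::real_normed_vector \<Rightarrow>\<^sub>L real) set"
  assumes C: "compactin weak_star C" "C \<noteq> {}"
  shows "compactin weak_star {g \<in> C. \<forall>h\<in>C. blinfun_apply h x \<le> blinfun_apply g x}" (is "compactin _ ?F")
    and "{g \<in> C. \<forall>h\<in>C. blinfun_apply h x \<le> blinfun_apply g x} \<noteq> {}"
proof -
  obtain g where g: "g \<in> C" "\<And>h. h \<in> C \<Longrightarrow> blinfun_apply h x \<le> blinfun_apply g x"
    using compactin_attains_max[OF C continuous_map_weak_star_apply[of x]] by blast
  then have eq: "?F = C \<inter> {h. blinfun_apply h x \<in> {blinfun_apply g x..}}"
    by (auto intro: order_trans)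
  show "compactin weak_star ?F" unfolding eq
    by (intro compact_Int_closedin[OF C(1)] closedin_weak_star_vimage continuous_map_weak_star_apply closed_atLeast)
  show "?F \<noteq> {}" using g by blast
qed

text \<open>
  Both the existence of extreme points and the existence of minimizers rest on this form of
  the finite intersection property.
\<close>

lemma compactin_chain_Inter:
  assumes X: "Hausdorff_space X" and "\<K> \<noteq> {}"
    and cpt: "\<And>K. K \<in> \<K> \<Longrightarrow> compactin X K \<and> K \<noteq> {}"
    and chain: "\<And>K L. K \<in> \<K> \<Longrightarrow> L \<in> \<K> \<Longrightarrow> K \<subseteq> L \<or> L \<subseteq> K"
  shows "\<Inter>\<K> \<noteq> {}"
proof -
  obtain K0 where K0: "K0 \<in> \<K>" using \<open>\<K> \<noteq> {}\<close> by blast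
  have least: "\<exists>K\<in>\<K>. K \<subseteq> K0 \<inter> \<Inter>\<F>" if "finite \<F>" "\<F> \<subseteq> \<K>" for \<F>
    using that
  proof (induction \<F> rule: finite_induct)
    case empty
    then show ?case using K0 by auto
  next
    case (insert L \<F>)
    then obtain K where K: "K \<in> \<K>" "K \<subseteq> K0 \<inter> \<Inter>\<F>" by auto
    have L: "L \<in> \<K>" using insert.prems by simp
    from chain[OF K(1) L] show ?case
    proof
      assume "K \<subseteq> L"
      then have "K \<subseteq> K0 \<inter> \<Inter>(insert L \<F>)" using K(2) by simp
      then show ?thesis using K(1) by (rule bexI)
    next
      assume "L \<subseteq> K"
      then have "L \<subseteq> K0 \<inter> \<Inter>(insert L \<F>)" using K(2) by (simp add: subset_trans)
      then show ?thesis using L by (rule bexI)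
    qed
  qed
  have "compact_space (subtopology X K0)" using cpt[OF K0] compactin_subspace by blast
  moreover have "\<forall>C\<in>(\<lambda>K. K0 \<inter> K) ` \<K>. closedin (subtopology X K0) C"
    using cpt compactin_imp_closedin[OF X] by (auto simp: closedin_subtopology)
  moreover have "\<Inter>\<G> \<noteq> {}" if fin: "finite \<G>" "\<G> \<subseteq> (\<lambda>K. K0 \<inter> K) ` \<K>" for \<G>
  proof -
    obtain \<F> where \<F>: "\<F> \<subseteq> \<K>" "finite \<F>" "\<G> = (\<lambda>K. K0 \<inter> K) ` \<F>"
      using finite_subset_image[OF fin] by blast
    obtain K where "K \<in> \<K>" "K \<subseteq> K0 \<inter> \<Inter>\<F>" using least[OF \<F>(2,1)] by blast
    then have "K \<subseteq> \<Inter>\<G>" "K \<noteq> {}" using cpt \<F>(3) by auto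
    then show ?thesis by blast
  qed
  ultimately have "\<Inter>((\<lambda>K. K0 \<inter> K) ` \<K>) \<noteq> {}"
    unfolding compact_space_fip by blast
  moreover have "\<Inter>((\<lambda>K. K0 \<inter> K) ` \<K>) \<subseteq> \<Inter>\<K>" by blast
  ultimately show ?thesis by blast
qed

text \<open>
  A minimal nonempty compact face exists by Zorn's lemma.  It cannot contain two points: an
  evaluation that distinguishes them would have a strictly smaller face of maximizers.
\<close>

lemma exists_extreme_point:
  fixes C :: "('a::real_normed_vector \<Rightarrow>\<^sub>L real) set"
  assumes C: "compactin weak_star C" "convex C" "C \<noteq> {}"
  obtains e where "e extreme_point_of C"
proof -
  define A where "A = {F. F face_of C \<and> compactin weak_star F \<and> F \<noteq> {}}"
  have "\<exists>F\<in>A. \<forall>G\<in>A. G \<subseteq> F \<longrightarrow> G = F"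
  proof (rule predicate_Zorn[where P = "\<lambda>F G. G \<subseteq> F"])
    show "partial_order_on A (relation_of (\<lambda>F G. G \<subseteq> F) A)"
      by (rule partial_order_on_relation_ofI) auto
  next
    fix \<K> assume "\<K> \<in> Chains (relation_of (\<lambda>F G. G \<subseteq> F) A)"
    then have \<K>: "\<K> \<subseteq> A" and chain: "\<And>F G. F \<in> \<K> \<Longrightarrow> G \<in> \<K> \<Longrightarrow> F \<subseteq> G \<or> G \<subseteq> F"
      by (auto simp: Chains_def relation_of_def)
    show "\<exists>G\<in>A. \<forall>F\<in>\<K>. G \<subseteq> F"
    proof (cases "\<K> = {}")
      case True
      have "C \<in> A" using C by (simp add: A_def face_of_refl)
      then show ?thesis using True by blast
    next
      case False
      then obtain F where F: "F \<in> \<K>" by blast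
      have "\<Inter>\<K> \<noteq> {}"
        by (rule compactin_chain_Inter[OF Hausdorff_weak_star False _ chain]) (use \<K> in \<open>auto simp: A_def\<close>)
      moreover have "\<Inter>\<K> face_of C"
        using False \<K> by (intro face_of_Inter) (auto simp: A_def)
      moreover have "compactin weak_star (\<Inter>\<K>)"
        by (rule closed_compactin_Inter[of _ F])
          (use F \<K> in \<open>auto simp: A_def intro: compactin_imp_closedin[OF Hausdorff_weak_star]\<close>)
      ultimately show ?thesis by (intro bexI[of _ "\<Inter>\<K>"]) (auto simp: A_def)
    qed
  qed
  then obtain F where F: "F \<in> A" and min: "\<And>G. G \<in> A \<Longrightarrow> G \<subseteq> F \<Longrightarrow> G = F" by blast
  have cF: "compactin weak_star F" "F \<noteq> {}" "F face_of C" using F by (auto simp: A_def)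
  obtain e where e: "e \<in> F" using cF by blast
  have "blinfun_apply f x = blinfun_apply e x" if "f \<in> F" for f x
  proof -
    define G where "G = {g \<in> F. \<forall>h\<in>F. blinfun_apply h x \<le> blinfun_apply g x}"
    have "G face_of C"
      using face_of_trans[OF maximizers_face[OF face_of_imp_convex[OF cF(3)]] cF(3)]
      unfolding G_def .
    moreover have "compactin weak_star G" "G \<noteq> {}"
      unfolding G_def by (fact compactin_maximizers[OF cF(1,2)])+
    ultimately have "G \<in> A" by (auto simp: A_def)
    then have "G = F" by (rule min) (auto simp: G_def)
    then have "f \<in> G" "e \<in> G" using that e by auto
    then show ?thesis by (auto simp: G_def intro: antisym)
  qed
  then have "F = {e}" using e by (auto intro: blinfun_eqI)
  then show ?thesis using that cF(3) face_of_singleton by blast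
qed

text \<open>
  Finitely many evaluations already keep \<open>f\<close> away from \<open>C\<close>, by compactness.  With respect to the sum
  of their squared differences there is a point \<open>g0\<close> of \<open>C\<close> nearest to \<open>f\<close>, and the separating
  evaluation is the one that corresponds to the vector from \<open>g0\<close> to \<open>f\<close>.
\<close>

lemma separation_compact_convex:
  fixes C :: "('a::real_normed_vector \<Rightarrow>\<^sub>L real) set"
  assumes C: "compactin weak_star C" "convex C" "f \<notin> C"
  obtains x where "\<And>g. g \<in> C \<Longrightarrow> blinfun_apply g x < blinfun_apply f x"
proof (cases "C = {}")
  case False
  define O' where "O' x = {g. blinfun_apply g x \<in> - {blinfun_apply f x}}" for x
  have "\<forall>V\<in>range O'. openin weak_star V"
    unfolding O'_def
    by (intro ballI, elim rangeE) (simp only: openin_weak_star_vimage[OF continuous_map_weak_star_apply] open_Compl closed_singleton)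
  moreover have "C \<subseteq> \<Union>(range O')"
  proof
    fix g assume "g \<in> C"
    then have "g \<noteq> f" using C by blast
    then obtain x where "blinfun_apply g x \<noteq> blinfun_apply f x" by (meson blinfun_eqI)
    then show "g \<in> \<Union>(range O')" by (auto simp: O'_def)
  qed
  ultimately obtain \<F> where \<F>: "finite \<F>" "\<F> \<subseteq> range O'" "C \<subseteq> \<Union>\<F>"
    using C(1) unfolding compactin_def by metis
  then obtain X where X: "finite X" "\<F> = O' ` X" using finite_subset_image[OF \<F>(1,2)] by blast
  define h where "h g = - (\<Sum>x\<in>X. (blinfun_apply g x - blinfun_apply f x)\<^sup>2)" for g
  have "continuous_map weak_star euclideanreal h"
    unfolding h_def
    by (intro continuous_intros continuous_map_weak_star_apply X)
  then obtain g0 where g0: "g0 \<in> C" "\<And>g. g \<in> C \<Longrightarrow> h g \<le> h g0"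
    using compactin_attains_max[OF C(1) False] by blast
  \<comment> \<open>\<open>A\<close> is the squared distance of \<open>f\<close> from \<open>C\<close>; the point \<open>z\<close> represents the vector from \<open>g0\<close> to \<open>f\<close>.\<close>
  define a where "a x = blinfun_apply g0 x - blinfun_apply f x" for x
  define A where "A = (\<Sum>x\<in>X. (a x)\<^sup>2)"
  obtain x0 where "x0 \<in> X" "blinfun_apply g0 x0 \<noteq> blinfun_apply f x0"
    using g0(1) \<F>(3) X(2) by (auto simp: O'_def)
  then have "0 < A" unfolding A_def by (intro sum_pos2[OF X(1)]) (auto simp: a_def)
  define z where "z = (\<Sum>x\<in>X. (- a x) *\<^sub>R x)"
  have "blinfun_apply g z < blinfun_apply f z" if "g \<in> C" for g
  proof -
    define b where "b x = blinfun_apply g x - blinfun_apply g0 x" for x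
    define B D where "B = (\<Sum>x\<in>X. a x * b x)" and "D = (\<Sum>x\<in>X. (b x)\<^sup>2)"
    \<comment> \<open>Moving from \<open>g0\<close> towards \<open>g\<close> does not decrease the squared distance; the first-order
      term of this inequality is \<open>0 \<le> B\<close>.\<close>
    have quad: "0 \<le> 2 * t * B + t\<^sup>2 * D" if "0 \<le> t" "t \<le> 1" for t
    proof -
      have "(1 - t) *\<^sub>R g0 + t *\<^sub>R g \<in> C" using convexD[OF C(2) g0(1) \<open>g \<in> C\<close>] that by simp
      then have "h ((1 - t) *\<^sub>R g0 + t *\<^sub>R g) \<le> h g0" by (rule g0(2))
      moreover have "h ((1 - t) *\<^sub>R g0 + t *\<^sub>R g) = - (\<Sum>x\<in>X. (a x + t * b x)\<^sup>2)"
        unfolding h_def a_def b_def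
        by (intro arg_cong[where f = uminus] sum.cong refl) (simp add: blinfun.bilinear_simps algebra_simps)
      moreover have "(\<Sum>x\<in>X. (a x + t * b x)\<^sup>2) = A + (2 * t * B + t\<^sup>2 * D)"
        unfolding A_def B_def D_def sum_distrib_left sum.distrib[symmetric]
        by (intro sum.cong refl) (simp add: power2_eq_square algebra_simps)
      moreover have "h g0 = - A" by (simp add: h_def A_def a_def)
      ultimately show ?thesis by linarith
    qed
    have "0 \<le> B"
    proof (rule ccontr)
      assume "\<not> 0 \<le> B"
      define t where "t = min 1 (- B / (D + 1))"
      have "0 \<le> D" unfolding D_def by (intro sum_nonneg) auto
      then have t: "0 < t" "t \<le> 1" "t \<le> (- B) / (D + 1)"
        using \<open>\<not> 0 \<le> B\<close> by (auto simp: t_def divide_neg_pos)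
      have "t * (D + 1) \<le> - B" using t(3) \<open>0 \<le> D\<close> by (subst (asm) pos_le_divide_eq) auto
      have "0 \<le> t * (2 * B + t * D)" using quad[of t] t by (simp add: power2_eq_square algebra_simps)
      then have "0 \<le> 2 * B + t * D" using t(1) by (simp add: zero_le_mult_iff)
      moreover have "t * D \<le> - B" using t(1) \<open>t * (D + 1) \<le> - B\<close> by (simp add: algebra_simps)
      ultimately show False using \<open>\<not> 0 \<le> B\<close> by linarith
    qed
    moreover have "blinfun_apply g z - blinfun_apply f z = - B - A"
    proof -
      have "blinfun_apply g z - blinfun_apply f z = (\<Sum>x\<in>X. - (a x * b x) - (a x)\<^sup>2)"
        unfolding z_def blinfun.sum_right sum_subtractf[symmetric]
        by (intro sum.cong refl) (simp add: a_def b_def blinfun.bilinear_simps power2_eq_square algebra_simps)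
      then show ?thesis by (simp add: B_def A_def sum_subtractf sum_negf)
    qed
    ultimately show ?thesis using \<open>0 < A\<close> by linarith
  qed
  then show ?thesis by (rule that)
qed (use that in blast)

text \<open>
  Convex combination is separately continuous, so the closure of \<open>D\<close> is reached in two steps:
  first one end point of the segment is moved into the closure, then the other.
\<close>

lemma convex_weak_star_closure:
  assumes D: "convex D"
  shows "convex (weak_star closure_of D)"
proof -
  have step: "s *\<^sub>R f + t *\<^sub>R g \<in> weak_star closure_of D"
    if "f \<in> weak_star closure_of D" and g: "\<And>f. f \<in> D \<Longrightarrow> s *\<^sub>R f + t *\<^sub>R g \<in> weak_star closure_of D"
    for s t f g
  proof -
    have "continuous_map weak_star weak_star (\<lambda>f. s *\<^sub>R f + t *\<^sub>R g)"
      unfolding continuous_on_strong_operator_topo_iff_coordinatewise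
      by (auto simp: blinfun.bilinear_simps intro!: continuous_intros continuous_map_weak_star_apply)
    then have "(\<lambda>f. s *\<^sub>R f + t *\<^sub>R g) ` (weak_star closure_of D)
        \<subseteq> weak_star closure_of ((\<lambda>f. s *\<^sub>R f + t *\<^sub>R g) ` D)"
      by (rule continuous_map_image_closure_subset)
    also have "\<dots> \<subseteq> weak_star closure_of (weak_star closure_of D)"
      using g by (intro closure_of_mono) auto
    finally show ?thesis using that(1) by auto
  qed
  have DC: "f \<in> weak_star closure_of D" if "f \<in> D" for f
    using that closure_of_subset[of D weak_star] by auto
  show ?thesis
  proof (rule convexI)
    fix f g and s t :: real
    assume fg: "f \<in> weak_star closure_of D" "g \<in> weak_star closure_of D"
      and st: "0 \<le> s" "0 \<le> t" "s + t = 1"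
    have "s *\<^sub>R f' + t *\<^sub>R g \<in> weak_star closure_of D" if "f' \<in> D" for f'
    proof -
      have "t *\<^sub>R h + s *\<^sub>R f' \<in> weak_star closure_of D" if "h \<in> D" for h
        using convexD[OF D that \<open>f' \<in> D\<close>, of t s] st by (intro DC) (simp add: add.commute)
      then have "t *\<^sub>R g + s *\<^sub>R f' \<in> weak_star closure_of D" by (rule step[OF fg(2)])
      then show ?thesis by (simp add: add.commute)
    qed
    then show "s *\<^sub>R f + t *\<^sub>R g \<in> weak_star closure_of D" by (rule step[OF fg(1)])
  qed
qed

text \<open>
  A point outside the closed hull would be separated from it by an evaluation; the face where that
  evaluation is maximal contains an extreme point, which is on the wrong side.
\<close>

theorem Krein_Milman_weak_star:
  fixes S :: "('a::real_normed_vector \<Rightarrow>\<^sub>L real) set"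
  assumes S: "compactin weak_star S" "convex S"
  shows "S = weak_star closure_of (convex hull {e. e extreme_point_of S})"
proof -
  define C where "C = weak_star closure_of (convex hull {e. e extreme_point_of S})"
  have closed: "closedin weak_star S" using compactin_imp_closedin[OF Hausdorff_weak_star S(1)] .
  have "convex hull {e. e extreme_point_of S} \<subseteq> S"
    by (rule hull_minimal) (use S in \<open>auto simp: extreme_point_of_def\<close>)
  then have CS: "C \<subseteq> S" unfolding C_def using closed by (rule closure_of_minimal)
  have "f \<in> C" if "f \<in> S" for f
  proof (rule ccontr)
    assume "f \<notin> C"
    have "compactin weak_star C" using closed_compactin[OF S(1) CS] by (simp add: C_def)
    moreover have "convex C" unfolding C_def by (intro convex_weak_star_closure convex_convex_hull)
    ultimately obtain x where x: "\<And>g. g \<in> C \<Longrightarrow> blinfun_apply g x < blinfun_apply f x"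
      using separation_compact_convex \<open>f \<notin> C\<close> by blast
    define F where "F = {g \<in> S. \<forall>h\<in>S. blinfun_apply h x \<le> blinfun_apply g x}"
    have face: "F face_of S" unfolding F_def by (rule maximizers_face[OF S(2)])
    have "S \<noteq> {}" using that by blast
    then have "compactin weak_star F" "F \<noteq> {}"
      unfolding F_def using compactin_maximizers[OF S(1)] by blast+
    then obtain e where "e extreme_point_of F"
      using exists_extreme_point face_of_imp_convex[OF face] by blast
    then have e: "e extreme_point_of S" "e \<in> F" using extreme_point_of_face[OF face] by auto
    then have "e \<in> convex hull {e. e extreme_point_of S}" by (simp add: hull_inc)
    then have "e \<in> C" unfolding C_def
      using closure_of_subset[of "convex hull {e. e extreme_point_of S}" weak_star] by auto
    then show False using x[of e] e(2) \<open>f \<in> S\<close> by (force simp: F_def)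
  qed
  then show ?thesis using CS by (auto simp: C_def)
qed

section \<open>Minimizers of functions with compact sublevel sets\<close>

lemma compactin_sublevels_arg_min:
  fixes G :: "'a \<Rightarrow> ereal"
  assumes X: "Hausdorff_space X"
    and sub: "\<And>c::real. compactin X {f. G f \<le> ereal c}"
    and nonneg: "\<And>f. 0 \<le> G f" and fin: "G f0 < \<infinity>"
  shows "{f. is_arg_min G (\<lambda>_. True) f} \<noteq> {}" "compactin X {f. is_arg_min G (\<lambda>_. True) f}"
proof -
  have "0 \<le> (INF f. G f)" using nonneg by (intro INF_greatest) auto
  moreover have "(INF f. G f) < \<infinity>" using INF_lower[of f0 UNIV G] fin by auto
  ultimately obtain m where m: "(INF f. G f) = ereal m" by (cases "INF f. G f") auto
  define \<K> where "\<K> = (\<lambda>c. {f. G f \<le> ereal c}) ` {m<..}"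
  have "f \<in> \<Inter>\<K> \<longleftrightarrow> G f \<le> ereal m" for f
  proof
    assume f: "f \<in> \<Inter>\<K>"
    show "G f \<le> ereal m"
    proof (rule ccontr)
      assume "\<not> G f \<le> ereal m"
      then obtain c where c: "ereal m < ereal c" "ereal c < G f" using ereal_dense2 by (meson not_le)
      then have "{f. G f \<le> ereal c} \<in> \<K>" by (simp add: \<K>_def)
      then show False using f c(2) by fastforce
    qed
  qed (auto simp: \<K>_def intro: order_trans)
  moreover have "is_arg_min G (\<lambda>_. True) f \<longleftrightarrow> G f \<le> ereal m" for f
    unfolding m[symmetric] is_arg_min_def by (auto simp: not_less le_INF_iff)
  ultimately have eq: "{f. is_arg_min G (\<lambda>_. True) f} = \<Inter>\<K>" by blast
  have K1: "{f. G f \<le> ereal (m + 1)} \<in> \<K>" unfolding \<K>_def by (rule imageI) simp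
  have cpt: "compactin X K \<and> K \<noteq> {}" if K: "K \<in> \<K>" for K
  proof -
    obtain c where c: "K = {f. G f \<le> ereal c}" "m < c" using K by (auto simp: \<K>_def)
    then have "(INF f. G f) < ereal c" using m by simp
    then obtain f where "G f < ereal c" by (auto simp: INF_less_iff)
    then show ?thesis using sub[of c] c(1) by (auto intro: less_imp_le)
  qed
  show "{f. is_arg_min G (\<lambda>_. True) f} \<noteq> {}"
    unfolding eq
  proof (rule compactin_chain_Inter[OF X _ cpt])
    show "\<K> \<noteq> {}" using K1 by blast
    fix K L assume "K \<in> \<K>" "L \<in> \<K>"
    then obtain c d where cd: "K = {f. G f \<le> ereal c}" "L = {f. G f \<le> ereal d}" by (auto simp: \<K>_def)
    show "K \<subseteq> L \<or> L \<subseteq> K"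
    proof (cases "c \<le> d")
      case True then show ?thesis unfolding cd by (auto intro: order_trans[of _ "ereal c"])
    next
      case False then show ?thesis unfolding cd by (auto intro: order_trans[of _ "ereal d"])
    qed
  qed
  show "compactin X {f. is_arg_min G (\<lambda>_. True) f}"
    unfolding eq using cpt K1 by (intro closed_compactin_Inter[OF _ K1] compactin_imp_closedin[OF X]) blast+
qed

section \<open>Spanning a point by extreme points\<close>

text \<open>
  The linear space parallel to the smallest face of \<open>C\<close> that contains \<open>s\<close>, provided that \<open>C\<close> is
  convex and \<open>s\<close> belongs to it.
\<close>

definition face_directions :: "'a::real_vector set \<Rightarrow> 'a \<Rightarrow> 'a set"
  where "face_directions C s = {d. \<exists>e>0. s + e *\<^sub>R d \<in> C \<and> s - e *\<^sub>R d \<in> C}"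

lemma face_directionsE:
  assumes "convex C" "d \<in> face_directions C s"
  obtains e where "0 < e" "\<And>t. \<bar>t\<bar> \<le> e \<Longrightarrow> s + t *\<^sub>R d \<in> C"
proof -
  obtain e where e: "0 < e" "s + e *\<^sub>R d \<in> C" "s - e *\<^sub>R d \<in> C"
    using assms(2) by (auto simp: face_directions_def)
  have "s + t *\<^sub>R d \<in> C" if t: "\<bar>t\<bar> \<le> e" for t
  proof -
    define l where "l = (e + t) / (2 * e)"
    have l: "0 \<le> l" "l \<le> 1" "2 * l * e = e + t" using e(1) t by (auto simp: l_def field_simps)
    have "l *\<^sub>R (s + e *\<^sub>R d) + (1 - l) *\<^sub>R (s - e *\<^sub>R d) = s + (2 * l * e - e) *\<^sub>R d"
      by (simp add: algebra_simps flip: scaleR_left_distrib)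
    then show ?thesis using convexD[OF assms(1) e(2,3), of l "1 - l"] l by simp
  qed
  then show ?thesis using e(1) that by blast
qed

lemma subspace_face_directions:
  assumes C: "convex C" "s \<in> C"
  shows "subspace (face_directions C s)"
  unfolding subspace_def
proof (intro conjI ballI allI)
  show "0 \<in> face_directions C s" using C by (auto simp: face_directions_def intro: exI[of _ 1])
next
  fix c d assume cd: "c \<in> face_directions C s" "d \<in> face_directions C s"
  obtain e where e: "0 < e" "\<And>t. \<bar>t\<bar> \<le> e \<Longrightarrow> s + t *\<^sub>R c \<in> C" using face_directionsE[OF C(1) cd(1)] by blast
  obtain f where f: "0 < f" "\<And>t. \<bar>t\<bar> \<le> f \<Longrightarrow> s + t *\<^sub>R d \<in> C" using face_directionsE[OF C(1) cd(2)] by blast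
  define g where "g = min e f"
  have g: "0 < g" "g \<le> e" "g \<le> f" using e f by (auto simp: g_def)
  have mid: "s + (t / 2) *\<^sub>R (c + d) \<in> C" if "\<bar>t\<bar> \<le> g" for t
  proof -
    have "(1/2) *\<^sub>R (s + t *\<^sub>R c) + (1/2) *\<^sub>R (s + t *\<^sub>R d) \<in> C"
      using that g by (intro convexD[OF C(1) e(2) f(2)]) auto
    moreover have "(1/2) *\<^sub>R (s + t *\<^sub>R c) + (1/2) *\<^sub>R (s + t *\<^sub>R d)
        = (1/2 + 1/2) *\<^sub>R s + (t / 2) *\<^sub>R (c + d)"
      unfolding scaleR_left_distrib by (simp add: scaleR_right_distrib)
    ultimately show ?thesis by simp
  qed
  show "c + d \<in> face_directions C s"
    unfolding face_directions_def using g mid[of g] mid[of "- g"] by (intro CollectI exI[of _ "g / 2"]) simp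
next
  fix r :: real and d assume d: "d \<in> face_directions C s"
  obtain f where f: "0 < f" "\<And>t. \<bar>t\<bar> \<le> f \<Longrightarrow> s + t *\<^sub>R d \<in> C" using face_directionsE[OF C(1) d] by blast
  define e where "e = f / (\<bar>r\<bar> + 1)"
  have e: "0 < e" "e * \<bar>r\<bar> \<le> f" using f(1) by (auto simp: e_def field_simps)
  then have "s + (e * r) *\<^sub>R d \<in> C" "s + (- (e * r)) *\<^sub>R d \<in> C"
    by (intro f(2); simp add: abs_mult)+
  then show "r *\<^sub>R d \<in> face_directions C s"
    unfolding face_directions_def using e(1) by (intro CollectI exI[of _ e]) simp
qed

lemma extreme_pointI_face_directions:
  assumes "s \<in> C" "face_directions C s \<subseteq> {0}" "convex C"
  shows "s extreme_point_of C"
  unfolding extreme_point_of_def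
proof (intro conjI ballI notI)
  fix a b assume ab: "a \<in> C" "b \<in> C" "s \<in> open_segment a b"
  then obtain t where t: "0 < t" "t < 1" "s = (1 - t) *\<^sub>R a + t *\<^sub>R b" "a \<noteq> b" by (auto simp: in_segment)
  define e where "e = min t (1 - t)"
  have e: "0 < e" "e \<le> t" "e \<le> 1 - t" using t by (auto simp: e_def)
  have "s + r *\<^sub>R (b - a) \<in> closed_segment a b" if "\<bar>r\<bar> \<le> e" for r
    unfolding in_segment using that e t(3) by (intro exI[of _ "t + r"]) (auto simp: algebra_simps)
  then have "s + r *\<^sub>R (b - a) \<in> C" if "\<bar>r\<bar> \<le> e" for r
    using closed_segment_subset[OF ab(1,2) assms(3)] that by blast
  from this[of e] this[of "- e"] have "b - a \<in> face_directions C s"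
    unfolding face_directions_def using e(1) by (intro CollectI exI[of _ e]) simp
  then show False using assms(2) t(4) by auto
qed (fact assms(1))

lemma extreme_point_symmetric:
  assumes "x extreme_point_of A" "x + a \<in> A" "x - a \<in> A"
  shows "a = 0"
proof (rule ccontr)
  assume "a \<noteq> 0"
  have "x + a \<noteq> x - a"
  proof
    assume "x + a = x - a"
    then have "(x + a) - (x - a) = 0" by simp
    then have "2 *\<^sub>R a = 0" by (simp add: scaleR_2)
    then show False using \<open>a \<noteq> 0\<close> by simp
  qed
  moreover have "x = (1 - 1/2) *\<^sub>R (x + a) + (1/2) *\<^sub>R (x - a)"
    by (simp add: algebra_simps flip: scaleR_left_distrib)
  ultimately have "x \<in> open_segment (x + a) (x - a)"
    unfolding in_segment by (intro conjI exI[of _ "1/2"]) auto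
  then show False using assms unfolding extreme_point_of_def by blast
qed

text \<open>
  From a point that is not extreme one can walk along a face direction, both ways, until \<open>C\<close> is
  left.  At each of the two exit points the space of face directions is smaller, because it has
  lost the direction of the walk, and the starting point is a combination of the exit points.
  The number \<open>k\<close> bounds the dimension of the space of face directions and decreases.
\<close>

lemma in_span_extreme_points:
  fixes C :: "'a::real_vector set"
  assumes C: "convex C"
    and line: "\<And>s d. s \<in> C \<Longrightarrow> d \<noteq> 0 \<Longrightarrow> compact {t::real. s + t *\<^sub>R d \<in> C}"
    and s: "s \<in> C"
    and dim: "\<And>T. finite T \<Longrightarrow> independent T \<Longrightarrow> T \<subseteq> face_directions C s \<Longrightarrow> card T \<le> k"
  shows "s \<in> span ({e. e extreme_point_of C} \<inter> span (insert s (face_directions C s)))"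
  using s dim
proof (induction k arbitrary: s rule: less_induct)
  case (less k)
  define L where "L = face_directions C s"
  define Q where "Q = {e. e extreme_point_of C} \<inter> span (insert s L)"
  have L: "subspace L" unfolding L_def by (rule subspace_face_directions[OF C less.prems(1)])
  show ?case
  proof (cases "L \<subseteq> {0}")
    case True
    then have "s \<in> Q" unfolding Q_def L_def
      using extreme_pointI_face_directions less.prems(1) C by (simp add: span_base)
    then show ?thesis unfolding Q_def[unfolded L_def, symmetric] by (rule span_base)
  next
    case False
    have step: "\<exists>\<tau>>0. s + \<tau> *\<^sub>R d \<in> span Q" if d: "d \<in> L" "d \<noteq> 0" for d
    proof -
      obtain e0 where e0: "0 < e0" "\<And>t. \<bar>t\<bar> \<le> e0 \<Longrightarrow> s + t *\<^sub>R d \<in> C"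
        using face_directionsE[OF C d(1)[unfolded L_def]] by blast
      define R where "R = {t. s + t *\<^sub>R d \<in> C}"
      have "compact R" "e0 \<in> R" unfolding R_def using line[OF less.prems(1) d(2)] e0 by auto
      then obtain \<tau> where \<tau>: "\<tau> \<in> R" "\<And>t. t \<in> R \<Longrightarrow> t \<le> \<tau>"
        using compact_attains_sup[of R] by blast
      have "0 < \<tau>" using \<tau>(2)[OF \<open>e0 \<in> R\<close>] e0(1) by linarith
      define s1 where "s1 = s + \<tau> *\<^sub>R d"
      have s1: "s1 \<in> C" using \<tau>(1) by (simp add: R_def s1_def)
      have dn: "d \<notin> face_directions C s1"
      proof
        assume "d \<in> face_directions C s1"
        then obtain e where "0 < e" "s1 + e *\<^sub>R d \<in> C" by (auto simp: face_directions_def)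
        then show False using \<tau>(2)[of "\<tau> + e"] by (simp add: R_def s1_def algebra_simps)
      qed
      have sub: "face_directions C s1 \<subseteq> L"
      proof
        fix g assume "g \<in> face_directions C s1"
        then obtain e where e: "0 < e" "\<And>t. \<bar>t\<bar> \<le> e \<Longrightarrow> s1 + t *\<^sub>R g \<in> C"
          using face_directionsE[OF C] by blast
        \<comment> \<open>The weight with which \<open>s\<close> is a convex combination of \<open>s1\<close> and \<open>s - e0 *\<^sub>R d\<close>.\<close>
        define l where "l = e0 / (e0 + \<tau>)"
        have l: "0 < l" "l < 1" "l * (e0 + \<tau>) = e0" using e0(1) \<open>0 < \<tau>\<close> by (auto simp: l_def field_simps)
        have "s + (l * t) *\<^sub>R g \<in> C" if "\<bar>t\<bar> \<le> e" for t
        proof -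
          have "l *\<^sub>R (s1 + t *\<^sub>R g) + (1 - l) *\<^sub>R (s + (- e0) *\<^sub>R d) \<in> C"
            using that l e0(1) by (intro convexD[OF C e(2) e0(2)]) auto
          moreover have "l *\<^sub>R (s1 + t *\<^sub>R g) + (1 - l) *\<^sub>R (s + (- e0) *\<^sub>R d)
              = s + (l * t) *\<^sub>R g + (l * (e0 + \<tau>) - e0) *\<^sub>R d"
            by (simp add: s1_def algebra_simps)
          ultimately show ?thesis using l(3) by simp
        qed
        from this[of e] this[of "- e"] show "g \<in> L"
          unfolding L_def face_directions_def using e(1) l(1) by (intro CollectI exI[of _ "l * e"]) simp
      qed
      have bound: "card T < k" if T: "finite T" "independent T" "T \<subseteq> face_directions C s1" for T
      proof -
        have "span T \<subseteq> face_directions C s1"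
          using T(3) subspace_face_directions[OF C s1] by (rule span_minimal)
        then have "d \<notin> span T" using dn by blast
        then have "independent (insert d T)" "d \<notin> T"
          using independent_insertI[OF _ T(2)] span_base[of d T] by blast+
        then have "card (insert d T) \<le> k"
          using less.prems(2)[of "insert d T"] T sub d(1) by (auto simp: L_def)
        then show ?thesis using T(1) \<open>d \<notin> T\<close> by simp
      qed
      have "0 < k" using bound[of "{}"] by (simp add: independent_empty)
      have "s1 \<in> span ({e. e extreme_point_of C} \<inter> span (insert s1 (face_directions C s1)))"
      proof (rule less.IH[of "k - 1"])
        show "k - 1 < k" using \<open>0 < k\<close> by simp
        show "card T \<le> k - 1" if "finite T" "independent T" "T \<subseteq> face_directions C s1" for T
          using bound[OF that] by simp
      qed (fact s1)
      moreover have "insert s1 (face_directions C s1) \<subseteq> span (insert s L)"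
        using sub d(1) unfolding s1_def
        by (auto intro!: span_add span_scale intro: span_base)
      then have "span (insert s1 (face_directions C s1)) \<subseteq> span (insert s L)"
        by (rule span_minimal) (rule subspace_span)
      ultimately have "s1 \<in> span Q"
        unfolding Q_def by (meson Int_mono order_refl span_mono subsetD)
      then show ?thesis using \<open>0 < \<tau>\<close> unfolding s1_def by blast
    qed
    obtain d where d: "d \<in> L" "d \<noteq> 0" using False by blast
    then have "- d \<in> L" "- d \<noteq> 0" using L by (auto simp: subspace_neg)
    then obtain \<sigma> where \<sigma>: "0 < \<sigma>" "s + \<sigma> *\<^sub>R (- d) \<in> span Q" using step by blast
    obtain \<tau> where \<tau>: "0 < \<tau>" "s + \<tau> *\<^sub>R d \<in> span Q" using step[OF d] by blast
    have "\<sigma> *\<^sub>R (s + \<tau> *\<^sub>R d) + \<tau> *\<^sub>R (s + \<sigma> *\<^sub>R (- d)) \<in> span Q"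
      by (rule span_add[OF span_scale[OF \<tau>(2)] span_scale[OF \<sigma>(2)]])
    also have "\<sigma> *\<^sub>R (s + \<tau> *\<^sub>R d) + \<tau> *\<^sub>R (s + \<sigma> *\<^sub>R (- d)) = (\<sigma> + \<tau>) *\<^sub>R s"
      by (simp add: algebra_simps)
    finally have "(1 / (\<sigma> + \<tau>)) *\<^sub>R ((\<sigma> + \<tau>) *\<^sub>R s) \<in> span Q" by (rule span_scale)
    then show ?thesis using \<sigma>(1) \<tau>(1) unfolding Q_def L_def by simp
  qed
qed

lemma span_sum_of_at_most:
  fixes Q :: "'a::real_vector set"
  assumes s: "s \<in> span Q"
    and dim: "\<And>T. finite T \<Longrightarrow> independent T \<Longrightarrow> T \<subseteq> Q \<Longrightarrow> card T \<le> K"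
  obtains n c e where "n \<le> K" "\<And>k. k \<in> {1..n} \<Longrightarrow> e k \<in> Q" "s = (\<Sum>k=1..n. c k *\<^sub>R e k)"
proof -
  obtain B where B: "B \<subseteq> Q" "independent B" "Q \<subseteq> span B" by (rule maximal_independent_subset)
  have "finite B"
  proof (rule ccontr)
    assume "infinite B"
    then obtain T where T: "T \<subseteq> B" "finite T" "card T = Suc K" using infinite_arbitrarily_large by blast
    then have "card T \<le> K" using B independent_mono[OF B(2) T(1)] by (intro dim) auto
    then show False using T(3) by simp
  qed
  have "s \<in> span B" using s B(3) span_minimal[OF B(3) subspace_span] by blast
  then obtain r where r: "s = (\<Sum>b\<in>B. r b *\<^sub>R b)" using span_finite[OF \<open>finite B\<close>] by auto
  obtain h where h: "bij_betw h {1..card B} B" using ex_bij_betw_nat_finite_1[OF \<open>finite B\<close>] by blast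
  show ?thesis
  proof (rule that)
    show "card B \<le> K" using dim \<open>finite B\<close> B by blast
    show "h k \<in> Q" if "k \<in> {1..card B}" for k using h that B(1) by (auto simp: bij_betw_def)
    show "s = (\<Sum>k=1..card B. (r \<circ> h) k *\<^sub>R h k)"
      using sum.reindex_bij_betw[OF h, of "\<lambda>b. r b *\<^sub>R b"] r by simp
  qed
qed

section \<open>Interpolation of finitely many measurements\<close>

text \<open>
  The norm of the combination is continuous and does not vanish on the compact unit sphere of
  coefficient vectors; \<open>\<delta>\<close> is its minimum there.
\<close>

lemma basis_coefficients_bounded:
  fixes g :: "'m::finite \<Rightarrow> 'x::real_normed_vector"
  assumes g: "lin_indep_family g UNIV"
  obtains \<delta> where "0 < \<delta>" "\<And>c :: real ^ 'm. \<delta> * norm c \<le> norm (\<Sum>i\<in>UNIV. c $ i *\<^sub>R g i)"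
proof -
  define h where "h c = (\<Sum>i\<in>UNIV. c $ i *\<^sub>R g i)" for c :: "real ^ 'm"
  have inj: "c = 0" if "h c = 0" for c
  proof -
    have ind: "independent (range g)" "inj g" using g by (auto simp: lin_indep_family_def)
    have "(\<Sum>v\<in>range g. c $ (inv g v) *\<^sub>R v) = 0"
      using that ind(2) by (simp add: h_def sum.reindex o_def)
    then have "c $ (inv g v) = 0" if "v \<in> range g" for v
      using ind(1) that independentD[of "range g" "range g" "\<lambda>v. c $ (inv g v)" v] by simp
    then show "c = 0" using ind(2) by (simp add: vec_eq_iff) (metis inv_f_f rangeI)
  qed
  have cont: "continuous_on (sphere 0 1) (\<lambda>c. norm (h c))" unfolding h_def by (intro continuous_intros)
  have "axis undefined 1 \<in> sphere (0 :: real ^ 'm) 1" by (simp add: norm_axis_1)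
  then have "sphere (0 :: real ^ 'm) 1 \<noteq> {}" by blast
  then obtain c0 where c0: "c0 \<in> sphere 0 1" "\<And>c. c \<in> sphere 0 1 \<Longrightarrow> norm (h c0) \<le> norm (h c)"
    using continuous_attains_inf[OF compact_sphere _ cont] by blast
  show ?thesis
  proof (rule that)
    show "0 < norm (h c0)" using inj[of c0] c0(1) by auto
    show "norm (h c0) * norm c \<le> norm (\<Sum>i\<in>UNIV. c $ i *\<^sub>R g i)" for c
    proof (cases "c = 0")
      case False
      have "norm (h c0) \<le> norm (h ((1 / norm c) *\<^sub>R c))" using False by (intro c0(2)) simp
      also have "h ((1 / norm c) *\<^sub>R c) = (1 / norm c) *\<^sub>R h c"
        by (simp add: h_def scaleR_sum_right)
      finally show ?thesis using False by (simp add: h_def field_simps)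
    qed simp
  qed
qed

text \<open>
  The functional with the prescribed values on the span of the \<open>\<nu> i\<close> is bounded, by
  \<open>basis_coefficients_bounded\<close>, and the Hahn-Banach theorem extends it.
\<close>

lemma measure_op_surj:
  fixes \<nu> :: "'m::finite \<Rightarrow> 'x::real_normed_vector"
  assumes \<nu>: "lin_indep_family \<nu> UNIV"
  obtains f where "measure_op \<nu> f = z"
proof -
  have ind: "independent (range \<nu>)" "inj \<nu>" using \<nu> by (auto simp: lin_indep_family_def)
  obtain \<phi> where \<phi>: "linear \<phi>" "\<And>v. v \<in> range \<nu> \<Longrightarrow> \<phi> v = z $ inv \<nu> v"
    using linear_independent_extend[OF ind(1), of "\<lambda>v. z $ inv \<nu> v"] by blast
  have \<phi>\<nu>: "\<phi> (\<nu> i) = z $ i" for i using \<phi>(2)[of "\<nu> i"] ind(2) by simp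
  obtain \<delta> where \<delta>: "0 < \<delta>" "\<And>c :: real ^ 'm. \<delta> * norm c \<le> norm (\<Sum>i\<in>UNIV. c $ i *\<^sub>R \<nu> i)"
    using basis_coefficients_bounded[OF \<nu>] by blast
  define r where "r = norm z / \<delta>"
  have r: "0 \<le> r" using \<delta>(1) by (simp add: r_def)
  obtain F where F: "linear F" "\<And>x. F x \<le> r * norm x" "\<And>v. v \<in> span (range \<nu>) \<Longrightarrow> F v = \<phi> v"
  proof (rule Hahn_Banach_sublinear[of "\<lambda>x. r * norm x" "span (range \<nu>)" \<phi>])
    show "sublinear (\<lambda>x. r * norm (x::'x))" using r
      by (auto simp: sublinear_def algebra_simps intro!: mult_left_mono[OF norm_triangle_ineq, of r, simplified distrib_left])
    fix v assume "v \<in> span (range \<nu>)"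
    then obtain w where w: "v = (\<Sum>b\<in>range \<nu>. w b *\<^sub>R b)" using span_finite[of "range \<nu>"] by auto
    define c :: "real ^ 'm" where "c = (\<chi> i. w (\<nu> i))"
    have v: "v = (\<Sum>i\<in>UNIV. c $ i *\<^sub>R \<nu> i)"
      using ind(2) by (simp add: w sum.reindex c_def)
    have "\<phi> v = c \<bullet> z" unfolding v
      by (simp add: linear_sum[OF \<phi>(1)] linear_scale[OF \<phi>(1)] \<phi>\<nu> inner_vec_def)
    also have "\<dots> \<le> norm c * norm z" by (rule norm_cauchy_schwarz)
    also have "\<dots> \<le> (norm v / \<delta>) * norm z"
      using \<delta>(2)[of c] \<delta>(1) unfolding v[symmetric] by (intro mult_right_mono) (auto simp: field_simps)
    finally show "\<phi> v \<le> r * norm v" by (simp add: r_def mult.commute)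
  qed (use \<phi>(1) in \<open>auto simp: subspace_span\<close>)
  have "bounded_linear F"
  proof (rule bounded_linear_intro[of _ r])
    fix x
    show "norm (F x) \<le> norm x * r" using F(2)[of x] F(2)[of "- x"] linear_neg[OF F(1), of x]
      by (simp add: abs_le_iff mult.commute)
  qed (use F(1) in \<open>auto simp: linear_add linear_scale\<close>)
  then have "blinfun_apply (Blinfun F) = F" by (rule bounded_linear_Blinfun_apply)
  then have "measure_op \<nu> (Blinfun F) = z"
    using F(3) \<phi>\<nu> by (simp add: measure_op_def vec_eq_iff span_base)
  then show ?thesis by (rule that)
qed

text \<open>
  A nonnegative quadratic polynomial without constant term has its minimum at \<open>0\<close>, so its
  derivative vanishes there.
\<close>

lemma linear_term_zero:
  fixes b c :: real
  assumes "\<And>t. 0 \<le> t * b + t\<^sup>2 * c"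
  shows "b = 0"
proof (rule ccontr)
  assume "b \<noteq> 0"
  define d where "d = \<bar>c\<bar> + 1"
  have d: "0 < d" "c < d" by (auto simp: d_def)
  have "(- b / d) * b + (- b / d)\<^sup>2 * c = (b / d)\<^sup>2 * (c - d)"
    using d(1) by (simp add: power2_eq_square field_simps)
  moreover have "(b / d)\<^sup>2 * (c - d) < 0"
    using d \<open>b \<noteq> 0\<close> by (intro mult_pos_neg) auto
  ultimately show False using assms[of "- b / d"] by linarith
qed

section \<open>The semi-norm and conjugates in a direct-sum dual pair\<close>

context direct_sum_dual_pair
begin

text \<open>
  The supremum that defines the dual norm runs over \<open>\<U>\<close> only, where \<open>f\<close> and its projection
  onto \<open>\<U>'\<close> agree.  So the same expression, applied to any \<open>f\<close>, is the semi-norm of \<open>f\<close>.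
\<close>

abbreviation seminorm :: "('x \<Rightarrow>\<^sub>L real) \<Rightarrow> real"
  where "seminorm \<equiv> Udual_norm N p nU"

lemma nU_0 [simp]: "nU 0 = 0"
  and nU_nonneg: "u \<in> Uspace N p \<Longrightarrow> 0 \<le> nU u"
  and nU_eq_0: "u \<in> Uspace N p \<Longrightarrow> nU u = 0 \<longleftrightarrow> u = 0"
  and nU_scaleR: "u \<in> Uspace N p \<Longrightarrow> nU (c *\<^sub>R u) = \<bar>c\<bar> * nU u"
  and nU_triangle: "u \<in> Uspace N p \<Longrightarrow> w \<in> Uspace N p \<Longrightarrow> nU (u + w) \<le> nU u + nU w"
  using norm_U subspace_0[OF subspace_Uspace] unfolding norm_on_def by blast+

lemma seminorm_apply: "u \<in> Uspace N p \<Longrightarrow> \<bar>blinfun_apply f u\<bar> \<le> seminorm f * nU u"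
  unfolding Udual_norm_def by (rule dual_U(2))

lemma seminorm_nonneg: "0 \<le> seminorm f"
  unfolding Udual_norm_def by (rule dual_U(3))

lemma seminorm_le_iff:
  "seminorm f \<le> c \<longleftrightarrow> (\<forall>u\<in>Uspace N p. nU u \<le> 1 \<longrightarrow> \<bar>blinfun_apply f u\<bar> \<le> c)"
proof -
  have "0 \<in> {v \<in> Uspace N p. nU v \<le> 1}" using subspace_0[OF subspace_Uspace] by simp
  then have "{v \<in> Uspace N p. nU v \<le> 1} \<noteq> {}" by blast
  then show ?thesis unfolding Udual_norm_def dual_norm_def
    by (subst cSUP_le_iff[OF _ dual_U(1)]) auto
qed

lemma seminorm_leI:
  assumes "0 \<le> c" "\<And>u. u \<in> Uspace N p \<Longrightarrow> \<bar>blinfun_apply f u\<bar> \<le> c * nU u"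
  shows "seminorm f \<le> c"
  unfolding seminorm_le_iff
proof (intro ballI impI)
  fix u assume "u \<in> Uspace N p" "nU u \<le> 1"
  then show "\<bar>blinfun_apply f u\<bar> \<le> c"
    using assms(2)[of u] mult_left_mono[of "nU u" 1 c] assms(1) by linarith
qed

lemma seminorm_triangle: "seminorm (f + g) \<le> seminorm f + seminorm g"
proof (rule seminorm_leI)
  show "\<bar>blinfun_apply (f + g) u\<bar> \<le> (seminorm f + seminorm g) * nU u" if "u \<in> Uspace N p" for u
    using seminorm_apply[OF that, of f] seminorm_apply[OF that, of g]
    by (simp add: blinfun.add_left distrib_right)
qed (simp add: seminorm_nonneg)

lemma seminorm_scaleR_le: "seminorm (c *\<^sub>R f) \<le> \<bar>c\<bar> * seminorm f"
proof (rule seminorm_leI)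
  show "\<bar>blinfun_apply (c *\<^sub>R f) u\<bar> \<le> (\<bar>c\<bar> * seminorm f) * nU u" if "u \<in> Uspace N p" for u
    using mult_left_mono[OF seminorm_apply[OF that, of f], of "\<bar>c\<bar>"]
    by (simp add: blinfun.scaleR_left abs_mult mult.assoc)
qed (simp add: seminorm_nonneg)

lemma seminorm_scaleR: "seminorm (c *\<^sub>R f) = \<bar>c\<bar> * seminorm f"
proof (cases "c = 0")
  case True
  then show ?thesis using seminorm_scaleR_le[of 0 f] seminorm_nonneg[of "0 *\<^sub>R f"] by simp
next
  case False
  then have "\<bar>c\<bar> * seminorm f \<le> seminorm (c *\<^sub>R f)"
    using mult_left_mono[OF seminorm_scaleR_le[of "1 / c" "c *\<^sub>R f"], of "\<bar>c\<bar>"]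
    by (simp add: field_simps)
  then show ?thesis using seminorm_scaleR_le[of c f] by simp
qed

lemma seminorm_cong:
  assumes "\<And>u. u \<in> Uspace N p \<Longrightarrow> blinfun_apply f u = blinfun_apply g u"
  shows "seminorm f = seminorm g"
  unfolding Udual_norm_def dual_norm_def using assms by (auto intro!: arg_cong[where f = Sup] image_cong)

lemma proj_Np_apply_U: "u \<in> Uspace N p \<Longrightarrow> blinfun_apply (proj_Np N p ps f) u = 0"
  by (simp add: proj_Np_def Uspace_def blinfun.sum_left blinfun.scaleR_left)

lemma proj_Udual_apply_U: "u \<in> Uspace N p \<Longrightarrow> blinfun_apply (proj_Udual N p ps f) u = blinfun_apply f u"
  by (simp add: proj_Udual_def blinfun.diff_left proj_Np_apply_U)

lemma seminorm_proj_Udual [simp]: "seminorm (proj_Udual N p ps f) = seminorm f"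
  by (rule seminorm_cong) (rule proj_Udual_apply_U)

lemma combination_p_apply_ps:
  assumes "m \<in> {1..N}"
  shows "blinfun_apply (\<Sum>n=1..N. b n *\<^sub>R p n) (ps m) = b m"
proof -
  have "blinfun_apply (\<Sum>n=1..N. b n *\<^sub>R p n) (ps m) = (\<Sum>n=1..N. if n = m then b n else 0)"
    unfolding blinfun.sum_left using assms
    by (intro sum.cong refl) (auto simp: blinfun.scaleR_left biorthonormal)
  then show ?thesis using assms by simp
qed

lemma proj_Udual_in: "proj_Udual N p ps f \<in> Udual N ps"
  unfolding Udual_def proj_Udual_def proj_Np_def
  using combination_p_apply_ps by (intro CollectI ballI) (simp only: blinfun.diff_left diff_self)

lemma proj_Np_in: "proj_Np N p ps f \<in> span (p ` {1..N})"
  unfolding proj_Np_def by (intro span_sum span_scale span_base) auto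

lemma subspace_Udual: "subspace (Udual N ps)"
  by (auto simp: subspace_def Udual_def blinfun.bilinear_simps)

lemma proj_Np_Udual: "s \<in> Udual N ps \<Longrightarrow> proj_Np N p ps s = 0"
  by (simp add: proj_Np_def Udual_def)

lemma proj_Np_add: "proj_Np N p ps (f + g) = proj_Np N p ps f + proj_Np N p ps g"
  and proj_Np_scaleR: "proj_Np N p ps (c *\<^sub>R f) = c *\<^sub>R proj_Np N p ps f"
  by (simp_all add: proj_Np_def blinfun.bilinear_simps scaleR_sum_right sum.distrib algebra_simps)

lemma proj_Udual_add: "proj_Udual N p ps (f + g) = proj_Udual N p ps f + proj_Udual N p ps g"
  and proj_Udual_scaleR: "proj_Udual N p ps (c *\<^sub>R f) = c *\<^sub>R proj_Udual N p ps f"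
  by (simp_all add: proj_Udual_def proj_Np_add proj_Np_scaleR algebra_simps)

lemma proj_Np_span:
  assumes "q \<in> span (p ` {1..N})"
  shows "proj_Np N p ps q = q"
  using assms
proof (induction rule: span_induct_alt)
  case base
  show ?case by (simp add: proj_Np_def)
next
  case (step c x y)
  then obtain k where k: "k \<in> {1..N}" "x = p k" by auto
  have "proj_Np N p ps x = (\<Sum>n=1..N. if k = n then p n else 0)"
    unfolding proj_Np_def k(2) using k(1) by (intro sum.cong refl) (auto simp: biorthonormal)
  also have "\<dots> = x" using k by simp
  finally show ?case using step by (simp add: proj_Np_add proj_Np_scaleR)
qed

lemma direct_sum_dual_unique:
  assumes "q \<in> span (p ` {1..N})" "s \<in> Udual N ps" "f = q + s"
  shows "q = proj_Np N p ps f" "s = proj_Udual N p ps f"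
  using assms by (simp_all add: proj_Udual_def proj_Np_add proj_Np_span proj_Np_Udual)

lemma Udual_apply: "s \<in> Udual N ps \<Longrightarrow> blinfun_apply s x = blinfun_apply s (proj_Uspace N p ps x)"
  by (simp add: Udual_def proj_Uspace_def proj_Nps_def blinfun.diff_right blinfun.sum_right blinfun.scaleR_right)

lemma Udual_eqI:
  assumes "s \<in> Udual N ps" "t \<in> Udual N ps" "\<And>u. u \<in> Uspace N p \<Longrightarrow> blinfun_apply s u = blinfun_apply t u"
  shows "s = t"
  by (rule blinfun_eqI) (metis assms Udual_apply proj_Uspace_in)

lemma nU_proj_le: "nU (proj_Uspace N p ps x) \<le> norm x / Z (1, 0)"
proof -
  have "\<bar>nU (proj_Uspace N p ps x)\<bar> * Z (1, 0) \<le> norm x"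
    unfolding norm_composite[of x] by (rule Z_fst)
  then show ?thesis using Z_pos(1) nU_nonneg[OF proj_Uspace_in, of x] by (simp add: field_simps)
qed

lemma norm_Udual_le:
  assumes "s \<in> Udual N ps"
  shows "norm s \<le> seminorm s / Z (1, 0)"
proof (rule norm_blinfun_bound)
  show "0 \<le> seminorm s / Z (1, 0)" using seminorm_nonneg[of s] Z_pos(1) by simp
  fix x
  have "\<bar>blinfun_apply s x\<bar> \<le> seminorm s * nU (proj_Uspace N p ps x)"
    unfolding Udual_apply[OF assms, of x] by (intro seminorm_apply proj_Uspace_in)
  also have "\<dots> \<le> seminorm s * (norm x / Z (1, 0))"
    by (intro mult_left_mono nU_proj_le seminorm_nonneg)
  finally show "norm (blinfun_apply s x) \<le> seminorm s / Z (1, 0) * norm x" by simp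
qed

lemma seminorm_eq_0: "s \<in> Udual N ps \<Longrightarrow> seminorm s = 0 \<Longrightarrow> s = 0"
  using norm_Udual_le[of s] by simp

text \<open>
  The semi-norm controls \<open>f\<close> up to the finitely many coordinates \<open>f (ps n)\<close> of its null-space
  component.
\<close>

lemma norm_le_seminorm:
  "norm f \<le> seminorm f / Z (1, 0) + (\<Sum>n=1..N. \<bar>blinfun_apply f (ps n)\<bar> * norm (p n))"
proof -
  have "norm f \<le> norm (proj_Udual N p ps f) + norm (proj_Np N p ps f)"
    using norm_triangle_ineq[of "proj_Udual N p ps f" "proj_Np N p ps f"] by (simp add: proj_Udual_def)
  moreover have "norm (proj_Udual N p ps f) \<le> seminorm f / Z (1, 0)"
    using norm_Udual_le[OF proj_Udual_in, of f] by simp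
  moreover have "norm (proj_Np N p ps f) \<le> (\<Sum>n=1..N. \<bar>blinfun_apply f (ps n)\<bar> * norm (p n))"
    unfolding proj_Np_def by (rule order_trans[OF norm_sum]) simp
  ultimately show ?thesis by linarith
qed

lemma nU_eq_norm: "x \<in> Uspace N p \<Longrightarrow> nU x = norm x / Z (1, 0)"
proof -
  assume x: "x \<in> Uspace N p"
  have "nN 0 = 0" using norm_N span_0 unfolding norm_on_def by blast
  then have "norm x = Z (nU x *\<^sub>R (1, 0))" using norm_add[OF x span_0] by simp
  then show ?thesis using nU_nonneg[OF x] Z_pos(1) by (simp only: Z_scale) simp
qed

lemma closedin_seminorm_le: "closedin weak_star {f. seminorm f \<le> c}"
proof -
  have "{f. seminorm f \<le> c} = (\<Inter>u\<in>{u \<in> Uspace N p. nU u \<le> 1}. {f. blinfun_apply f u \<in> {-c..c}})"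
    by (auto simp: seminorm_le_iff abs_le_iff minus_le_iff)
  moreover have "{u \<in> Uspace N p. nU u \<le> 1} \<noteq> {}"
    using subspace_0[OF subspace_Uspace] nU_0 by (metis (mono_tags, lifting) empty_iff mem_Collect_eq zero_le_one)
  ultimately show ?thesis
    by (auto intro!: closedin_Inter closedin_weak_star_vimage continuous_map_weak_star_apply
        simp del: atLeastAtMost_iff)
qed

text \<open>
  A line meets the unit ball of \<open>\<U>'\<close> in a segment, because the semi-norm is a norm on \<open>\<U>'\<close>;
  a line that leaves \<open>\<U>'\<close> meets it in the single point \<open>s\<close>.
\<close>

lemma unit_ball_line_compact:
  assumes s: "s \<in> Udual N ps" "seminorm s \<le> 1" and d: "d \<noteq> 0"
  shows "compact {t::real. s + t *\<^sub>R d \<in> {s \<in> Udual N ps. seminorm s \<le> 1}}"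
proof (cases "d \<in> Udual N ps")
  case True
  have "seminorm d \<noteq> 0" using seminorm_eq_0[OF True] d by blast
  then have pos: "0 < seminorm d" using seminorm_nonneg[of d] by simp
  let ?T = "{t::real. seminorm (s + t *\<^sub>R d) \<le> 1}"
  have "?T = (\<Inter>x\<in>{x \<in> Uspace N p. nU x \<le> 1}. {t. \<bar>blinfun_apply s x + t * blinfun_apply d x\<bar> \<le> 1})"
    by (auto simp: seminorm_le_iff blinfun.bilinear_simps)
  then have "closed ?T" by (auto intro!: closed_INT closed_Collect_le continuous_intros)
  moreover have "\<bar>t\<bar> \<le> 2 / seminorm d" if t: "t \<in> ?T" for t
  proof -
    have "seminorm (t *\<^sub>R d) \<le> seminorm (s + t *\<^sub>R d) + seminorm ((- 1) *\<^sub>R s)"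
      using seminorm_triangle[of "s + t *\<^sub>R d" "(- 1) *\<^sub>R s"] by simp
    then have "\<bar>t\<bar> * seminorm d \<le> 2" using t s(2) unfolding seminorm_scaleR by simp
    then show ?thesis using pos by (simp add: field_simps)
  qed
  then have "bounded ?T" by (auto simp: bounded_iff)
  ultimately have "compact ?T" by (simp add: compact_eq_bounded_closed)
  moreover have "s + t *\<^sub>R d \<in> Udual N ps" for t
    using s(1) True subspace_Udual by (auto intro: subspace_add subspace_scale)
  ultimately show ?thesis by simp
next
  case False
  have "t = 0" if "s + t *\<^sub>R d \<in> Udual N ps" for t
  proof (rule ccontr)
    assume "t \<noteq> 0"
    have "(1 / t) *\<^sub>R ((s + t *\<^sub>R d) - s) \<in> Udual N ps"
      using that s(1) subspace_Udual by (intro subspace_scale subspace_diff)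
    then show False using \<open>t \<noteq> 0\<close> False by simp
  qed
  then have "{t::real. s + t *\<^sub>R d \<in> {s \<in> Udual N ps. seminorm s \<le> 1}} = {0}" using s by auto
  then show ?thesis by simp
qed

text \<open>
  The sublinear majorant \<open>\<rho> * nU (proj_Uspace N p ps x)\<close> is defined on the whole space and
  vanishes on the span of the \<open>ps n\<close>.  Dominated by it, the extension vanishes there as well, so it
  lies in \<open>\<U>'\<close>, and it is continuous because the projection is.
\<close>

lemma Hahn_Banach_Udual:
  assumes V: "subspace V" "V \<subseteq> Uspace N p" and \<phi>: "linear \<phi>"
    and \<rho>: "0 \<le> \<rho>" "\<And>v. v \<in> V \<Longrightarrow> \<phi> v \<le> \<rho> * nU v"
  obtains s where "s \<in> Udual N ps" "seminorm s \<le> \<rho>" "\<And>v. v \<in> V \<Longrightarrow> blinfun_apply s v = \<phi> v"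
proof -
  define q where "q x = \<rho> * nU (proj_Uspace N p ps x)" for x
  have proj: "proj_Uspace N p ps (x + y) = proj_Uspace N p ps x + proj_Uspace N p ps y"
    "proj_Uspace N p ps (c *\<^sub>R x) = c *\<^sub>R proj_Uspace N p ps x" for x y c
    by (simp_all add: proj_Uspace_def proj_Nps_def blinfun.bilinear_simps scaleR_sum_right sum.distrib algebra_simps)
  have projU: "proj_Uspace N p ps u = u" if "u \<in> Uspace N p" for u
    using that by (simp add: proj_Uspace_def proj_Nps_def Uspace_def)
  have proj_ps: "proj_Uspace N p ps (ps n) = 0" if "n \<in> {1..N}" for n
    using proj_Nps_span[OF span_base, of "ps n"] that by (simp add: proj_Uspace_def)
  obtain F where F: "linear F" "\<And>x. F x \<le> q x" "\<And>v. v \<in> V \<Longrightarrow> F v = \<phi> v"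
  proof (rule Hahn_Banach_sublinear[OF _ V(1) \<phi>, of q])
    show "sublinear q"
      unfolding sublinear_def q_def proj
    proof (intro conjI allI impI)
      fix x y
      show "\<rho> * nU (proj_Uspace N p ps x + proj_Uspace N p ps y)
          \<le> \<rho> * nU (proj_Uspace N p ps x) + \<rho> * nU (proj_Uspace N p ps y)"
        using mult_left_mono[OF nU_triangle[OF proj_Uspace_in proj_Uspace_in, of x y] \<rho>(1)]
        by (simp add: distrib_left)
    qed (simp add: nU_scaleR[OF proj_Uspace_in])
    show "\<phi> v \<le> q v" if "v \<in> V" for v
      using \<rho>(2)[OF that] projU[of v] V(2) that by (auto simp: q_def)
  qed blast
  have abs: "\<bar>F x\<bar> \<le> \<rho> * nU (proj_Uspace N p ps x)" for x
    using F(2)[of x] F(2)[of "- x"] linear_neg[OF F(1), of x] proj(2)[of "- 1" x]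
      nU_scaleR[OF proj_Uspace_in, of "- 1" x] by (simp add: q_def abs_le_iff)
  have "bounded_linear F"
  proof (rule bounded_linear_intro[of _ "\<rho> / Z (1, 0)"])
    fix x
    show "norm (F x) \<le> norm x * (\<rho> / Z (1, 0))"
      using order_trans[OF abs[of x] mult_left_mono[OF nU_proj_le[of x] \<rho>(1)]] by (simp add: mult.commute)
  qed (use F(1) in \<open>auto simp: linear_add linear_scale\<close>)
  then have ap: "blinfun_apply (Blinfun F) = F" by (rule bounded_linear_Blinfun_apply)
  show ?thesis
  proof (rule that)
    show "Blinfun F \<in> Udual N ps"
      unfolding Udual_def
    proof (intro CollectI ballI)
      fix n assume "n \<in> {1..N}"
      then show "blinfun_apply (Blinfun F) (ps n) = 0" unfolding ap using abs[of "ps n"] proj_ps[of n] by simp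
    qed
    show "seminorm (Blinfun F) \<le> \<rho>"
    proof (rule seminorm_leI[OF \<rho>(1)])
      fix u assume "u \<in> Uspace N p"
      then show "\<bar>blinfun_apply (Blinfun F) u\<bar> \<le> \<rho> * nU u" using abs[of u] by (simp add: ap projU)
    qed
    show "blinfun_apply (Blinfun F) v = \<phi> v" if "v \<in> V" for v using F(3)[OF that] ap by simp
  qed
qed

lemma conjugates_iff:
  assumes "s \<in> Udual N ps" "x \<in> Uspace N p"
  shows "conjugates N p ps nU s x \<longleftrightarrow> seminorm s \<le> nU x \<and> blinfun_apply s x = nU x * nU x"
proof
  assume "seminorm s \<le> nU x \<and> blinfun_apply s x = nU x * nU x"
  moreover from this have "nU x * nU x \<le> seminorm s * nU x"
    using seminorm_apply[OF assms(2), of s] by simp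
  then have "nU x \<le> seminorm s" using nU_nonneg[OF assms(2)] seminorm_nonneg[of s]
    by (cases "nU x = 0") auto
  ultimately show "conjugates N p ps nU s x" using assms by (simp add: conjugates_def)
qed (auto simp: conjugates_def)

lemma exists_conjugate:
  assumes x: "x \<in> Uspace N p"
  obtains s where "conjugates N p ps nU s x"
proof (cases "x = 0")
  case True
  have "seminorm 0 = 0" using seminorm_scaleR[of 0 0] by simp
  then have "conjugates N p ps nU 0 x"
    using x True subspace_0[OF subspace_Udual] by (simp add: conjugates_def)
  then show ?thesis by (rule that)
next
  case False
  then obtain \<phi> :: "'x \<Rightarrow> real" where \<phi>: "linear \<phi>" "\<phi> x = nU x * nU x"
    using linear_independent_extend[of "{x}" "\<lambda>_. nU x * nU x"] by auto
  obtain s where s: "s \<in> Udual N ps" "seminorm s \<le> nU x" "\<And>v. v \<in> span {x} \<Longrightarrow> blinfun_apply s v = \<phi> v"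
  proof (rule Hahn_Banach_Udual[of "span {x}" \<phi> "nU x"])
    show "span {x} \<subseteq> Uspace N p" using x subspace_Uspace by (intro span_minimal) auto
    fix v assume "v \<in> span {x}"
    then obtain t where t: "v = t *\<^sub>R x" by (auto simp: span_singleton)
    have "t * (nU x * nU x) \<le> \<bar>t\<bar> * (nU x * nU x)" by (intro mult_right_mono) auto
    then show "\<phi> v \<le> nU x * nU v"
      using \<phi> by (simp add: t linear_scale[OF \<phi>(1)] nU_scaleR[OF x] mult.left_commute)
  qed (use \<phi> nU_nonneg[OF x] in \<open>auto simp: subspace_span\<close>)
  then have "conjugates N p ps nU s x" using conjugates_iff[OF s(1) x] \<phi> by (simp add: span_base)
  then show ?thesis by (rule that)
qed

text \<open>
  Midpoints of conjugates still norm \<open>x\<close>, which strict convexity forbids for two different ones.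
\<close>

lemma conjugate_unique:
  assumes sc: "strictly_convex_norm_on (Udual N ps) seminorm"
    and s: "conjugates N p ps nU s x" and t: "conjugates N p ps nU t x"
  shows "s = t"
proof (cases "nU x = 0")
  case True
  then show ?thesis using s t seminorm_eq_0 by (metis conjugates_def)
next
  case False
  have x: "x \<in> Uspace N p" and st: "s \<in> Udual N ps" "t \<in> Udual N ps"
    and n: "seminorm s = nU x" "seminorm t = nU x" "blinfun_apply s x = nU x * nU x" "blinfun_apply t x = nU x * nU x"
    using s t by (auto simp: conjugates_def)
  have r: "0 < nU x" using nU_nonneg[OF x] False by simp
  show ?thesis
  proof (rule ccontr)
    assume "s \<noteq> t"
    define c where "c = 1 / nU x"
    have c: "0 < c" "c * nU x = 1" using r by (auto simp: c_def)
    have "seminorm ((1/2) *\<^sub>R (c *\<^sub>R s) + (1 - 1/2) *\<^sub>R (c *\<^sub>R t)) < 1"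
    proof (rule sc[unfolded strictly_convex_norm_on_def, rule_format])
      show "c *\<^sub>R s \<in> Udual N ps" "c *\<^sub>R t \<in> Udual N ps" using st subspace_Udual by (auto intro: subspace_scale)
      show "seminorm (c *\<^sub>R s) = 1 \<and> seminorm (c *\<^sub>R t) = 1 \<and> c *\<^sub>R s \<noteq> c *\<^sub>R t"
        using n c \<open>s \<noteq> t\<close> by (simp add: seminorm_scaleR)
    qed simp
    then have "seminorm ((1/2) *\<^sub>R (c *\<^sub>R s) + (1 - 1/2) *\<^sub>R (c *\<^sub>R t)) * nU x < 1 * nU x"
      using r by (rule mult_strict_right_mono)
    moreover have "\<bar>blinfun_apply ((1/2) *\<^sub>R (c *\<^sub>R s) + (1 - 1/2) *\<^sub>R (c *\<^sub>R t)) x\<bar>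
        \<le> seminorm ((1/2) *\<^sub>R (c *\<^sub>R s) + (1 - 1/2) *\<^sub>R (c *\<^sub>R t)) * nU x"
      by (rule seminorm_apply[OF x])
    moreover have "blinfun_apply ((1/2) *\<^sub>R (c *\<^sub>R s) + (1 - 1/2) *\<^sub>R (c *\<^sub>R t)) x = (c * nU x) * nU x"
      by (simp add: blinfun.bilinear_simps n)
    ultimately show False using c r by simp
  qed
qed

lemma conjugates_duality_map:
  assumes sc: "strictly_convex_norm_on (Udual N ps) seminorm" and x: "x \<in> Uspace N p"
  shows "\<exists>!s. conjugates N p ps nU s x"
    and "conjugates N p ps nU (duality_map N p ps nU x) x"
    and "conjugates N p ps nU s x \<Longrightarrow> duality_map N p ps nU x = s"
proof -
  show *: "\<exists>!s. conjugates N p ps nU s x"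
    using exists_conjugate[OF x] conjugate_unique[OF sc] by blast
  show "conjugates N p ps nU (duality_map N p ps nU x) x"
    unfolding duality_map_def by (rule theI'[OF *])
  show "conjugates N p ps nU s x \<Longrightarrow> duality_map N p ps nU x = s"
    unfolding duality_map_def by (rule the1_equality[OF *])
qed

lemma hilbert_imp_strictly_convex:
  assumes "hilbert_norm_on (Udual N ps) seminorm"
  shows "strictly_convex_norm_on (Udual N ps) seminorm"
proof -
  obtain ip where ip: "inner_product_on (Udual N ps) seminorm ip"
    using assms by (auto simp: hilbert_norm_on_def)
  note ip' = ip[unfolded inner_product_on_def]
  show ?thesis
    unfolding strictly_convex_norm_on_def
  proof (intro ballI impI)
    fix t :: real and f g
    assume t: "t \<in> {0<..<1}" and fg: "f \<in> Udual N ps" "g \<in> Udual N ps"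
      and n: "seminorm f = 1 \<and> seminorm g = 1 \<and> f \<noteq> g"
    have expand: "(seminorm (a *\<^sub>R f + b *\<^sub>R g))\<^sup>2 = a\<^sup>2 + 2 * a * b * ip f g + b\<^sup>2" for a b
    proof -
      have mem: "a *\<^sub>R f \<in> Udual N ps" "b *\<^sub>R g \<in> Udual N ps" "a *\<^sub>R f + b *\<^sub>R g \<in> Udual N ps"
        using fg subspace_Udual by (auto intro: subspace_scale subspace_add)
      have lin: "ip (a *\<^sub>R f + b *\<^sub>R g) h = a * ip f h + b * ip g h" if "h \<in> Udual N ps" for h
        using ip' mem fg that by metis
      have "(seminorm (a *\<^sub>R f + b *\<^sub>R g))\<^sup>2 = ip (a *\<^sub>R f + b *\<^sub>R g) (a *\<^sub>R f + b *\<^sub>R g)"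
        using ip' mem by metis
      also have "\<dots> = a * ip (a *\<^sub>R f + b *\<^sub>R g) f + b * ip (a *\<^sub>R f + b *\<^sub>R g) g"
        using lin[OF mem(3)] ip' mem fg by metis
      also have "\<dots> = a * (a * ip f f + b * ip g f) + b * (a * ip f g + b * ip g g)"
        using lin fg by simp
      also have "\<dots> = a * (a * 1 + b * ip f g) + b * (a * ip f g + b * 1)"
        using ip' fg n by (metis power_one)
      finally show ?thesis by (simp add: power2_eq_square algebra_simps)
    qed
    have "seminorm (f - g) \<noteq> 0"
      using seminorm_eq_0[of "f - g"] fg n subspace_diff[OF subspace_Udual] by auto
    then have "0 < (seminorm (1 *\<^sub>R f + (- 1) *\<^sub>R g))\<^sup>2" by simp
    then have "ip f g < 1" unfolding expand by simp
    then have "2 * t * (1 - t) * ip f g < 2 * t * (1 - t) * 1"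
      using t by (intro mult_strict_left_mono) auto
    then have "(seminorm (t *\<^sub>R f + (1 - t) *\<^sub>R g))\<^sup>2 < 1\<^sup>2"
      unfolding expand by (simp add: power2_eq_square algebra_simps)
    then show "seminorm (t *\<^sub>R f + (1 - t) *\<^sub>R g) < 1"
      by (rule power_less_imp_less_base) simp
  qed
qed

text \<open>
  On the inner product space \<open>\<U>'\<close>, evaluation at \<open>x\<close> is a functional of norm at most \<open>nU x\<close>, and it
  attains this norm at the conjugate \<open>j\<close>.  So the nonnegative quadratic function
  \<open>(nU x * seminorm (j + t *\<^sub>R s))\<^sup>2 - ((j + t *\<^sub>R s) x)\<^sup>2\<close> of \<open>t\<close> vanishes at \<open>t = 0\<close>; the vanishing of its
  derivative is the claim.
\<close>

lemma hilbert_Riesz: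
  assumes ip: "inner_product_on (Udual N ps) seminorm ip"
    and j: "conjugates N p ps nU j x" and s: "s \<in> Udual N ps"
  shows "blinfun_apply s x = ip s j"
proof -
  note ip' = ip[unfolded inner_product_on_def]
  have x: "x \<in> Uspace N p" and jm: "j \<in> Udual N ps" and n: "seminorm j = nU x" "blinfun_apply j x = nU x * nU x"
    using j by (auto simp: conjugates_def)
  have quad: "0 \<le> 2 * t * (nU x)\<^sup>2 * (ip s j - blinfun_apply s x) + t\<^sup>2 * ((nU x)\<^sup>2 * (seminorm s)\<^sup>2 - (blinfun_apply s x)\<^sup>2)"
    for t
  proof -
    have mem: "t *\<^sub>R s \<in> Udual N ps" "j + t *\<^sub>R s \<in> Udual N ps"
      using jm s subspace_Udual by (auto intro: subspace_scale subspace_add)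
    have lin: "ip (j + t *\<^sub>R s) h = ip j h + t * ip s h" if "h \<in> Udual N ps" for h
      using ip' mem jm s that by metis
    have "(seminorm (j + t *\<^sub>R s))\<^sup>2 = ip (j + t *\<^sub>R s) (j + t *\<^sub>R s)" using ip' mem by metis
    also have "\<dots> = ip (j + t *\<^sub>R s) j + t * ip (j + t *\<^sub>R s) s"
      using lin[OF mem(2)] ip' mem jm s by metis
    also have "\<dots> = (ip j j + t * ip s j) + t * (ip j s + t * ip s s)" using lin jm s by simp
    also have "\<dots> = ((nU x)\<^sup>2 + t * ip s j) + t * (ip s j + t * (seminorm s)\<^sup>2)"
      using ip' jm s n(1) by metis
    finally have sq: "(seminorm (j + t *\<^sub>R s))\<^sup>2 = (nU x)\<^sup>2 + 2 * t * ip s j + t\<^sup>2 * (seminorm s)\<^sup>2"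
      by (simp add: power2_eq_square algebra_simps)
    have "(blinfun_apply (j + t *\<^sub>R s) x)\<^sup>2 \<le> (seminorm (j + t *\<^sub>R s) * nU x)\<^sup>2"
      using seminorm_apply[OF x, of "j + t *\<^sub>R s"] by (rule power2_le_iff_abs_le[THEN iffD2, rotated])
        (simp add: seminorm_nonneg nU_nonneg[OF x])
    then have "(nU x * nU x + t * blinfun_apply s x)\<^sup>2
        \<le> ((nU x)\<^sup>2 + 2 * t * ip s j + t\<^sup>2 * (seminorm s)\<^sup>2) * (nU x)\<^sup>2"
      unfolding power_mult_distrib sq by (simp add: blinfun.bilinear_simps n(2))
    then show ?thesis by (simp add: power2_eq_square algebra_simps)
  qed
  have "(nU x)\<^sup>2 * (ip s j - blinfun_apply s x) = 0"
  proof -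
    have "2 * (nU x)\<^sup>2 * (ip s j - blinfun_apply s x) = 0"
    proof (rule linear_term_zero)
      show "0 \<le> t * (2 * (nU x)\<^sup>2 * (ip s j - blinfun_apply s x))
          + t\<^sup>2 * ((nU x)\<^sup>2 * (seminorm s)\<^sup>2 - (blinfun_apply s x)\<^sup>2)" for t
        using quad[of t] by (simp add: mult.assoc mult.left_commute)
    qed
    then show ?thesis by simp
  qed
  show ?thesis
  proof (cases "nU x = 0")
    case True
    then have "j = 0" using seminorm_eq_0[OF jm] n by simp
    moreover have "x = 0" using True nU_eq_0[OF x] by simp
    moreover have "ip (0 *\<^sub>R j) s = 0 * ip j s" using ip' jm s by metis
    ultimately show ?thesis using ip' jm s by simp
  qed (use \<open>(nU x)\<^sup>2 * (ip s j - blinfun_apply s x) = 0\<close> in simp)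
qed

text \<open>
  By \<open>hilbert_Riesz\<close> the value \<open>J x w\<close> is the inner product of \<open>J x\<close> and \<open>J w\<close>, so it is symmetric in
  \<open>x\<close> and \<open>w\<close>.  As it is linear in \<open>w\<close>, it is then linear in \<open>x\<close>.
\<close>

lemma hilbert_duality_map:
  assumes h: "hilbert_norm_on (Udual N ps) seminorm"
  obtains ip where "inner_product_on (Uspace N p) nU ip"
    "\<And>x w. x \<in> Uspace N p \<Longrightarrow> w \<in> Uspace N p \<Longrightarrow> blinfun_apply (duality_map N p ps nU x) w = ip x w"
proof -
  obtain ip' where ip': "inner_product_on (Udual N ps) seminorm ip'"
    using h by (auto simp: hilbert_norm_on_def)
  note sc = hilbert_imp_strictly_convex[OF h]
  let ?J = "duality_map N p ps nU"
  have J: "?J x \<in> Udual N ps" "blinfun_apply (?J x) x = (nU x)\<^sup>2" if "x \<in> Uspace N p" for x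
    using conjugates_duality_map(2)[OF sc that] by (auto simp: conjugates_def power2_eq_square)
  have ev: "blinfun_apply (?J x) w = ip' (?J x) (?J w)" if "x \<in> Uspace N p" "w \<in> Uspace N p" for x w
    using hilbert_Riesz[OF ip' conjugates_duality_map(2)[OF sc that(2)] J(1)[OF that(1)]] .
  have sym: "blinfun_apply (?J x) w = blinfun_apply (?J w) x" if "x \<in> Uspace N p" "w \<in> Uspace N p" for x w
    using ev[OF that] ev[OF that(2,1)] ip' J(1) that unfolding inner_product_on_def by metis
  show ?thesis
  proof (rule that)
    show "inner_product_on (Uspace N p) nU (\<lambda>x w. blinfun_apply (?J x) w)"
      unfolding inner_product_on_def
    proof (intro conjI ballI allI)
      fix x y z assume xyz: "x \<in> Uspace N p" "y \<in> Uspace N p" "z \<in> Uspace N p"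
      show "blinfun_apply (?J (x + y)) z = blinfun_apply (?J x) z + blinfun_apply (?J y) z"
        using xyz subspace_add[OF subspace_Uspace xyz(1,2)]
        by (simp add: sym[of _ z] blinfun.add_right)
    next
      fix x y c assume xy: "x \<in> Uspace N p" "y \<in> Uspace N p"
      show "blinfun_apply (?J (c *\<^sub>R x)) y = c * blinfun_apply (?J x) y"
        using xy subspace_scale[OF subspace_Uspace xy(1)]
        by (simp add: sym[of _ y] blinfun.scaleR_right)
    qed (use sym J(2) in auto)
  qed simp
qed

lemma hilbert_duality_map_sum:
  assumes h: "hilbert_norm_on (Udual N ps) seminorm"
    and A: "finite A" "\<And>m. m \<in> A \<Longrightarrow> g m \<in> Uspace N p"
  shows "duality_map N p ps nU (\<Sum>m\<in>A. a m *\<^sub>R g m) = (\<Sum>m\<in>A. a m *\<^sub>R duality_map N p ps nU (g m))"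
proof (rule Udual_eqI)
  note sc = hilbert_imp_strictly_convex[OF h]
  let ?J = "duality_map N p ps nU"
  have J: "?J x \<in> Udual N ps" if "x \<in> Uspace N p" for x
    using conjugates_duality_map(2)[OF sc that] by (auto simp: conjugates_def)
  obtain ip where ip: "inner_product_on (Uspace N p) nU ip"
    "\<And>x w. x \<in> Uspace N p \<Longrightarrow> w \<in> Uspace N p \<Longrightarrow> blinfun_apply (?J x) w = ip x w"
    using hilbert_duality_map[OF h] by blast
  have sym: "blinfun_apply (?J x) w = blinfun_apply (?J w) x" if "x \<in> Uspace N p" "w \<in> Uspace N p" for x w
    using ip that unfolding inner_product_on_def by metis
  have sumU: "(\<Sum>m\<in>A. a m *\<^sub>R g m) \<in> Uspace N p"
    using A by (intro subspace_sum subspace_scale subspace_Uspace) auto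
  show "?J (\<Sum>m\<in>A. a m *\<^sub>R g m) \<in> Udual N ps" using J sumU .
  show "(\<Sum>m\<in>A. a m *\<^sub>R ?J (g m)) \<in> Udual N ps"
    using A J by (intro subspace_sum subspace_scale subspace_Udual) auto
  fix w assume w: "w \<in> Uspace N p"
  show "blinfun_apply (?J (\<Sum>m\<in>A. a m *\<^sub>R g m)) w = blinfun_apply (\<Sum>m\<in>A. a m *\<^sub>R ?J (g m)) w"
    unfolding sym[OF sumU w] blinfun.sum_right blinfun.sum_left
    using A(2) by (intro sum.cong refl) (simp add: blinfun.scaleR_right blinfun.scaleR_left sym[OF w])
qed

end

section \<open>The penalty, the loss and the biorthogonal vectors\<close>

text \<open>
  The sublevel sets of \<open>\<psi>\<close> are compact intervals: convexity makes \<open>\<psi>\<close> grow at least linearly, so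
  they are bounded, and continuous at every positive point, so they contain their right end point.
  A negative \<open>\<rho>\<close> stands for an empty one.
\<close>

lemma strict_mono_convex_sublevel:
  fixes \<psi> :: "real \<Rightarrow> real"
  assumes mono: "strict_mono_on {0..} \<psi>" and conv: "convex_on {0..} \<psi>"
  obtains \<rho> where "\<And>r. 0 \<le> r \<Longrightarrow> \<psi> r \<le> \<beta> \<longleftrightarrow> r \<le> \<rho>"
proof (cases "\<psi> 0 \<le> \<beta>")
  case False
  have "\<psi> r \<le> \<beta> \<longleftrightarrow> r \<le> - 1" if "0 \<le> r" for r
    using that False strict_mono_on_leD[OF mono, of 0 r] by auto
  then show ?thesis by (rule that)
next
  case True
  define R where "R = {r. 0 \<le> r \<and> \<psi> r \<le> \<beta>}"
  have "0 \<in> R" using True by (simp add: R_def)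
  have \<psi>01: "\<psi> 0 < \<psi> 1" using strict_mono_onD[OF mono, of 0 1] by simp
  have "r \<le> max 1 ((\<beta> - \<psi> 0) / (\<psi> 1 - \<psi> 0))" if "r \<in> R" for r
  proof (cases "r \<le> 1")
    case False
    \<comment> \<open>Here \<open>1\<close> is the convex combination of \<open>0\<close> and \<open>r\<close> with weight \<open>1 / r\<close> at \<open>r\<close>.\<close>
    then have "\<psi> ((1 - 1 / r) *\<^sub>R 0 + (1 / r) *\<^sub>R r) \<le> (1 - 1 / r) * \<psi> 0 + (1 / r) * \<psi> r"
      by (intro convex_onD[OF conv]) auto
    then have "\<psi> 1 \<le> \<psi> 0 + (\<psi> r - \<psi> 0) / r" using False by (simp add: field_simps)
    then have "r * (\<psi> 1 - \<psi> 0) \<le> \<psi> r - \<psi> 0" using False by (simp add: field_simps)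
    also have "\<dots> \<le> \<beta> - \<psi> 0" using that by (simp add: R_def)
    finally have "r \<le> (\<beta> - \<psi> 0) / (\<psi> 1 - \<psi> 0)" using \<psi>01 by (simp add: pos_le_divide_eq)
    then show ?thesis by simp
  qed simp
  then have bdd: "bdd_above R" by (auto simp: bdd_above_def)
  define \<rho> where "\<rho> = Sup R"
  have up: "r \<le> \<rho>" if "r \<in> R" for r unfolding \<rho>_def using cSup_upper[OF that bdd] .
  have approx: "\<exists>s\<in>R. r < s" if "r < \<rho>" for r
    using that less_cSup_iff[of R r] bdd \<open>0 \<in> R\<close> unfolding \<rho>_def by blast
  have down: "\<psi> r \<le> \<beta>" if r: "0 \<le> r" "r < \<rho>" for r
  proof -
    obtain s where "s \<in> R" "r < s" using approx[OF r(2)] by blast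
    then show ?thesis using strict_mono_onD[OF mono, of r s] r(1) by (auto simp: R_def)
  qed
  have "\<psi> \<rho> \<le> \<beta>"
  proof (cases "\<rho> = 0")
    case False
    then have "0 < \<rho>" using up[OF \<open>0 \<in> R\<close>] by simp
    have "continuous_on {0<..} \<psi>"
      by (rule convex_on_continuous) (auto intro: convex_on_subset[OF conv])
    then have cont: "(\<psi> \<longlongrightarrow> \<psi> \<rho>) (at \<rho>)"
      using \<open>0 < \<rho>\<close> by (simp add: continuous_on_eq_continuous_at isCont_def)
    show ?thesis
    proof (rule ccontr)
      assume "\<not> \<psi> \<rho> \<le> \<beta>"
      then have "\<forall>\<^sub>F r in at \<rho>. \<beta> < \<psi> r" using order_tendstoD(1)[OF cont, of \<beta>] by simp
      then obtain d where d: "0 < d" "\<And>r. r \<noteq> \<rho> \<Longrightarrow> dist r \<rho> < d \<Longrightarrow> \<beta> < \<psi> r"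
        by (auto simp: eventually_at)
      define r where "r = max (\<rho> / 2) (\<rho> - d / 2)"
      have "0 \<le> r" "r < \<rho>" "dist r \<rho> < d" using \<open>0 < \<rho>\<close> d(1) by (auto simp: r_def dist_real_def)
      then show False using d(2)[of r] down[of r] by simp
    qed
  qed (use True in simp)
  then have "\<psi> r \<le> \<beta> \<longleftrightarrow> r \<le> \<rho>" if "0 \<le> r" for r
    using that up[of r] down[of r] by (cases "r = \<rho>") (auto simp: R_def)
  then show ?thesis by (rule that)
qed

lemma closed_lsc_sublevel:
  assumes "lsc_loss E"
  shows "closed {z. E y z \<le> c}"
proof -
  have "open {z. c < E y z}"
    unfolding open_subopen[of "{z. c < E y z}"]
  proof (intro ballI)
    fix z assume "z \<in> {z. c < E y z}"
    then have z: "c < E y z" by simp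
    have "E y z \<le> Liminf (at z) (E y)" using assms by (simp add: lsc_loss_def)
    then have "\<forall>\<^sub>F w in at z. c < E y w" using z le_Liminf_iff by blast
    then obtain T where "open T" "z \<in> T" "\<And>w. w \<in> T \<Longrightarrow> w \<noteq> z \<Longrightarrow> c < E y w"
      by (auto simp: eventually_at_topological)
    then show "\<exists>T. open T \<and> z \<in> T \<and> T \<subseteq> {z. c < E y z}" using z by blast
  qed
  then show ?thesis by (simp add: closed_def Compl_eq not_le)
qed

lemma bounded_coercive_sublevel:
  assumes "coercive_loss E"
  obtains B where "\<And>z. E y z \<le> ereal c \<Longrightarrow> norm z \<le> B"
proof -
  have "(E y \<longlongrightarrow> \<infinity>) at_infinity" using assms by (simp add: coercive_loss_def)
  then have "\<forall>\<^sub>F z in at_infinity. ereal c < E y z" by (rule order_tendstoD) simp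
  then obtain b where b: "\<And>z. b \<le> norm z \<Longrightarrow> ereal c < E y z" by (auto simp: eventually_at_infinity)
  have "norm z \<le> b" if "E y z \<le> ereal c" for z
    using b[of z] that by (meson linear not_le)
  then show ?thesis by (rule that)
qed

text \<open>
  Each coefficient is a linear functional of the combination, and linear functionals on a Euclidean
  space are bounded.
\<close>

lemma coefficient_bound:
  fixes v :: "nat \<Rightarrow> 'a::euclidean_space"
  assumes v: "lin_indep_family v {1..N}"
  obtains C where "0 \<le> C" "\<And>b n. n \<in> {1..N} \<Longrightarrow> \<bar>b n\<bar> \<le> C * norm (\<Sum>k=1..N. b k *\<^sub>R v k)"
proof -
  have "\<exists>D. \<forall>b. \<bar>b n\<bar> \<le> D * norm (\<Sum>k=1..N. b k *\<^sub>R v k)" if n: "n \<in> {1..N}" for n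
  proof -
    obtain \<phi> :: "'a \<Rightarrow> real" where \<phi>: "linear \<phi>" "\<And>x. x \<in> v ` {1..N} \<Longrightarrow> \<phi> x = (if x = v n then 1 else 0)"
      using linear_independent_extend[of "v ` {1..N}" "\<lambda>x. if x = v n then 1 else 0"] v
      by (auto simp: lin_indep_family_def)
    have ev: "\<phi> (v k) = (if k = n then 1 else 0)" if "k \<in> {1..N}" for k
      using \<phi>(2)[of "v k"] that n v inj_onD[of v "{1..N}" k n] by (auto simp: lin_indep_family_def)
    obtain D where D: "\<And>x. norm (\<phi> x) \<le> D * norm x" using linear_bounded[OF \<phi>(1)] by blast
    have "\<phi> (\<Sum>k=1..N. b k *\<^sub>R v k) = b n" for b
    proof -
      have "\<phi> (\<Sum>k=1..N. b k *\<^sub>R v k) = (\<Sum>k=1..N. if k = n then b k else 0)"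
        unfolding linear_sum[OF \<phi>(1)] by (intro sum.cong refl) (simp add: linear_scale[OF \<phi>(1)] ev)
      then show ?thesis using n by simp
    qed
    then show ?thesis using D by (metis real_norm_def)
  qed
  then obtain D where D: "\<And>n b. n \<in> {1..N} \<Longrightarrow> \<bar>b n\<bar> \<le> D n * norm (\<Sum>k=1..N. b k *\<^sub>R v k)" by metis
  show ?thesis
  proof (rule that)
    show "0 \<le> (\<Sum>n=1..N. \<bar>D n\<bar>)" by (simp add: sum_nonneg)
    fix b :: "nat \<Rightarrow> real" and n assume n: "n \<in> {1..N}"
    have "D n \<le> \<bar>D n\<bar>" by simp
    also have "\<dots> \<le> (\<Sum>n=1..N. \<bar>D n\<bar>)" using n by (intro member_le_sum) auto
    finally show "\<bar>b n\<bar> \<le> (\<Sum>n=1..N. \<bar>D n\<bar>) * norm (\<Sum>k=1..N. b k *\<^sub>R v k)"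
      using D[OF n, of b] mult_right_mono[of "D n" "\<Sum>n=1..N. \<bar>D n\<bar>" "norm (\<Sum>k=1..N. b k *\<^sub>R v k)"]
      by simp
  qed
qed

lemma measure_op_add: "measure_op \<nu> (f + g) = measure_op \<nu> f + measure_op \<nu> g"
  and measure_op_diff: "measure_op \<nu> (f - g) = measure_op \<nu> f - measure_op \<nu> g"
  and measure_op_scaleR: "measure_op \<nu> (c *\<^sub>R f) = c *\<^sub>R measure_op \<nu> f"
  by (simp_all add: measure_op_def vec_eq_iff blinfun.bilinear_simps)

lemma linear_measure_op: "linear (measure_op \<nu>)"
  by (rule linearI) (simp_all add: measure_op_add measure_op_scaleR)

lemma continuous_map_measure_op:
  fixes \<nu> :: "'m::finite \<Rightarrow> 'x::real_normed_vector"
  shows "continuous_map weak_star euclidean (measure_op \<nu>)"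
proof -
  have "continuous_map weak_star (product_topology (\<lambda>i. euclidean) UNIV) (\<lambda>f i. blinfun_apply f (\<nu> i))"
    by (simp add: continuous_map_componentwise_UNIV continuous_map_weak_star_apply)
  then have 1: "continuous_map weak_star euclidean (\<lambda>f i. blinfun_apply f (\<nu> i))"
    by (simp add: euclidean_product_topology)
  have "continuous_on UNIV (\<lambda>g :: 'm \<Rightarrow> real. (\<chi> i. g i) :: real ^ 'm)"
    by (intro continuous_on_vec_lambda continuous_on_product_coordinates)
  then have "continuous_map euclidean euclidean (\<lambda>g :: 'm \<Rightarrow> real. (\<chi> i. g i) :: real ^ 'm)" by simp
  from continuous_map_compose[OF 1 this] show ?thesis by (simp add: o_def measure_op_def[abs_def])
qed

text \<open>
  The adjoint of \<open>measure_op \<nu>\<close>, see \<open>apply_analysis\<close>.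
\<close>

definition analysis :: "('m::finite \<Rightarrow> 'x::real_normed_vector) \<Rightarrow> real ^ 'm \<Rightarrow> 'x"
  where "analysis \<nu> c = (\<Sum>i\<in>UNIV. c $ i *\<^sub>R \<nu> i)"

lemma apply_analysis: "blinfun_apply f (analysis \<nu> c) = c \<bullet> measure_op \<nu> f"
  by (simp add: analysis_def measure_op_def inner_vec_def blinfun.sum_right blinfun.scaleR_right)

lemma linear_analysis: "linear (analysis \<nu>)"
  by (rule linearI) (simp_all add: analysis_def scaleR_left_distrib sum.distrib scaleR_sum_right)

lemma analysis_in_span: "analysis \<nu> c \<in> span (range \<nu>)"
  unfolding analysis_def by (intro span_sum span_scale span_base) auto

lemma span_range_eq_analysis: "span (range \<nu>) = range (analysis \<nu>)"
proof
  have "\<nu> i = analysis \<nu> (axis i 1)" for i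
    by (simp add: analysis_def axis_def if_distrib[where f = "\<lambda>a. a *\<^sub>R _"] cong: if_cong)
  then have "range \<nu> \<subseteq> range (analysis \<nu>)" by auto
  then show "span (range \<nu>) \<subseteq> range (analysis \<nu>)"
    by (intro span_minimal linear_subspace_image[OF linear_analysis]) (auto simp: subspace_UNIV)
qed (use analysis_in_span in auto)

text \<open>
  The \<open>N + K\<close> vectors \<open>v n\<close>, \<open>u m\<close> span a space of dimension \<open>N + K\<close>, so they are distinct and form a
  basis.  The biorthogonal vectors represent the coordinate functionals of this basis.
\<close>

lemma biorthogonal_facts:
  fixes v u :: "nat \<Rightarrow> real ^ 'm::finite"
  assumes K: "K = CARD('m) - N" "N < CARD('m)"
    and compl: "direct_sum_UNIV (span (v ` {1..N})) (span (u ` {1..K}))"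
  shows biorthogonal_ex1: "m \<in> {1..K} \<Longrightarrow> \<exists>!w. biorthogonal N K v u m w"
    and zero_if_orthogonal: "(\<And>n. n \<in> {1..N} \<Longrightarrow> c \<bullet> v n = 0) \<Longrightarrow> (\<And>m. m \<in> {1..K} \<Longrightarrow> c \<bullet> u m = 0) \<Longrightarrow> c = 0"
proof -
  define B where "B = v ` {1..N} \<union> u ` {1..K}"
  have "span B = UNIV"
    using compl unfolding B_def span_Un direct_sum_UNIV_def by auto
  have fin: "finite B" by (simp add: B_def)
  have "card B \<le> card (v ` {1..N}) + card (u ` {1..K})" unfolding B_def by (rule card_Un_le)
  moreover have "card (v ` {1..N}) \<le> N" "card (u ` {1..K}) \<le> K"
    using card_image_le[of "{1..N}" v] card_image_le[of "{1..K}" u] by auto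
  moreover have "dim (UNIV :: (real ^ 'm) set) = N + K" using K by (simp add: dim_UNIV)
  moreover have "dim (UNIV :: (real ^ 'm) set) \<le> card B"
    using span_card_ge_dim[of B UNIV] \<open>span B = UNIV\<close> fin by simp
  ultimately have c: "card B = N + K" "card (v ` {1..N}) = N" "card (u ` {1..K}) = K" "card B = dim (UNIV :: (real ^ 'm) set)"
    by auto
  have ind: "independent B"
    using card_le_dim_spanning[of B UNIV] \<open>span B = UNIV\<close> fin c(4) by simp
  have inj_u: "inj_on u {1..K}" using c(3) by (intro eq_card_imp_inj_on) auto
  have "card (v ` {1..N} \<inter> u ` {1..K}) = 0"
    using card_Un_Int[of "v ` {1..N}" "u ` {1..K}"] c unfolding B_def by simp
  then have disj: "v ` {1..N} \<inter> u ` {1..K} = {}" by simp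
  show zero: "c = 0" if "\<And>n. n \<in> {1..N} \<Longrightarrow> c \<bullet> v n = 0" "\<And>m. m \<in> {1..K} \<Longrightarrow> c \<bullet> u m = 0" for c
    by (rule vector_eq_dot_span[of _ B]) (use \<open>span B = UNIV\<close> that in \<open>auto simp: B_def inner_commute\<close>)
  show "\<exists>!w. biorthogonal N K v u m w" if m: "m \<in> {1..K}" for m
  proof (rule ex_ex1I)
    obtain \<phi> :: "real ^ 'm \<Rightarrow> real" where \<phi>: "linear \<phi>" "\<And>x. x \<in> B \<Longrightarrow> \<phi> x = (if x = u m then 1 else 0)"
      using linear_independent_extend[OF ind, of "\<lambda>x. if x = u m then 1 else 0"] by blast
    have w: "adjoint \<phi> 1 \<bullet> x = \<phi> x" for x using adjoint_works[OF \<phi>(1), of x 1] by (simp add: inner_commute)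
    have "biorthogonal N K v u m (adjoint \<phi> 1)"
      unfolding biorthogonal_def w
    proof (intro conjI ballI)
      fix n assume "n \<in> {1..N}"
      moreover from this have "v n \<noteq> u m" using disj m by blast
      ultimately show "\<phi> (v n) = 0" using \<phi>(2)[of "v n"] by (simp add: B_def)
    next
      fix m' assume "m' \<in> {1..K}"
      then show "\<phi> (u m') = (if m = m' then 1 else 0)"
        using \<phi>(2)[of "u m'"] inj_onD[OF inj_u, of m' m] m by (auto simp: B_def)
    qed
    then show "\<exists>w. biorthogonal N K v u m w" by blast
  next
    fix w w' assume "biorthogonal N K v u m w" "biorthogonal N K v u m w'"
    then have "w - w' = 0" by (intro zero) (auto simp: biorthogonal_def inner_diff_left)
    then show "w = w'" by simp
  qed
qed

section \<open>Existence of solutions\<close>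

locale representer_problem = direct_sum_dual_pair N p ps nU nN Z
  for N :: nat and p :: "nat \<Rightarrow> 'x::banach \<Rightarrow>\<^sub>L real" and ps :: "nat \<Rightarrow> 'x"
    and nU nN :: "'x \<Rightarrow> real" and Z :: "real \<times> real \<Rightarrow> real" +
  fixes K :: nat and \<nu> :: "'m::finite \<Rightarrow> 'x" and v u :: "nat \<Rightarrow> real ^ 'm"
    and E :: "real ^ 'm \<Rightarrow> real ^ 'm \<Rightarrow> ereal" and \<psi> :: "real \<Rightarrow> real" and y :: "real ^ 'm"
  assumes \<nu>_indep: "lin_indep_family \<nu> UNIV"
    and M_gt: "CARD('m) > N"
    and K_def: "K = CARD('m) - N"
    and v_def: "v = (\<lambda>n. measure_op \<nu> (p n))"
    and v_indep: "lin_indep_family v {1..N}"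
    and u_compl: "direct_sum_UNIV (span (v ` {1..N})) (span (u ` {1..K}))"
    and E_nonneg: "\<And>y z. 0 \<le> E y z"
    and E_proper: "proper_loss E" and E_lsc: "lsc_loss E"
    and E_coercive: "coercive_loss E" and E_convex: "convex_loss E"
    and \<psi>_nonneg: "\<And>r. 0 \<le> r \<Longrightarrow> 0 \<le> \<psi> r"
    and \<psi>_strict_mono: "strict_mono_on {0..} \<psi>"
    and \<psi>_convex: "convex_on {0..} \<psi>"
begin

definition objective :: "('x \<Rightarrow>\<^sub>L real) \<Rightarrow> ereal"
  where "objective f = E y (measure_op \<nu> f) + ereal (\<psi> (seminorm f))"

definition S :: "('x \<Rightarrow>\<^sub>L real) set"
  where "S = solution_set N p ps nU \<nu> E \<psi> y"

lemma S_arg_min: "S = {f. is_arg_min objective (\<lambda>_. True) f}"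
  by (simp add: S_def solution_set_def objective_def[abs_def])

lemma in_S_iff: "f \<in> S \<longleftrightarrow> (\<forall>g. objective f \<le> objective g)"
  by (auto simp: S_arg_min is_arg_min_def not_less)

lemma seminorm_add_Np:
  assumes "q \<in> span (p ` {1..N})"
  shows "seminorm (f + q) = seminorm f"
  using proj_Np_apply_U[of _ q] proj_Np_span[OF assms]
  by (intro seminorm_cong) (simp add: blinfun.add_left)

lemma measure_op_combination_p: "measure_op \<nu> (\<Sum>n=1..N. b n *\<^sub>R p n) = (\<Sum>n=1..N. b n *\<^sub>R v n)"
  by (simp add: v_def linear_sum[OF linear_measure_op] measure_op_scaleR)

lemma measure_op_Np: "measure_op \<nu> ` span (p ` {1..N}) = span (v ` {1..N})"
  by (simp add: v_def linear_span_image[OF linear_measure_op, symmetric] image_image)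

text \<open>
  A sum is at most \<open>c\<close> if and only if no \<open>\<beta>\<close> lies strictly below the second summand while \<open>c - \<beta>\<close> lies
  strictly below the first.  In this form, lower semicontinuity of the sum is read off from
  closedness of the sublevel sets of the two summands.
\<close>

lemma objective_le_iff:
  "objective f \<le> ereal c \<longleftrightarrow> (\<forall>\<beta>. E y (measure_op \<nu> f) \<le> ereal (c - \<beta>) \<or> \<psi> (seminorm f) \<le> \<beta>)"
proof -
  have "0 \<le> E y (measure_op \<nu> f)" by (rule E_nonneg)
  then show ?thesis
  proof (cases "E y (measure_op \<nu> f)")
    case (real e)
    have "e + \<psi> (seminorm f) \<le> c" if "\<forall>\<beta>. e \<le> c - \<beta> \<or> \<psi> (seminorm f) \<le> \<beta>"
    proof (rule dense_le)
      fix a assume "a < e + \<psi> (seminorm f)"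
      then show "a \<le> c" using that[rule_format, of "a - e"] by auto
    qed
    then show ?thesis by (auto simp: objective_def real)
  next
    case PInf
    then show ?thesis by (auto simp: objective_def intro: exI[of _ "\<psi> (seminorm f) - 1"])
  qed auto
qed

lemma closedin_objective: "closedin weak_star {f. objective f \<le> ereal c}"
proof -
  have "closedin weak_star {f. \<psi> (seminorm f) \<le> \<beta>}" for \<beta>
  proof -
    obtain \<rho> where "\<And>r. 0 \<le> r \<Longrightarrow> \<psi> r \<le> \<beta> \<longleftrightarrow> r \<le> \<rho>"
      using strict_mono_convex_sublevel[OF \<psi>_strict_mono \<psi>_convex] by blast
    then have "{f. \<psi> (seminorm f) \<le> \<beta>} = {f. seminorm f \<le> \<rho>}" using seminorm_nonneg by blast
    then show ?thesis using closedin_seminorm_le by simp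
  qed
  moreover have "closedin weak_star {f. E y (measure_op \<nu> f) \<le> e}" for e
    using closedin_weak_star_vimage[OF continuous_map_measure_op closed_lsc_sublevel[OF E_lsc, of y e]] by simp
  moreover have "{f. objective f \<le> ereal c}
      = (\<Inter>\<beta>. {f. E y (measure_op \<nu> f) \<le> ereal (c - \<beta>)} \<union> {f. \<psi> (seminorm f) \<le> \<beta>})"
    using objective_le_iff by auto
  ultimately show ?thesis by (auto intro!: closedin_Inter closedin_Un)
qed

lemma norm_measure_op_le: "norm (measure_op \<nu> f) \<le> norm f * (\<Sum>i\<in>UNIV. norm (\<nu> i))"
proof -
  have "norm (measure_op \<nu> f) \<le> (\<Sum>i\<in>UNIV. \<bar>blinfun_apply f (\<nu> i)\<bar>)"
    using norm_le_l1_cart[of "measure_op \<nu> f"] by (simp add: measure_op_def)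
  also have "\<dots> \<le> (\<Sum>i\<in>UNIV. norm f * norm (\<nu> i))"
    using norm_blinfun[of f] by (intro sum_mono) simp
  finally show ?thesis by (simp add: sum_distrib_left)
qed

text \<open>
  The two summands, being nonnegative, are bounded separately.  Bounds on \<open>measure_op \<nu> f\<close> and on
  the penalized component bound the measurements of the null-space component, hence its
  coefficients.
\<close>

lemma bounded_objective:
  obtains R where "0 \<le> R" "\<And>f. objective f \<le> ereal c \<Longrightarrow> norm f \<le> R"
proof -
  obtain B where B: "\<And>z. E y z \<le> ereal c \<Longrightarrow> norm z \<le> B"
    using bounded_coercive_sublevel[OF E_coercive] by blast
  obtain \<rho> where \<rho>: "\<And>r. 0 \<le> r \<Longrightarrow> \<psi> r \<le> c \<longleftrightarrow> r \<le> \<rho>"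
    using strict_mono_convex_sublevel[OF \<psi>_strict_mono \<psi>_convex] by blast
  obtain C where C: "0 \<le> C" "\<And>b n. n \<in> {1..N} \<Longrightarrow> \<bar>b n\<bar> \<le> C * norm (\<Sum>k=1..N. b k *\<^sub>R v k)"
    using coefficient_bound[OF v_indep] by blast
  define D where "D = (\<Sum>i\<in>UNIV. norm (\<nu> i))"
  define R where "R = \<rho> / Z (1, 0) + (\<Sum>n=1..N. (C * (B + \<rho> / Z (1, 0) * D)) * norm (p n))"
  have "norm f \<le> R" if f: "objective f \<le> ereal c" for f
  proof -
    have sep: "E y (measure_op \<nu> f) \<le> ereal c" "\<psi> (seminorm f) \<le> c"
    proof -
      have "0 \<le> \<psi> (seminorm f)" using \<psi>_nonneg seminorm_nonneg by blast
      then have "E y (measure_op \<nu> f) + 0 \<le> objective f"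
        unfolding objective_def by (intro add_left_mono) simp
      then show "E y (measure_op \<nu> f) \<le> ereal c" using f by (simp add: order_trans)
      have "0 + ereal (\<psi> (seminorm f)) \<le> objective f"
        unfolding objective_def using E_nonneg by (intro add_right_mono)
      then show "\<psi> (seminorm f) \<le> c" using f by (metis add_0 ereal_less_eq(3) order_trans)
    qed
    have sn: "seminorm f \<le> \<rho>" using sep(2) \<rho> seminorm_nonneg by blast
    define s where "s = proj_Udual N p ps f"
    have ns: "norm s \<le> \<rho> / Z (1, 0)"
      using order_trans[OF norm_Udual_le[OF proj_Udual_in, of f] divide_right_mono[of "seminorm (proj_Udual N p ps f)" \<rho> "Z (1, 0)"]]
        sn Z_pos(1) by (simp add: s_def)
    have f_eq: "f = (\<Sum>n=1..N. blinfun_apply f (ps n) *\<^sub>R p n) + s"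
      by (simp add: s_def proj_Udual_def proj_Np_def)
    have "measure_op \<nu> f - measure_op \<nu> s = (\<Sum>n=1..N. blinfun_apply f (ps n) *\<^sub>R v n)"
      by (subst f_eq) (simp only: measure_op_add measure_op_combination_p add_diff_cancel_right')
    then have "norm (\<Sum>n=1..N. blinfun_apply f (ps n) *\<^sub>R v n) \<le> norm (measure_op \<nu> f) + norm (measure_op \<nu> s)"
      using norm_triangle_ineq4[of "measure_op \<nu> f" "measure_op \<nu> s"] by simp
    also have "\<dots> \<le> B + \<rho> / Z (1, 0) * D"
      using B[OF sep(1)] norm_measure_op_le[of s] mult_right_mono[OF ns, of D]
      by (simp add: D_def sum_nonneg)
    finally have vb: "C * norm (\<Sum>n=1..N. blinfun_apply f (ps n) *\<^sub>R v n) \<le> C * (B + \<rho> / Z (1, 0) * D)"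
      using C(1) by (rule mult_left_mono)
    have "norm f \<le> seminorm f / Z (1, 0) + (\<Sum>n=1..N. \<bar>blinfun_apply f (ps n)\<bar> * norm (p n))"
      by (rule norm_le_seminorm)
    also have "\<dots> \<le> R" unfolding R_def
    proof (intro add_mono sum_mono mult_right_mono)
      show "seminorm f / Z (1, 0) \<le> \<rho> / Z (1, 0)" using sn Z_pos(1) by (simp add: divide_right_mono)
      show "\<bar>blinfun_apply f (ps n)\<bar> \<le> C * (B + \<rho> / Z (1, 0) * D)" if "n \<in> {1..N}" for n
        using C(2)[OF that, of "\<lambda>n. blinfun_apply f (ps n)"] vb by linarith
    qed simp
    finally show ?thesis .
  qed
  then have "norm f \<le> max 0 R" if "objective f \<le> ereal c" for f using that by (meson max.coboundedI2)
  then show ?thesis by (intro that[of "max 0 R"]) auto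
qed

lemma compactin_objective: "compactin weak_star {f. objective f \<le> ereal c}"
proof -
  obtain R where R: "0 \<le> R" "\<And>f. objective f \<le> ereal c \<Longrightarrow> norm f \<le> R"
    using bounded_objective by blast
  show ?thesis
    by (rule closed_compactin[OF Banach_Alaoglu[OF R(1)] _ closedin_objective]) (use R(2) in auto)
qed

lemma finite_objective: obtains f where "objective f < \<infinity>"
proof -
  obtain z where z: "E y z < \<infinity>" using E_proper by (auto simp: proper_loss_def)
  obtain f where "measure_op \<nu> f = z" using measure_op_surj[OF \<nu>_indep] by blast
  then have "objective f < \<infinity>" using z by (auto simp: objective_def)
  then show ?thesis by (rule that)
qed

lemma objective_nonneg: "0 \<le> objective f"
  unfolding objective_def using E_nonneg \<psi>_nonneg[OF seminorm_nonneg] by simp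

lemma S_nonempty: "S \<noteq> {}" and S_compact: "compactin weak_star S"
proof -
  obtain f where f: "objective f < \<infinity>" by (rule finite_objective)
  show "S \<noteq> {}" "compactin weak_star S"
    unfolding S_arg_min
    using compactin_sublevels_arg_min[OF Hausdorff_weak_star compactin_objective objective_nonneg f] by auto
qed

lemma S_loss_finite:
  assumes "f \<in> S"
  obtains e where "E y (measure_op \<nu> f) = ereal e"
proof -
  obtain g where "objective g < \<infinity>" by (rule finite_objective)
  then have "objective f < \<infinity>" using assms by (auto simp: in_S_iff intro: le_less_trans)
  then have "E y (measure_op \<nu> f) < \<infinity>" by (auto simp: objective_def)
  then show ?thesis using E_nonneg[of y "measure_op \<nu> f"] that by (cases "E y (measure_op \<nu> f)") auto
qed

lemma \<psi>_seminorm_convex: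
  assumes "0 \<le> t" "t \<le> 1"
  shows "\<psi> (seminorm (t *\<^sub>R f + (1 - t) *\<^sub>R g)) \<le> t * \<psi> (seminorm f) + (1 - t) * \<psi> (seminorm g)"
proof -
  have "seminorm (t *\<^sub>R f + (1 - t) *\<^sub>R g) \<le> t * seminorm f + (1 - t) * seminorm g"
    using seminorm_triangle[of "t *\<^sub>R f" "(1 - t) *\<^sub>R g"] assms by (simp add: seminorm_scaleR)
  then have "\<psi> (seminorm (t *\<^sub>R f + (1 - t) *\<^sub>R g)) \<le> \<psi> (t * seminorm f + (1 - t) * seminorm g)"
    using seminorm_nonneg assms by (intro strict_mono_on_leD[OF \<psi>_strict_mono]) auto
  also have "\<dots> \<le> t * \<psi> (seminorm f) + (1 - t) * \<psi> (seminorm g)"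
    using convex_onD[OF \<psi>_convex, of "1 - t" "seminorm f" "seminorm g"] assms seminorm_nonneg by simp
  finally show ?thesis .
qed

lemma S_value_eq: "f \<in> S \<Longrightarrow> g \<in> S \<Longrightarrow> objective f = objective g"
  by (meson in_S_iff antisym)

lemma convex_S: "convex S"
proof (rule convexI)
  fix f g and s t :: real
  assume fg: "f \<in> S" "g \<in> S" and st: "0 \<le> s" "0 \<le> t" "s + t = 1"
  show "s *\<^sub>R f + t *\<^sub>R g \<in> S"
  proof (cases "s = 0 \<or> t = 0")
    case True
    then show ?thesis using fg st by auto
  next
    case False
    then have s: "s \<in> {0<..<1}" "t = 1 - s" using st by auto
    obtain a where a: "E y (measure_op \<nu> f) = ereal a" using S_loss_finite[OF fg(1)] .
    obtain b where b: "E y (measure_op \<nu> g) = ereal b" using S_loss_finite[OF fg(2)] .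
    define h where "h = s *\<^sub>R f + (1 - s) *\<^sub>R g"
    have "E y (measure_op \<nu> h) \<le> ereal s * E y (measure_op \<nu> f) + ereal (1 - s) * E y (measure_op \<nu> g)"
      unfolding h_def measure_op_add measure_op_scaleR using E_convex s(1) unfolding convex_loss_def by blast
    then have "E y (measure_op \<nu> h) \<le> ereal (s * a + (1 - s) * b)" by (simp add: a b)
    moreover have "\<psi> (seminorm h) \<le> s * \<psi> (seminorm f) + (1 - s) * \<psi> (seminorm g)"
      unfolding h_def using s by (intro \<psi>_seminorm_convex) auto
    ultimately have "objective h \<le> ereal (s * a + (1 - s) * b) + ereal (s * \<psi> (seminorm f) + (1 - s) * \<psi> (seminorm g))"
      unfolding objective_def by (intro add_mono) auto
    also have "\<dots> = ereal (s * (a + \<psi> (seminorm f)) + (1 - s) * (b + \<psi> (seminorm g)))"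
      by (simp add: algebra_simps)
    also have "a + \<psi> (seminorm f) = b + \<psi> (seminorm g)"
      using S_value_eq[OF fg] by (simp add: objective_def a b)
    also have "ereal (s * (b + \<psi> (seminorm g)) + (1 - s) * (b + \<psi> (seminorm g))) = objective g"
      by (simp add: objective_def b algebra_simps)
    finally have "objective h \<le> objective g" .
    then have "h \<in> S" using fg(2) by (auto simp: in_S_iff intro: order_trans)
    then show ?thesis by (simp add: h_def s(2))
  qed
qed

section \<open>Solutions share their measurements and their semi-norm\<close>

text \<open>
  With a strictly convex loss, the midpoint of two solutions with different measurements would have
  a smaller objective.  Once the losses agree, so do the penalties, and \<open>\<psi>\<close> is injective.
\<close>

lemma S_common_data:
  assumes E: "strictly_convex_loss E \<or> equality_loss E" and fg: "f \<in> S" "g \<in> S"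
  shows "measure_op \<nu> f = measure_op \<nu> g" "seminorm f = seminorm g"
proof -
  obtain a where a: "E y (measure_op \<nu> f) = ereal a" using S_loss_finite[OF fg(1)] .
  obtain b where b: "E y (measure_op \<nu> g) = ereal b" using S_loss_finite[OF fg(2)] .
  show eq: "measure_op \<nu> f = measure_op \<nu> g"
    using E
  proof
    assume "equality_loss E"
    then show ?thesis using a b unfolding equality_loss_def by (metis PInfty_neq_ereal(1))
  next
    assume sc: "strictly_convex_loss E"
    show ?thesis
    proof (rule ccontr)
      assume ne: "measure_op \<nu> f \<noteq> measure_op \<nu> g"
      define h where "h = (1/2) *\<^sub>R f + (1 - 1/2) *\<^sub>R g"
      have "E y (measure_op \<nu> h) < ereal (1/2) * E y (measure_op \<nu> f) + ereal (1 - 1/2) * E y (measure_op \<nu> g)"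
        unfolding h_def measure_op_add measure_op_scaleR
        by (rule sc[unfolded strictly_convex_loss_def, rule_format]) (use ne a b in auto)
      then have less: "E y (measure_op \<nu> h) < ereal (a / 2 + b / 2)" by (simp add: a b)
      then obtain c where c: "E y (measure_op \<nu> h) = ereal c" "c < a / 2 + b / 2"
        using E_nonneg[of y "measure_op \<nu> h"] by (cases "E y (measure_op \<nu> h)") auto
      have "\<psi> (seminorm h) \<le> (1/2) * \<psi> (seminorm f) + (1 - 1/2) * \<psi> (seminorm g)"
        unfolding h_def by (intro \<psi>_seminorm_convex) auto
      moreover have "a + \<psi> (seminorm f) = b + \<psi> (seminorm g)"
        using S_value_eq[OF fg] by (simp add: objective_def a b)
      ultimately have "objective h < objective f" using c by (simp add: objective_def a)
      then show False using fg(1) by (auto simp: in_S_iff not_le[symmetric])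
    qed
  qed
  have "\<psi> (seminorm f) = \<psi> (seminorm g)" using S_value_eq[OF fg] eq a by (simp add: objective_def)
  then show "seminorm f = seminorm g"
    using strict_mono_on_imp_inj_on[OF \<psi>_strict_mono] seminorm_nonneg by (auto dest: inj_onD)
qed

lemma in_S_if_same_data:
  assumes "f \<in> S" "measure_op \<nu> g = measure_op \<nu> f" "seminorm g \<le> seminorm f"
  shows "g \<in> S"
proof -
  have "\<psi> (seminorm g) \<le> \<psi> (seminorm f)"
    using assms(3) seminorm_nonneg by (intro strict_mono_on_leD[OF \<psi>_strict_mono]) auto
  then have "objective g \<le> objective f" unfolding objective_def assms(2) by (intro add_left_mono) simp
  then show ?thesis using assms(1) by (auto simp: in_S_iff intro: order_trans)
qed

lemma S_seminorm_minimal: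
  assumes "f \<in> S" "measure_op \<nu> g = measure_op \<nu> f"
  shows "seminorm f \<le> seminorm g"
proof (rule ccontr)
  assume "\<not> seminorm f \<le> seminorm g"
  then have "\<psi> (seminorm g) < \<psi> (seminorm f)"
    using seminorm_nonneg by (intro strict_mono_onD[OF \<psi>_strict_mono]) auto
  moreover obtain a where "E y (measure_op \<nu> f) = ereal a" using S_loss_finite[OF assms(1)] .
  ultimately have "objective g < objective f" by (simp add: objective_def assms(2))
  then show False using assms(1) by (auto simp: in_S_iff not_le[symmetric])
qed


section \<open>The reduced functions and the common conjugate\<close>

abbreviation w :: "nat \<Rightarrow> real ^ 'm"
  where "w \<equiv> reduced_vec N K v u"

text \<open>
  The reduced functions form the part of the analysis space that lies in \<open>\<U>\<close>, see
  \<open>analysis_eq_\<nu>t_sum\<close>.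
\<close>

definition \<nu>t :: "nat \<Rightarrow> 'x"
  where "\<nu>t m = analysis \<nu> (w m)"

lemma biorthogonal_w: "m \<in> {1..K} \<Longrightarrow> biorthogonal N K v u m (w m)"
  unfolding reduced_vec_def by (rule theI'[OF biorthogonal_ex1[OF K_def M_gt u_compl]])

lemma w_v: "m \<in> {1..K} \<Longrightarrow> n \<in> {1..N} \<Longrightarrow> w m \<bullet> v n = 0"
  and w_u: "m \<in> {1..K} \<Longrightarrow> m' \<in> {1..K} \<Longrightarrow> w m \<bullet> u m' = (if m = m' then 1 else 0)"
  using biorthogonal_w unfolding biorthogonal_def by blast+

lemma analysis_in_Uspace_iff: "analysis \<nu> c \<in> Uspace N p \<longleftrightarrow> (\<forall>n\<in>{1..N}. c \<bullet> v n = 0)"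
  by (simp add: Uspace_def apply_analysis v_def)

lemma \<nu>t_in_Uspace: "m \<in> {1..K} \<Longrightarrow> \<nu>t m \<in> Uspace N p"
  by (auto simp: \<nu>t_def analysis_in_Uspace_iff w_v simp del: atLeastAtMost_iff)

lemma analysis_eq_\<nu>t_sum:
  assumes "\<And>n. n \<in> {1..N} \<Longrightarrow> c \<bullet> v n = 0"
  shows "analysis \<nu> c = (\<Sum>m=1..K. (c \<bullet> u m) *\<^sub>R \<nu>t m)"
proof -
  have "c - (\<Sum>m=1..K. (c \<bullet> u m) *\<^sub>R w m) = 0"
  proof (rule zero_if_orthogonal[OF K_def M_gt u_compl])
    fix n assume "n \<in> {1..N}"
    then show "(c - (\<Sum>m=1..K. (c \<bullet> u m) *\<^sub>R w m)) \<bullet> v n = 0"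
      by (simp add: inner_diff_left inner_sum_left assms w_v del: atLeastAtMost_iff)
  next
    fix k assume k: "k \<in> {1..K}"
    have "(\<Sum>m=1..K. (c \<bullet> u m) *\<^sub>R w m) \<bullet> u k = (\<Sum>m=1..K. if m = k then c \<bullet> u m else 0)"
      unfolding inner_sum_left using k by (intro sum.cong refl) (auto simp: w_u simp del: atLeastAtMost_iff)
    then show "(c - (\<Sum>m=1..K. (c \<bullet> u m) *\<^sub>R w m)) \<bullet> u k = 0" using k by (simp add: inner_diff_left)
  qed
  then have "c = (\<Sum>m=1..K. (c \<bullet> u m) *\<^sub>R w m)" by simp
  then have "analysis \<nu> c = analysis \<nu> (\<Sum>m=1..K. (c \<bullet> u m) *\<^sub>R w m)" by simp
  then show ?thesis
    by (simp add: linear_sum[OF linear_analysis] linear_scale[OF linear_analysis] \<nu>t_def)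
qed

lemma span_u_eq_0:
  assumes b: "b \<in> span (u ` {1..K})" and zero: "\<And>m. m \<in> {1..K} \<Longrightarrow> w m \<bullet> b = 0"
  shows "b = 0"
proof -
  have "b = (\<Sum>m=1..K. (w m \<bullet> b) *\<^sub>R u m)"
    using b
  proof (induction rule: span_induct_alt)
    case (step c x z)
    then obtain k where k: "k \<in> {1..K}" "x = u k" by auto
    have "(\<Sum>m=1..K. (w m \<bullet> x) *\<^sub>R u m) = (\<Sum>m=1..K. if m = k then u m else 0)"
      unfolding k(2) using k(1) by (intro sum.cong refl) (auto simp: w_u simp del: atLeastAtMost_iff)
    also have "\<dots> = x" using k by simp
    finally have x: "(\<Sum>m=1..K. (w m \<bullet> x) *\<^sub>R u m) = x" .
    have "(\<Sum>m=1..K. (w m \<bullet> (c *\<^sub>R x + z)) *\<^sub>R u m)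
        = c *\<^sub>R (\<Sum>m=1..K. (w m \<bullet> x) *\<^sub>R u m) + (\<Sum>m=1..K. (w m \<bullet> z) *\<^sub>R u m)"
      by (simp add: inner_add_right scaleR_left_distrib sum.distrib scaleR_sum_right)
    then show ?case using step.IH unfolding x by simp
  qed simp
  also have "\<dots> = 0" using zero by (intro sum.neutral) auto
  finally show ?thesis .
qed

lemma in_span_v:
  assumes zero: "\<And>m. m \<in> {1..K} \<Longrightarrow> w m \<bullet> g = 0"
  shows "g \<in> span (v ` {1..N})"
proof -
  have "g \<in> {a + b | a b. a \<in> span (v ` {1..N}) \<and> b \<in> span (u ` {1..K})}"
    using u_compl by (simp add: direct_sum_UNIV_def)
  then obtain a b where ab: "g = a + b" "a \<in> span (v ` {1..N})" "b \<in> span (u ` {1..K})" by blast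
  have "b = 0"
  proof (rule span_u_eq_0[OF ab(3)])
    fix m assume m: "m \<in> {1..K}"
    have "orthogonal (w m) a"
      using ab(2) by (rule orthogonal_to_span) (use w_v[OF m] in \<open>auto simp: orthogonal_def\<close>)
    then show "w m \<bullet> b = 0" using zero[OF m] ab(1) by (simp add: orthogonal_def inner_add_right)
  qed
  then show ?thesis using ab by simp
qed

text \<open>
  The values on the \<open>\<nu>t m\<close> determine the measurements up to those of an element of the null space.
\<close>

lemma same_\<nu>t_data:
  assumes "\<And>m. m \<in> {1..K} \<Longrightarrow> blinfun_apply g (\<nu>t m) = blinfun_apply f (\<nu>t m)"
  obtains q where "q \<in> span (p ` {1..N})" "measure_op \<nu> (g + q) = measure_op \<nu> f"
proof -
  have "measure_op \<nu> f - measure_op \<nu> g \<in> span (v ` {1..N})"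
    by (rule in_span_v) (use assms in \<open>simp add: \<nu>t_def apply_analysis inner_diff_right\<close>)
  then obtain q where "q \<in> span (p ` {1..N})" "measure_op \<nu> q = measure_op \<nu> f - measure_op \<nu> g"
    unfolding measure_op_Np[symmetric] by auto
  then show ?thesis using that[of q] by (simp add: measure_op_add)
qed

text \<open>
  The functional that \<open>f\<close> induces on the finite-dimensional space \<open>analysis \<nu> ` W\<close> attains its
  norm \<open>\<rho>\<close> at some \<open>x0\<close> of the unit ball.  Extending it without increase of the norm yields an
  element of \<open>\<U>'\<close> that competes with \<open>f\<close>, after correction by an element of the null space.  As \<open>f\<close>
  is a solution, its semi-norm is at most \<open>\<rho>\<close>; so the two are equal.
\<close>

lemma exists_norming_analysis:
  assumes f: "f \<in> S"
  obtains c where "\<And>n. n \<in> {1..N} \<Longrightarrow> c \<bullet> v n = 0" "nU (analysis \<nu> c) = seminorm f"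
    "blinfun_apply f (analysis \<nu> c) = (seminorm f)\<^sup>2"
proof -
  define W where "W = {c. \<forall>n\<in>{1..N}. c \<bullet> v n = 0}"
  define D where "D = {c \<in> W. norm (analysis \<nu> c) \<le> Z (1, 0)}"
  have W: "subspace W" by (auto simp: W_def subspace_def inner_add_left)
  have anU: "analysis \<nu> c \<in> Uspace N p" if "c \<in> W" for c
    using that by (simp add: analysis_in_Uspace_iff W_def)
  have nU_D: "nU (analysis \<nu> c) \<le> 1 \<longleftrightarrow> norm (analysis \<nu> c) \<le> Z (1, 0)" if "c \<in> W" for c
    unfolding nU_eq_norm[OF anU[OF that]] using Z_pos(1) by (simp add: pos_divide_le_eq)
  obtain \<delta> where \<delta>: "0 < \<delta>" "\<And>c :: real ^ 'm. \<delta> * norm c \<le> norm (analysis \<nu> c)"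
    using basis_coefficients_bounded[OF \<nu>_indep] unfolding analysis_def by blast
  have "closed D"
  proof -
    have "D = (\<Inter>n\<in>{1..N}. {c. c \<bullet> v n = 0}) \<inter> {c. norm (analysis \<nu> c) \<le> Z (1, 0)}"
      by (auto simp: D_def W_def)
    then show ?thesis unfolding analysis_def
      by (auto intro!: closed_Int closed_INT closed_Collect_eq closed_Collect_le continuous_intros)
  qed
  moreover have "norm c \<le> Z (1, 0) / \<delta>" if "c \<in> D" for c
    using \<delta>(2)[of c] that \<delta>(1) by (simp add: D_def field_simps)
  then have "bounded D" by (auto simp: bounded_iff)
  ultimately have "compact D" by (simp add: compact_eq_bounded_closed)
  moreover have "0 \<in> D"
    using subspace_0[OF W] Z_pos(1) by (simp add: D_def linear_0[OF linear_analysis])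
  moreover have "continuous_on D (\<lambda>c. c \<bullet> measure_op \<nu> f)" by (intro continuous_intros)
  ultimately obtain c0 where c0: "c0 \<in> D" "\<And>c. c \<in> D \<Longrightarrow> c \<bullet> measure_op \<nu> f \<le> c0 \<bullet> measure_op \<nu> f"
    using continuous_attains_sup[of D "\<lambda>c. c \<bullet> measure_op \<nu> f"] by blast
  define \<rho> where "\<rho> = c0 \<bullet> measure_op \<nu> f"
  have "0 \<le> \<rho>" using c0(2)[OF \<open>0 \<in> D\<close>] by (simp add: \<rho>_def)
  have c0W: "c0 \<in> W" using c0(1) by (simp add: D_def)
  define x0 where "x0 = analysis \<nu> c0"
  have x0: "x0 \<in> Uspace N p" "nU x0 \<le> 1" "blinfun_apply f x0 = \<rho>"
    using anU[OF c0W] nU_D[OF c0W] c0(1) by (auto simp: x0_def D_def \<rho>_def apply_analysis)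
  have bound: "blinfun_apply f x \<le> \<rho> * nU x" if x: "x \<in> analysis \<nu> ` W" for x
  proof -
    obtain c where c: "c \<in> W" "x = analysis \<nu> c" using x by blast
    have xU: "x \<in> Uspace N p" using anU c by simp
    show ?thesis
    proof (cases "nU x = 0")
      case True
      then show ?thesis using nU_eq_0[OF xU] by simp
    next
      case False
      then have pos: "0 < nU x" using nU_nonneg[OF xU] by simp
      have cW: "(1 / nU x) *\<^sub>R c \<in> W" using W c(1) by (rule subspace_scale)
      have eq: "analysis \<nu> ((1 / nU x) *\<^sub>R c) = (1 / nU x) *\<^sub>R x"
        by (simp add: linear_scale[OF linear_analysis] c(2))
      have "nU (analysis \<nu> ((1 / nU x) *\<^sub>R c)) \<le> 1" unfolding eq using pos by (simp add: nU_scaleR[OF xU])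
      then have "(1 / nU x) *\<^sub>R c \<in> D" using nU_D[OF cW] cW by (simp add: D_def)
      then have "blinfun_apply f ((1 / nU x) *\<^sub>R x) \<le> \<rho>"
        using c0(2) unfolding eq[symmetric] apply_analysis \<rho>_def by blast
      then show ?thesis using pos by (simp add: blinfun.scaleR_right field_simps)
    qed
  qed
  obtain s where s: "s \<in> Udual N ps" "seminorm s \<le> \<rho>"
    "\<And>x. x \<in> analysis \<nu> ` W \<Longrightarrow> blinfun_apply s x = blinfun_apply f x"
  proof (rule Hahn_Banach_Udual[of "analysis \<nu> ` W" "blinfun_apply f" \<rho>])
    show "subspace (analysis \<nu> ` W)" by (rule linear_subspace_image[OF linear_analysis W])
    show "linear (blinfun_apply f)" by (rule linearI) (simp_all add: blinfun.bilinear_simps)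
  qed (use anU bound \<open>0 \<le> \<rho>\<close> in auto)
  have "blinfun_apply s (\<nu>t m) = blinfun_apply f (\<nu>t m)" if "m \<in> {1..K}" for m
    by (rule s(3)) (use w_v[OF that] in \<open>simp add: \<nu>t_def W_def\<close>)
  then obtain q where q: "q \<in> span (p ` {1..N})" "measure_op \<nu> (s + q) = measure_op \<nu> f"
    using same_\<nu>t_data by blast
  define r where "r = seminorm f"
  have "r \<le> \<rho>"
    using S_seminorm_minimal[OF f q(2)] s(2) seminorm_add_Np[OF q(1), of s] by (simp add: r_def)
  have "\<rho> \<le> r * nU x0" using seminorm_apply[OF x0(1), of f] by (simp add: x0(3) r_def)
  also have "r * nU x0 \<le> r * 1" using x0(2) seminorm_nonneg[of f] by (intro mult_left_mono) (auto simp: r_def)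
  finally have "\<rho> = r" using \<open>r \<le> \<rho>\<close> by simp
  have "r * nU x0 = r" using \<open>\<rho> \<le> r * nU x0\<close> \<open>r * nU x0 \<le> r * 1\<close> \<open>\<rho> = r\<close> by simp
  show ?thesis
  proof (rule that)
    \<comment> \<open>The factor \<open>r\<close> gives the norming point the norm that conjugacy requires; if \<open>r = 0\<close>, it is \<open>0\<close>.\<close>
    have c1: "r *\<^sub>R c0 \<in> W" using W c0W by (rule subspace_scale)
    then show "(r *\<^sub>R c0) \<bullet> v n = 0" if "n \<in> {1..N}" for n using that unfolding W_def by blast
    have eq: "analysis \<nu> (r *\<^sub>R c0) = r *\<^sub>R x0" by (simp add: linear_scale[OF linear_analysis] x0_def)
    show "nU (analysis \<nu> (r *\<^sub>R c0)) = seminorm f"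
      unfolding eq using \<open>r * nU x0 = r\<close> seminorm_nonneg[of f] by (simp add: nU_scaleR[OF x0(1)] r_def)
    show "blinfun_apply f (analysis \<nu> (r *\<^sub>R c0)) = (seminorm f)\<^sup>2"
      unfolding eq using x0(3) \<open>\<rho> = r\<close> by (simp add: blinfun.scaleR_right r_def power2_eq_square)
  qed
qed


text \<open>
  Both properties of the point from \<open>exists_norming_analysis\<close> depend on the solution only through
  its measurements and its semi-norm, so the point serves all solutions.
\<close>

lemma common_conjugate:
  assumes E: "strictly_convex_loss E \<or> equality_loss E"
  obtains a where "(\<Sum>m=1..K. a m *\<^sub>R \<nu>t m) \<in> span (range \<nu>) \<inter> Uspace N p"
    "\<And>f. f \<in> S \<Longrightarrow> conjugates N p ps nU (proj_Udual N p ps f) (\<Sum>m=1..K. a m *\<^sub>R \<nu>t m)"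
proof -
  obtain f where f: "f \<in> S" using S_nonempty by blast
  obtain c where c: "\<And>n. n \<in> {1..N} \<Longrightarrow> c \<bullet> v n = 0" "nU (analysis \<nu> c) = seminorm f"
    "blinfun_apply f (analysis \<nu> c) = (seminorm f)\<^sup>2"
    using exists_norming_analysis[OF f] by blast
  define x where "x = analysis \<nu> c"
  have x: "x \<in> Uspace N p" using c(1) by (simp add: x_def analysis_in_Uspace_iff)
  have conj: "conjugates N p ps nU (proj_Udual N p ps g) x" if g: "g \<in> S" for g
  proof -
    have "blinfun_apply g x = (seminorm f)\<^sup>2"
      using c(3) S_common_data(1)[OF E g f] by (simp add: x_def apply_analysis)
    moreover have "nU x = seminorm f" using c(2) by (simp add: x_def)
    ultimately show ?thesis
      unfolding conjugates_iff[OF proj_Udual_in x]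
      using S_common_data(2)[OF E g f] by (simp add: proj_Udual_apply_U[OF x] power2_eq_square)
  qed
  have "x = (\<Sum>m=1..K. (c \<bullet> u m) *\<^sub>R \<nu>t m)" unfolding x_def by (rule analysis_eq_\<nu>t_sum[OF c(1)])
  then show ?thesis
    using that[of "\<lambda>m. c \<bullet> u m"] conj x analysis_in_span[of \<nu> c] by (simp add: x_def)
qed

section \<open>Description of the solution set\<close>

text \<open>
  Two solutions with the same penalized component differ by an element of the null space whose
  measurements vanish, and the \<open>v n\<close> are linearly independent.
\<close>

lemma S_inj_proj:
  assumes E: "strictly_convex_loss E \<or> equality_loss E"
    and fg: "f \<in> S" "g \<in> S" "proj_Udual N p ps f = proj_Udual N p ps g"
  shows "f = g"
proof -
  define b where "b n = blinfun_apply f (ps n) - blinfun_apply g (ps n)" for n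
  have fg_eq: "f - g = (\<Sum>n=1..N. b n *\<^sub>R p n)"
  proof -
    have "f - g = proj_Np N p ps f - proj_Np N p ps g"
      using fg(3) by (simp add: proj_Udual_def algebra_simps)
    then show ?thesis by (simp add: proj_Np_def b_def scaleR_diff_left sum_subtractf)
  qed
  have "(\<Sum>n=1..N. b n *\<^sub>R v n) = measure_op \<nu> (f - g)"
    unfolding fg_eq by (rule measure_op_combination_p[symmetric])
  also have "\<dots> = 0" using S_common_data(1)[OF E fg(1,2)] by (simp add: measure_op_diff)
  finally have zero: "(\<Sum>n=1..N. b n *\<^sub>R v n) = 0" .
  obtain C where "\<And>b n. n \<in> {1..N} \<Longrightarrow> \<bar>b n\<bar> \<le> C * norm (\<Sum>k=1..N. b k *\<^sub>R v k)"
    using coefficient_bound[OF v_indep] by blast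
  from this[of _ b] have "b n = 0" if "n \<in> {1..N}" for n using that unfolding zero by force
  then have "f - g = 0" unfolding fg_eq by (intro sum.neutral) auto
  then show ?thesis by simp
qed

lemma solution_decomposition: "f = proj_Udual N p ps f + (\<Sum>n=1..N. blinfun_apply f (ps n) *\<^sub>R p n)"
  by (simp add: proj_Udual_def proj_Np_def)

lemma strictly_convex_solution:
  assumes E: "strictly_convex_loss E \<or> equality_loss E"
    and sc: "strictly_convex_norm_on (Udual N ps) seminorm"
  obtains f a b where "S = {f}"
    "f = duality_map N p ps nU (\<Sum>m=1..K. a m *\<^sub>R \<nu>t m) + (\<Sum>n=1..N. b n *\<^sub>R p n)"
proof -
  obtain a where a: "(\<Sum>m=1..K. a m *\<^sub>R \<nu>t m) \<in> span (range \<nu>) \<inter> Uspace N p"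
    "\<And>f. f \<in> S \<Longrightarrow> conjugates N p ps nU (proj_Udual N p ps f) (\<Sum>m=1..K. a m *\<^sub>R \<nu>t m)"
    using common_conjugate[OF E] by blast
  have J: "duality_map N p ps nU (\<Sum>m=1..K. a m *\<^sub>R \<nu>t m) = proj_Udual N p ps f" if "f \<in> S" for f
    using conjugates_duality_map(3)[OF sc _ a(2)[OF that]] a(1) by blast
  obtain f where f: "f \<in> S" using S_nonempty by blast
  have "g = f" if "g \<in> S" for g using S_inj_proj[OF E that f] J[OF that] J[OF f] by simp
  then have "S = {f}" using f by blast
  then show ?thesis using that[of f a "\<lambda>n. blinfun_apply f (ps n)"] J[OF f] solution_decomposition[of f] by simp
qed

text \<open>
  The projection onto \<open>\<U>'\<close> is linear, and injective on the convex set of solutions.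
\<close>

lemma extreme_solutions:
  assumes E: "strictly_convex_loss E \<or> equality_loss E"
  shows "{f \<in> S. proj_Udual N p ps f extreme_point_of (proj_Udual N p ps ` S)} = {f. f extreme_point_of S}"
proof (intro Collect_cong)
  fix f
  let ?P = "proj_Udual N p ps"
  have inj: "inj_on ?P S" using S_inj_proj[OF E] by (auto simp: inj_on_def)
  have lin: "?P ((1 - t) *\<^sub>R a + t *\<^sub>R b) = (1 - t) *\<^sub>R ?P a + t *\<^sub>R ?P b" for t a b
    by (simp add: proj_Udual_add proj_Udual_scaleR)
  have "?P f \<in> open_segment (?P a) (?P b) \<longleftrightarrow> f \<in> open_segment a b" if "f \<in> S" "a \<in> S" "b \<in> S" for a b
  proof -
    have "?P f = (1 - t) *\<^sub>R ?P a + t *\<^sub>R ?P b \<longleftrightarrow> f = (1 - t) *\<^sub>R a + t *\<^sub>R b" if t: "0 < t" "t < 1" for t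
    proof -
      have "(1 - t) *\<^sub>R a + t *\<^sub>R b \<in> S" using \<open>a \<in> S\<close> \<open>b \<in> S\<close> t by (intro convexD[OF convex_S]) auto
      then show ?thesis unfolding lin[symmetric] using inj_on_eq_iff[OF inj \<open>f \<in> S\<close>] by blast
    qed
    moreover have "?P a = ?P b \<longleftrightarrow> a = b" using inj_on_eq_iff[OF inj \<open>a \<in> S\<close> \<open>b \<in> S\<close>] .
    ultimately show ?thesis unfolding in_segment by blast
  qed
  then show "f \<in> S \<and> ?P f extreme_point_of (?P ` S) \<longleftrightarrow> f extreme_point_of S"
    unfolding extreme_point_of_def by blast
qed

text \<open>
  Suppose that the penalized component is not \<open>0\<close>.  Let \<open>s1\<close> be its quotient by its norm \<open>r\<close>, and \<open>L\<close> its space of face directions in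
  the unit ball.  A direction in \<open>L\<close> that all \<open>\<nu>t m\<close> annihilate would, corrected by an element of the
  null space, move \<open>f\<close> within the solution set in both senses; so it is \<open>0\<close>.  Moreover the common
  conjugate \<open>x\<close> is maximal over the ball at \<open>s1\<close>, so it annihilates \<open>L\<close> but not \<open>s1\<close>.  Therefore the
  \<open>K\<close> evaluations at \<open>\<nu>t m\<close> are jointly injective on \<open>L\<close> together with \<open>s1\<close>: although the face
  may have dimension \<open>K - 1\<close>, its points are combinations of \<open>K\<close>, not \<open>K + 1\<close>, extreme points
  of the ball.
\<close>

lemma extreme_solution_representation:
  assumes E: "strictly_convex_loss E \<or> equality_loss E"
    and f: "f extreme_point_of S"
  obtains K0 c e where "K0 \<le> K" "\<And>k. k \<in> {1..K0} \<Longrightarrow> e k extreme_point_of {s \<in> Udual N ps. seminorm s \<le> 1}"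
    "proj_Udual N p ps f = (\<Sum>k=1..K0. c k *\<^sub>R e k)"
proof -
  define B where "B = {s \<in> Udual N ps. seminorm s \<le> 1}"
  define s r where "s = proj_Udual N p ps f" and "r = seminorm f"
  have fS: "f \<in> S" using f by (simp add: extreme_point_of_def)
  have sU: "s \<in> Udual N ps" and sr: "seminorm s = r" by (simp_all add: s_def r_def proj_Udual_in)
  show ?thesis
  proof (cases "r = 0")
    case True
    then have "s = 0" using seminorm_eq_0[OF sU] sr by simp
    then show ?thesis using that[of 0] by (simp add: s_def)
  next
    case False
    then have r: "0 < r" using seminorm_nonneg[of f] by (simp add: r_def)
    obtain a where a: "(\<Sum>m=1..K. a m *\<^sub>R \<nu>t m) \<in> span (range \<nu>) \<inter> Uspace N p"
      "\<And>f. f \<in> S \<Longrightarrow> conjugates N p ps nU (proj_Udual N p ps f) (\<Sum>m=1..K. a m *\<^sub>R \<nu>t m)"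
      using common_conjugate[OF E] by blast
    define x where "x = (\<Sum>m=1..K. a m *\<^sub>R \<nu>t m)"
    have x: "x \<in> Uspace N p" "nU x = r" "blinfun_apply s x = r * r"
      using a(1) a(2)[OF fS] sr unfolding conjugates_def x_def[symmetric] s_def[symmetric] by auto
    have x0: "blinfun_apply g x = 0" if "\<And>m. m \<in> {1..K} \<Longrightarrow> blinfun_apply g (\<nu>t m) = 0" for g
      unfolding x_def blinfun.sum_right using that by (intro sum.neutral) (auto simp: blinfun.scaleR_right)
    define s1 where "s1 = (1 / r) *\<^sub>R s"
    have s1: "s1 \<in> B" "blinfun_apply s1 x = r" "r *\<^sub>R s1 = s"
      using sU sr r x(3) subspace_Udual
      by (auto simp: s1_def B_def seminorm_scaleR blinfun.scaleR_left intro: subspace_scale)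
    have B: "convex B"
    proof (rule convexI)
      fix g h and t t' :: real
      assume gh: "g \<in> B" "h \<in> B" "0 \<le> t" "0 \<le> t'" "t + t' = 1"
      have "seminorm (t *\<^sub>R g + t' *\<^sub>R h) \<le> t * seminorm g + t' * seminorm h"
        using seminorm_triangle[of "t *\<^sub>R g" "t' *\<^sub>R h"] gh by (simp add: seminorm_scaleR)
      also have "\<dots> \<le> t * 1 + t' * 1" using gh by (intro add_mono mult_left_mono) (auto simp: B_def)
      finally show "t *\<^sub>R g + t' *\<^sub>R h \<in> B"
        using gh subspace_Udual by (auto simp: B_def intro: subspace_add subspace_scale)
    qed
    define L where "L = face_directions B s1"
    have L: "subspace L" unfolding L_def by (rule subspace_face_directions[OF B s1(1)])
    have Lx: "blinfun_apply d x = 0" if d: "d \<in> L" for d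
    proof -
      obtain e where e: "0 < e" "s1 + e *\<^sub>R d \<in> B" "s1 - e *\<^sub>R d \<in> B"
        using d unfolding L_def face_directions_def by blast
      have le: "blinfun_apply g x \<le> r" if "g \<in> B" for g
      proof -
        have "\<bar>blinfun_apply g x\<bar> \<le> seminorm g * r" using seminorm_apply[OF x(1), of g] x(2) by simp
        also have "\<dots> \<le> 1 * r" using that r by (intro mult_right_mono) (auto simp: B_def)
        finally show ?thesis by simp
      qed
      show ?thesis using le[OF e(2)] le[OF e(3)] s1(2) e(1)
        by (simp add: blinfun.bilinear_simps zero_le_mult_iff mult_le_0_iff)
    qed
    have L0: "d = 0" if d: "d \<in> L" "\<And>m. m \<in> {1..K} \<Longrightarrow> blinfun_apply d (\<nu>t m) = 0" for d
    proof -
      obtain e where e: "0 < e" "s1 + e *\<^sub>R d \<in> B" "s1 - e *\<^sub>R d \<in> B"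
        using d(1) unfolding L_def face_directions_def by blast
      have "d = (1 / (2 * e)) *\<^sub>R ((s1 + e *\<^sub>R d) - (s1 - e *\<^sub>R d))"
        using e(1) by (simp flip: scaleR_2)
      also have "\<dots> \<in> Udual N ps"
        using subspace_scale[OF subspace_Udual subspace_diff[OF subspace_Udual]] e(2,3) by (simp only: B_def mem_Collect_eq)
      finally have dU: "d \<in> Udual N ps" .
      obtain q where q: "q \<in> span (p ` {1..N})" "measure_op \<nu> (d + q) = measure_op \<nu> 0"
        using same_\<nu>t_data[of d 0] d(2) by auto
      have q0: "measure_op \<nu> (d + q) = 0" using q(2) linear_0[OF linear_measure_op] by simp
      have mem: "f + t *\<^sub>R (d + q) \<in> S" if t: "s1 + (t / r) *\<^sub>R d \<in> B" for t
      proof (rule in_S_if_same_data[OF fS])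
        show "measure_op \<nu> (f + t *\<^sub>R (d + q)) = measure_op \<nu> f"
          using q0 by (simp add: measure_op_add measure_op_scaleR)
        have "seminorm (f + t *\<^sub>R (d + q)) = seminorm ((f + t *\<^sub>R d) + t *\<^sub>R q)"
          by (simp add: algebra_simps)
        also have "\<dots> = seminorm (f + t *\<^sub>R d)" using q(1) by (intro seminorm_add_Np span_scale)
        also have "\<dots> = seminorm (r *\<^sub>R (s1 + (t / r) *\<^sub>R d))"
        proof (rule seminorm_cong)
          fix z assume z: "z \<in> Uspace N p"
          have "r *\<^sub>R (s1 + (t / r) *\<^sub>R d) = s + t *\<^sub>R d"
            using r by (simp add: scaleR_right_distrib s1(3))
          then show "blinfun_apply (f + t *\<^sub>R d) z = blinfun_apply (r *\<^sub>R (s1 + (t / r) *\<^sub>R d)) z"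
            using proj_Udual_apply_U[OF z, of f] by (simp add: blinfun.bilinear_simps s_def)
        qed
        also have "\<dots> = r * seminorm (s1 + (t / r) *\<^sub>R d)" using r by (simp add: seminorm_scaleR)
        also have "\<dots> \<le> r * 1" using t r by (intro mult_left_mono) (auto simp: B_def)
        finally show "seminorm (f + t *\<^sub>R (d + q)) \<le> seminorm f" by (simp add: r_def)
      qed
      have "(r * e) *\<^sub>R (d + q) = 0"
      proof (rule extreme_point_symmetric[OF f])
        show "f + (r * e) *\<^sub>R (d + q) \<in> S" using mem[of "r * e"] e(2) r by simp
        show "f - (r * e) *\<^sub>R (d + q) \<in> S" using mem[of "- (r * e)"] e(3) r by simp
      qed
      then have "d = - q" using r e(1) by (simp only: scaleR_eq_0_iff) (simp add: add_eq_0_iff2)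
      then have "d \<in> span (p ` {1..N})" using q(1) by (simp add: span_neg)
      then show "d = 0" using proj_Np_span proj_Np_Udual[OF dU] by metis
    qed
    \<comment> \<open>The \<open>K\<close> evaluations, packed into a linear map with values in the span of the \<open>u m\<close>.\<close>
    define G where "G g = (\<Sum>m=1..K. blinfun_apply g (\<nu>t m) *\<^sub>R u m)" for g :: "'x \<Rightarrow>\<^sub>L real"
    have G: "linear G"
      by (rule linearI)
        (simp_all add: G_def blinfun.bilinear_simps scaleR_left_distrib sum.distrib scaleR_sum_right)
    define W where "W = span (insert s1 L)"
    have G_inj: "g = 0" if g: "g \<in> W" "G g = 0" for g
    proof -
      have g0: "blinfun_apply g (\<nu>t m) = 0" if m: "m \<in> {1..K}" for m
      proof -
        have "w m \<bullet> G g = (\<Sum>k=1..K. if k = m then blinfun_apply g (\<nu>t k) else 0)"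
          unfolding G_def inner_sum_right using m
          by (intro sum.cong refl) (auto simp: w_u simp del: atLeastAtMost_iff)
        then show ?thesis using m g(2) by simp
      qed
      \<comment> \<open>Evaluation at \<open>x\<close> is a combination of the evaluations at \<open>\<nu>t m\<close>, so it detects the multiple of \<open>s1\<close>.\<close>
      obtain k where k: "g - k *\<^sub>R s1 \<in> L"
        using g(1) span_breakdown_eq[of g s1 L] span_eq_iff[THEN iffD2, OF L] by (auto simp: W_def)
      have "blinfun_apply (g - k *\<^sub>R s1) x = - (k * r)"
        using x0[OF g0] s1(2) by (simp add: blinfun.bilinear_simps)
      then have "k = 0" using Lx[OF k] r by simp
      then show "g = 0" using k L0[of g] g0 by simp
    qed
    have dim: "card T \<le> K" if T: "finite T" "independent T" "T \<subseteq> W" for T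
    proof -
      have "span T \<subseteq> W" unfolding W_def by (rule span_minimal[OF T(3)[unfolded W_def] subspace_span])
      then have inj: "inj_on G (span T)"
        unfolding linear_inj_on_iff_eq_0[OF G subspace_span] using G_inj by blast
      then have "independent (G ` T)" by (rule linear_independent_injective_image[OF G T(2)])
      moreover have "G ` T \<subseteq> span (u ` {1..K})"
        unfolding G_def by (auto intro!: span_sum span_scale intro: span_base)
      ultimately have "card (G ` T) \<le> card (u ` {1..K})"
        using independent_span_bound[of "u ` {1..K}" "G ` T"] by simp
      also have "\<dots> \<le> K" using card_image_le[of "{1..K}" u] by simp
      finally show ?thesis using card_image[OF inj_on_subset[OF inj span_superset]] by simp
    qed
    have "s1 \<in> span ({e. e extreme_point_of B} \<inter> W)"
      unfolding W_def L_def
    proof (rule in_span_extreme_points[OF B _ s1(1), where k = K])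
      show "compact {t::real. g + t *\<^sub>R d \<in> B}" if "g \<in> B" "d \<noteq> 0" for g d
        using that unit_ball_line_compact[of g d] by (simp add: B_def)
      show "card T \<le> K" if "finite T" "independent T" "T \<subseteq> face_directions B s1" for T
        using that by (intro dim) (auto simp: W_def L_def intro: span_base)
    qed
    then obtain n c e where nce: "n \<le> K" "\<And>k. k \<in> {1..n} \<Longrightarrow> e k \<in> {e. e extreme_point_of B} \<inter> W"
      "s1 = (\<Sum>k=1..n. c k *\<^sub>R e k)"
      by (rule span_sum_of_at_most[where K = K]) (use dim in auto)
    have "s = (\<Sum>k=1..n. (r * c k) *\<^sub>R e k)"
      using s1(3) nce(3) by (simp add: scaleR_sum_right)
    then show ?thesis
      using that[of n e "\<lambda>k. r * c k"] nce(1,2) by (simp add: s_def B_def)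
  qed
qed

text \<open>
  If \<open>ps n\<close> is a combination of the \<open>\<nu> i\<close>, then the coefficient \<open>f (ps n)\<close> is a function of the
  measurements, which all solutions share.
\<close>

lemma unique_null_space_coefficients:
  assumes E: "strictly_convex_loss E" and sub: "span (ps ` {1..N}) \<subseteq> span (range \<nu>)"
  shows "\<exists>!b. b \<in> extensional {1..N} \<and> (\<forall>f\<in>S. proj_Np N p ps f = (\<Sum>n=1..N. b n *\<^sub>R p n))"
proof -
  obtain f where f: "f \<in> S" using S_nonempty by blast
  have const: "blinfun_apply g (ps n) = blinfun_apply f (ps n)" if g: "g \<in> S" and n: "n \<in> {1..N}" for g n
  proof -
    have "ps n \<in> span (ps ` {1..N})" using n by (intro span_base imageI)
    then have "ps n \<in> range (analysis \<nu>)" using sub unfolding span_range_eq_analysis[symmetric] by blast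
    then obtain c where "ps n = analysis \<nu> c" by blast
    then show ?thesis using S_common_data(1)[OF disjI1[OF E] g f] by (simp add: apply_analysis)
  qed
  show ?thesis
  proof (rule ex1I)
    let ?b = "restrict (\<lambda>n. blinfun_apply f (ps n)) {1..N}"
    show "?b \<in> extensional {1..N} \<and> (\<forall>g\<in>S. proj_Np N p ps g = (\<Sum>n=1..N. ?b n *\<^sub>R p n))"
      using const by (auto simp: proj_Np_def intro!: sum.cong)
    fix b assume b: "b \<in> extensional {1..N} \<and> (\<forall>g\<in>S. proj_Np N p ps g = (\<Sum>n=1..N. b n *\<^sub>R p n))"
    show "b = ?b"
    proof (rule extensionalityI[of _ "{1..N}"])
      fix n assume n: "n \<in> {1..N}"
      have "blinfun_apply (\<Sum>n=1..N. b n *\<^sub>R p n) (ps n) = blinfun_apply (\<Sum>n=1..N. blinfun_apply f (ps n) *\<^sub>R p n) (ps n)"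
        using b f by (simp add: proj_Np_def)
      then show "b n = ?b n" unfolding combination_p_apply_ps[OF n] using n by simp
    qed (use b in auto)
  qed
qed

end

section \<open>The representer theorem\<close>

theorem theorem3:
  fixes N K :: nat
    and p :: "nat \<Rightarrow> 'x::banach \<Rightarrow>\<^sub>L real" and ps :: "nat \<Rightarrow> 'x"
    and nU nN :: "'x \<Rightarrow> real" and Z :: "real \<times> real \<Rightarrow> real"
    and \<nu> :: "'m::finite \<Rightarrow> 'x" and v u :: "nat \<Rightarrow> real ^ 'm"
    and E :: "real ^ 'm \<Rightarrow> real ^ 'm \<Rightarrow> ereal" and \<psi> :: "real \<Rightarrow> real" and y :: "real ^ 'm"
    and U :: "'x set" and U' S Ext :: "('x \<Rightarrow>\<^sub>L real) set"
    and normU' :: "('x \<Rightarrow>\<^sub>L real) \<Rightarrow> real" and J :: "'x \<Rightarrow> ('x \<Rightarrow>\<^sub>L real)" and \<nu>t :: "nat \<Rightarrow> 'x"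
  assumes pair: "direct_sum_dual_pair N p ps nU nN Z"
    and \<nu>_indep: "lin_indep_family \<nu> UNIV"
    and M_gt: "CARD('m) > N"
    and K_def: "K = CARD('m) - N"
    and v_def: "v = (\<lambda>n. measure_op \<nu> (p n))"
    and v_indep: "lin_indep_family v {1..N}"
    and u_compl: "direct_sum_UNIV (span (v ` {1..N})) (span (u ` {1..K}))"
    and E_nonneg: "\<And>y z. 0 \<le> E y z"
    and E: "proper_loss E" "lsc_loss E" "coercive_loss E" "convex_loss E"
    and \<psi>_nonneg: "\<And>r. 0 \<le> r \<Longrightarrow> 0 \<le> \<psi> r"
    and \<psi>_strict_mono: "strict_mono_on {0..} \<psi>"
    and \<psi>_convex: "convex_on {0..} \<psi>"
    and U_def: "U = Uspace N p"
    and U'_def: "U' = Udual N ps"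
    and normU'_def: "normU' = Udual_norm N p nU"
    and J_def: "J = duality_map N p ps nU"
    and \<nu>t_def: "\<nu>t = (\<lambda>m. \<Sum>i\<in>UNIV. reduced_vec N K v u m $ i *\<^sub>R \<nu> i)"
    and S_def: "S = solution_set N p ps nU \<nu> E \<psi> y"
    and Ext_def: "Ext = {f \<in> S. proj_Udual N p ps f extreme_point_of (proj_Udual N p ps ` S)}"
  shows
    "S \<noteq> {} \<and> convex S \<and> compactin weak_star S \<and>
     (\<forall>m\<in>{1..K}. (\<exists>!w. biorthogonal N K v u m w) \<and> \<nu>t m \<in> U) \<and>
     (strictly_convex_loss E \<or> equality_loss E \<longrightarrow>
       (\<exists>a. (\<Sum>m=1..K. a m *\<^sub>R \<nu>t m) \<in> span (range \<nu>) \<inter> U \<and>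
         (\<forall>f\<in>S. (\<exists>!(q, s). q \<in> span (p ` {1..N}) \<and> s \<in> U' \<and> f = q + s) \<and>
           (\<forall>q\<in>span (p ` {1..N}). \<forall>s\<in>U'. f = q + s \<longrightarrow>
              conjugates N p ps nU s (\<Sum>m=1..K. a m *\<^sub>R \<nu>t m)))) \<and>
       (hilbert_norm_on U' normU' \<and> strictly_convex_on {0..} \<psi> \<longrightarrow>
         (\<exists>ip. inner_product_on U nU ip \<and>
           (\<forall>x\<in>U. J x \<in> U' \<and> (\<forall>w\<in>U. blinfun_apply (J x) w = ip x w))) \<and>
         (\<exists>f. S = {f} \<and>
           (\<exists>a b. f = (\<Sum>m=1..K. a m *\<^sub>R J (\<nu>t m)) + (\<Sum>n=1..N. b n *\<^sub>R p n)))) \<and>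
       (strictly_convex_norm_on U' normU' \<longrightarrow>
         (\<forall>x\<in>U. \<exists>!s. conjugates N p ps nU s x) \<and>
         (\<exists>f. S = {f} \<and>
           (\<exists>a b. f = J (\<Sum>m=1..K. a m *\<^sub>R \<nu>t m) + (\<Sum>n=1..N. b n *\<^sub>R p n)))) \<and>
       (\<not> strictly_convex_norm_on U' normU' \<longrightarrow>
         S = weak_star closure_of (convex hull Ext) \<and>
         (\<forall>f\<in>Ext. \<exists>K0\<le>K. \<exists>c e b.
            (\<forall>k\<in>{1..K0}. e k extreme_point_of {s \<in> U'. normU' s \<le> 1}) \<and>
            f = (\<Sum>k=1..K0. c k *\<^sub>R e k) + (\<Sum>n=1..N. b n *\<^sub>R p n)) \<and>
         (strictly_convex_loss E \<and> span (ps ` {1..N}) \<subseteq> span (range \<nu>) \<longrightarrow>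
            (\<exists>!b. b \<in> extensional {1..N} \<and>
              (\<forall>f\<in>S. proj_Np N p ps f = (\<Sum>n=1..N. b n *\<^sub>R p n))))))"
proof -
  interpret P: representer_problem N p ps nU nN Z K \<nu> v u E \<psi> y
    unfolding representer_problem_def representer_problem_axioms_def
    using pair \<nu>_indep M_gt K_def v_def v_indep u_compl E_nonneg E \<psi>_nonneg \<psi>_strict_mono \<psi>_convex
    by blast
  have \<nu>t: "\<nu>t = P.\<nu>t" by (simp add: \<nu>t_def P.\<nu>t_def fun_eq_iff analysis_def)
  have S: "S = P.S" by (simp add: S_def P.S_def)
  note defs = \<nu>t S U_def U'_def normU'_def J_def
  let ?P = "proj_Udual N p ps"
  have basic: "S \<noteq> {}" "convex S" "compactin weak_star S"
    unfolding S by (fact P.S_nonempty P.convex_S P.S_compact)+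
  have reduced: "(\<exists>!w. biorthogonal N K v u m w) \<and> \<nu>t m \<in> U" if "m \<in> {1..K}" for m
    unfolding defs using biorthogonal_ex1[OF K_def M_gt u_compl that] P.\<nu>t_in_Uspace[OF that] by blast
  have decomposition: "\<exists>!(q, s). q \<in> span (p ` {1..N}) \<and> s \<in> U' \<and> f = q + s" for f
  proof (rule ex1I[of _ "(proj_Np N p ps f, ?P f)"])
    show "case (proj_Np N p ps f, ?P f) of (q, s) \<Rightarrow> q \<in> span (p ` {1..N}) \<and> s \<in> U' \<and> f = q + s"
      using P.proj_Np_in P.proj_Udual_in by (simp add: U'_def proj_Udual_def)
    fix qs assume "case qs of (q, s) \<Rightarrow> q \<in> span (p ` {1..N}) \<and> s \<in> U' \<and> f = q + s"
    then show "qs = (proj_Np N p ps f, ?P f)"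
      using P.direct_sum_dual_unique[of "fst qs" "snd qs" f] by (cases qs) (simp add: U'_def)
  qed
  show ?thesis
  proof (intro conjI ballI impI)
    assume E': "strictly_convex_loss E \<or> equality_loss E"
    obtain a where a: "(\<Sum>m=1..K. a m *\<^sub>R \<nu>t m) \<in> span (range \<nu>) \<inter> U"
      "\<And>f. f \<in> S \<Longrightarrow> conjugates N p ps nU (?P f) (\<Sum>m=1..K. a m *\<^sub>R \<nu>t m)"
      unfolding defs using P.common_conjugate[OF E'] by blast
    show "\<exists>a. (\<Sum>m=1..K. a m *\<^sub>R \<nu>t m) \<in> span (range \<nu>) \<inter> U \<and>
         (\<forall>f\<in>S. (\<exists>!(q, s). q \<in> span (p ` {1..N}) \<and> s \<in> U' \<and> f = q + s) \<and>
           (\<forall>q\<in>span (p ` {1..N}). \<forall>s\<in>U'. f = q + s \<longrightarrow>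
              conjugates N p ps nU s (\<Sum>m=1..K. a m *\<^sub>R \<nu>t m)))"
    proof (intro exI conjI ballI impI)
      fix f q s assume f: "f \<in> S" "q \<in> span (p ` {1..N})" "s \<in> U'" "f = q + s"
      have "s = ?P f" using P.direct_sum_dual_unique(2)[of q s f] f by (simp add: U'_def)
      then show "conjugates N p ps nU s (\<Sum>m=1..K. a m *\<^sub>R \<nu>t m)" using a(2)[OF f(1)] by simp
    qed (rule decomposition a(1))+
  next
    assume E': "strictly_convex_loss E \<or> equality_loss E"
      and h: "hilbert_norm_on U' normU' \<and> strictly_convex_on {0..} \<psi>"
    have h': "hilbert_norm_on (Udual N ps) P.seminorm" using h by (simp add: defs)
    note sc = P.hilbert_imp_strictly_convex[OF h']
    obtain ip where ip: "inner_product_on U nU ip"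
      "\<And>x w. x \<in> U \<Longrightarrow> w \<in> U \<Longrightarrow> blinfun_apply (J x) w = ip x w"
      unfolding defs using P.hilbert_duality_map[OF h'] by blast
    moreover have "J x \<in> U'" if "x \<in> U" for x
      using P.conjugates_duality_map(2)[OF sc, of x] that by (simp add: defs conjugates_def)
    ultimately show "\<exists>ip. inner_product_on U nU ip \<and>
        (\<forall>x\<in>U. J x \<in> U' \<and> (\<forall>w\<in>U. blinfun_apply (J x) w = ip x w))" by blast
    obtain f a b where f: "S = {f}" "f = J (\<Sum>m=1..K. a m *\<^sub>R \<nu>t m) + (\<Sum>n=1..N. b n *\<^sub>R p n)"
      unfolding defs using P.strictly_convex_solution[OF E' sc] by blast
    moreover have "J (\<Sum>m=1..K. a m *\<^sub>R \<nu>t m) = (\<Sum>m=1..K. a m *\<^sub>R J (\<nu>t m))"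
      unfolding defs using P.\<nu>t_in_Uspace by (intro P.hilbert_duality_map_sum[OF h']) auto
    ultimately show "\<exists>f. S = {f} \<and>
        (\<exists>a b. f = (\<Sum>m=1..K. a m *\<^sub>R J (\<nu>t m)) + (\<Sum>n=1..N. b n *\<^sub>R p n))" by metis
  next
    assume E': "strictly_convex_loss E \<or> equality_loss E" and sc: "strictly_convex_norm_on U' normU'"
    have sc': "strictly_convex_norm_on (Udual N ps) P.seminorm" using sc by (simp add: defs)
    show "\<exists>!s. conjugates N p ps nU s x" if "x \<in> U" for x
      using P.conjugates_duality_map(1)[OF sc', of x] that by (simp add: defs)
    show "\<exists>f. S = {f} \<and> (\<exists>a b. f = J (\<Sum>m=1..K. a m *\<^sub>R \<nu>t m) + (\<Sum>n=1..N. b n *\<^sub>R p n))"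
      unfolding defs using P.strictly_convex_solution[OF E' sc'] by metis
  next
    assume E': "strictly_convex_loss E \<or> equality_loss E"
    have Ext: "Ext = {f. f extreme_point_of S}"
      unfolding Ext_def S by (rule P.extreme_solutions[OF E'])
    show "S = weak_star closure_of (convex hull Ext)"
      unfolding Ext by (rule Krein_Milman_weak_star[OF basic(3,2)])
    fix f assume "f \<in> Ext"
    then have f: "f extreme_point_of P.S" by (simp add: Ext S)
    obtain K0 e c where e: "K0 \<le> K"
      "\<And>k. k \<in> {1..K0} \<Longrightarrow> e k extreme_point_of {s \<in> Udual N ps. P.seminorm s \<le> 1}"
      "?P f = (\<Sum>k=1..K0. c k *\<^sub>R e k)"
      by (rule P.extreme_solution_representation[OF E' f]) (rule that; assumption)
    then have f_eq: "f = (\<Sum>k=1..K0. c k *\<^sub>R e k) + (\<Sum>n=1..N. blinfun_apply f (ps n) *\<^sub>R p n)"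
      using P.solution_decomposition[of f] by simp
    show "\<exists>K0\<le>K. \<exists>c e b. (\<forall>k\<in>{1..K0}. e k extreme_point_of {s \<in> U'. normU' s \<le> 1}) \<and>
        f = (\<Sum>k=1..K0. c k *\<^sub>R e k) + (\<Sum>n=1..N. b n *\<^sub>R p n)"
      unfolding defs
      by (rule exI[of _ K0], intro conjI e(1), rule exI[of _ c], rule exI[of _ e],
          rule exI[of _ "\<lambda>n. blinfun_apply f (ps n)"]) (intro conjI ballI e(2) f_eq)
  next
    assume "strictly_convex_loss E \<and> span (ps ` {1..N}) \<subseteq> span (range \<nu>)"
    then show "\<exists>!b. b \<in> extensional {1..N} \<and> (\<forall>f\<in>S. proj_Np N p ps f = (\<Sum>n=1..N. b n *\<^sub>R p n))"
      unfolding S using P.unique_null_space_coefficients by blast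
  qed (use basic reduced in auto)
qed

end
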